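(* Kleene's functional $\exists^3$ computes a $\zeta$-functional via a term of Gödel's system $T$, and every $\zeta$-functional computes $\exists^3$ via a term of Gödel's system $T$. Moreover, the system $\mathsf{RCA}_0^\omega$ proves $(\exists\zeta)\mathsf{NCC}(\zeta)\leftrightarrow(\exists^3)$.
   Context: $\mathsf{RCA}_0^\omega$ is Kohlenbach's base theory of higher-order reverse mathematics: a theory in the language of all finite types (type $0$ = natural numbers, $\sigma\to\tau$ = mappings from type $\sigma$ to type $\tau$; type $1$ = $\mathbb N^{\mathbb N}$, type $2$ = $\mathbb N^{\mathbb N}\to\mathbb N$, etc.), with constants $0,1,<,+,\times,=_0$, combinators and Gödel's recursors; its axioms are: ordered semiring axioms, combinator axioms, the defining axioms of the recursor $\mathbf R_0$, the axiom of extensionality at all finite types (equality at higher types defined pointwise from $=_0$), induction for quantifier-free formulas, and quantifier-free choice $\mathsf{QF\text{-}AC}^{1,0}$. Finite tuples of numbers and functions are coded into single arguments as usual. $2^{\mathbb N}$ is Cantor space. $(\exists^3)$ states: there is $E^3\le 1$ such that for all $Y^2$, $(\exists f^1)(Y(f)=0)\leftrightarrow E(Y)=0$; this $E$ is Kleene's $\exists^3$. For $\zeta$ of type $2\to1$, $\mathsf{NCC}(\zeta)$ states: for every $Y^2$, writing $A(n,m)\equiv(\exists f\in 2^{\mathbb N})(Y(f,m,n)=0)$, if $(\forall n^0)(\exists m^0)A(n,m)$ then $(\forall n^0)A(n,\zeta(Y)(n))$. A (total) $\zeta$ satisfying $\mathsf{NCC}(\zeta)$ is called a $\zeta$-functional.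 "Computes" refers to Kleene's S1–S9 computability; here the computation is given by a term of Gödel's $T$.
   Formalization: The first claim fails literally: terms of T in ∃³ are majorizable, while ζ(Y)(0) is unbounded over 0-1-valued Y. It is proved as: ∃³ computes a ζ-functional via a term of Gödel's T followed by one always-terminating unbounded search for its least zero. *)

theory Defs
  imports Main
begin

section \<open>Finite types and terms\<close>

datatype ty = N | Fn ty ty (infixr "\<leadsto>" 65)

abbreviation one :: ty where "one \<equiv> N \<leadsto> N"
abbreviation two :: ty where "two \<equiv> one \<leadsto> N"
abbreviation three :: ty where "three \<equiv> two \<leadsto> N"

datatype cst = Zero | One | Plus | Times | Pi ty ty | Sigma ty ty ty | Rec ty

text \<open>Variables carry their type, and de Bruijn indices are counted separately for each type:
  a quantifier over type \<open>\<rho>\<close> binds the variable of type \<open>\<rho>\<close> with index 0, and leaves the indices of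
  the variables of all other types alone.\<close>

datatype trm = Var ty nat | Cst cst | App trm trm (infixl "\<cdot>" 100)

fun cst_ty :: "cst \<Rightarrow> ty" where
  "cst_ty Zero = N"
| "cst_ty One = N"
| "cst_ty Plus = N \<leadsto> N \<leadsto> N"
| "cst_ty Times = N \<leadsto> N \<leadsto> N"
| "cst_ty (Pi \<rho> \<sigma>) = \<rho> \<leadsto> \<sigma> \<leadsto> \<rho>"
| "cst_ty (Sigma \<rho> \<sigma> \<tau>) = (\<rho> \<leadsto> \<sigma> \<leadsto> \<tau>) \<leadsto> (\<rho> \<leadsto> \<sigma>) \<leadsto> \<rho> \<leadsto> \<tau>"
| "cst_ty (Rec \<rho>) = (N \<leadsto> \<rho> \<leadsto> \<rho>) \<leadsto> \<rho> \<leadsto> N \<leadsto> \<rho>"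

text \<open>\<open>ty_of\<close> is meaningful on well-typed terms only.\<close>

fun ty_of :: "trm \<Rightarrow> ty" where
  "ty_of (Var \<rho> i) = \<rho>"
| "ty_of (Cst c) = cst_ty c"
| "ty_of (s \<cdot> t) = (case ty_of s of N \<Rightarrow> N | \<sigma> \<leadsto> \<tau> \<Rightarrow> \<tau>)"

fun wt :: "trm \<Rightarrow> bool" where
  "wt (Var \<rho> i) = True"
| "wt (Cst c) = True"
| "wt (s \<cdot> t) = (wt s \<and> wt t \<and> ty_of s = ty_of t \<leadsto> ty_of (s \<cdot> t))"

abbreviation has_ty :: "trm \<Rightarrow> ty \<Rightarrow> bool" where "has_ty t \<rho> \<equiv> wt t \<and> ty_of t = \<rho>"

fun closed_trm :: "trm \<Rightarrow> bool" where
  "closed_trm (Var \<rho> i) = False"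
| "closed_trm (Cst c) = True"
| "closed_trm (s \<cdot> t) = (closed_trm s \<and> closed_trm t)"

text \<open>Closed terms of Goedel's \<open>T\<close>. The successor is \<open>x + 1\<close>, and the recursors are available at
  all types; \<open>+\<close> and \<open>\<times>\<close> are definable from them.\<close>

definition T_term :: "ty \<Rightarrow> trm \<Rightarrow> bool" where
  "T_term \<rho> t \<longleftrightarrow> has_ty t \<rho> \<and> closed_trm t"

fun lift :: "ty \<Rightarrow> nat \<Rightarrow> trm \<Rightarrow> trm" where
  "lift \<rho> k (Var \<sigma> i) = (if \<sigma> = \<rho> \<and> k \<le> i then Var \<sigma> (Suc i) else Var \<sigma> i)"
| "lift \<rho> k (Cst c) = Cst c"
| "lift \<rho> k (s \<cdot> t) = lift \<rho> k s \<cdot> lift \<rho> k t"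

fun subst :: "ty \<Rightarrow> nat \<Rightarrow> trm \<Rightarrow> trm \<Rightarrow> trm" where
  "subst \<rho> k u (Var \<sigma> i) =
     (if \<sigma> = \<rho> then (if i < k then Var \<sigma> i else if i = k then u else Var \<sigma> (i - 1)) else Var \<sigma> i)"
| "subst \<rho> k u (Cst c) = Cst c"
| "subst \<rho> k u (s \<cdot> t) = subst \<rho> k u s \<cdot> subst \<rho> k u t"

text \<open>Bracket abstraction: \<open>lam \<rho> t\<close> binds the variable of type \<open>\<rho>\<close> with index 0 in \<open>t\<close>.\<close>

fun lam :: "ty \<Rightarrow> trm \<Rightarrow> trm" where
  "lam \<rho> (Var \<sigma> i) =
     (if \<sigma> = \<rho> \<and> i = 0
      then Cst (Sigma \<rho> (\<rho> \<leadsto> \<rho>) \<rho>) \<cdot> Cst (Pi \<rho> (\<rho> \<leadsto> \<rho>)) \<cdot> Cst (Pi \<rho> \<rho>)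
      else Cst (Pi \<sigma> \<rho>) \<cdot> Var \<sigma> (if \<sigma> = \<rho> then i - 1 else i))"
| "lam \<rho> (Cst c) = Cst (Pi (cst_ty c) \<rho>) \<cdot> Cst c"
| "lam \<rho> (s \<cdot> t) = Cst (Sigma \<rho> (ty_of t) (ty_of (s \<cdot> t))) \<cdot> lam \<rho> s \<cdot> lam \<rho> t"

abbreviation zero_tm :: trm where "zero_tm \<equiv> Cst Zero"
abbreviation one_tm :: trm where "one_tm \<equiv> Cst One"
abbreviation plus_tm :: "trm \<Rightarrow> trm \<Rightarrow> trm" where "plus_tm s t \<equiv> Cst Plus \<cdot> s \<cdot> t"
abbreviation times_tm :: "trm \<Rightarrow> trm \<Rightarrow> trm" where "times_tm s t \<equiv> Cst Times \<cdot> s \<cdot> t"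
abbreviation suc_tm :: "trm \<Rightarrow> trm" where "suc_tm s \<equiv> plus_tm s one_tm"

section \<open>Formulas\<close>

datatype fm = Fls | Eq trm trm | Less trm trm | And fm fm | Or fm fm | Imp fm fm
  | All ty fm | Ex ty fm

abbreviation Neg :: "fm \<Rightarrow> fm" where "Neg \<phi> \<equiv> Imp \<phi> Fls"
abbreviation Iff :: "fm \<Rightarrow> fm \<Rightarrow> fm" where "Iff \<phi> \<psi> \<equiv> And (Imp \<phi> \<psi>) (Imp \<psi> \<phi>)"

fun wff :: "fm \<Rightarrow> bool" where
  "wff Fls = True"
| "wff (Eq s t) = (has_ty s N \<and> has_ty t N)"
| "wff (Less s t) = (has_ty s N \<and> has_ty t N)"
| "wff (And \<phi> \<psi>) = (wff \<phi> \<and> wff \<psi>)"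
| "wff (Or \<phi> \<psi>) = (wff \<phi> \<and> wff \<psi>)"
| "wff (Imp \<phi> \<psi>) = (wff \<phi> \<and> wff \<psi>)"
| "wff (All \<rho> \<phi>) = wff \<phi>"
| "wff (Ex \<rho> \<phi>) = wff \<phi>"

fun qf :: "fm \<Rightarrow> bool" where
  "qf Fls = True"
| "qf (Eq s t) = True"
| "qf (Less s t) = True"
| "qf (And \<phi> \<psi>) = (qf \<phi> \<and> qf \<psi>)"
| "qf (Or \<phi> \<psi>) = (qf \<phi> \<and> qf \<psi>)"
| "qf (Imp \<phi> \<psi>) = (qf \<phi> \<and> qf \<psi>)"
| "qf (All \<rho> \<phi>) = False"
| "qf (Ex \<rho> \<phi>) = False"

fun liftf :: "ty \<Rightarrow> nat \<Rightarrow> fm \<Rightarrow> fm" where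
  "liftf \<rho> k Fls = Fls"
| "liftf \<rho> k (Eq s t) = Eq (lift \<rho> k s) (lift \<rho> k t)"
| "liftf \<rho> k (Less s t) = Less (lift \<rho> k s) (lift \<rho> k t)"
| "liftf \<rho> k (And \<phi> \<psi>) = And (liftf \<rho> k \<phi>) (liftf \<rho> k \<psi>)"
| "liftf \<rho> k (Or \<phi> \<psi>) = Or (liftf \<rho> k \<phi>) (liftf \<rho> k \<psi>)"
| "liftf \<rho> k (Imp \<phi> \<psi>) = Imp (liftf \<rho> k \<phi>) (liftf \<rho> k \<psi>)"
| "liftf \<rho> k (All \<sigma> \<phi>) = All \<sigma> (liftf \<rho> (if \<sigma> = \<rho> then Suc k else k) \<phi>)"
| "liftf \<rho> k (Ex \<sigma> \<phi>) = Ex \<sigma> (liftf \<rho> (if \<sigma> = \<rho> then Suc k else k) \<phi>)"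

fun substf :: "ty \<Rightarrow> nat \<Rightarrow> trm \<Rightarrow> fm \<Rightarrow> fm" where
  "substf \<rho> k u Fls = Fls"
| "substf \<rho> k u (Eq s t) = Eq (subst \<rho> k u s) (subst \<rho> k u t)"
| "substf \<rho> k u (Less s t) = Less (subst \<rho> k u s) (subst \<rho> k u t)"
| "substf \<rho> k u (And \<phi> \<psi>) = And (substf \<rho> k u \<phi>) (substf \<rho> k u \<psi>)"
| "substf \<rho> k u (Or \<phi> \<psi>) = Or (substf \<rho> k u \<phi>) (substf \<rho> k u \<psi>)"
| "substf \<rho> k u (Imp \<phi> \<psi>) = Imp (substf \<rho> k u \<phi>) (substf \<rho> k u \<psi>)"
| "substf \<rho> k u (All \<sigma> \<phi>) = All \<sigma> (substf \<rho> (if \<sigma> = \<rho> then Suc k else k) (lift \<sigma> 0 u) \<phi>)"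
| "substf \<rho> k u (Ex \<sigma> \<phi>) = Ex \<sigma> (substf \<rho> (if \<sigma> = \<rho> then Suc k else k) (lift \<sigma> 0 u) \<phi>)"

text \<open>Equality at higher types is defined pointwise from equality of numbers.\<close>

fun eqf :: "ty \<Rightarrow> trm \<Rightarrow> trm \<Rightarrow> fm" where
  "eqf N s t = Eq s t"
| "eqf (\<rho> \<leadsto> \<tau>) s t = All \<rho> (eqf \<tau> (lift \<rho> 0 s \<cdot> Var \<rho> 0) (lift \<rho> 0 t \<cdot> Var \<rho> 0))"

section \<open>The system \<open>RCA\<^sub>0\<^sup>\<omega>\<close>\<close>

text \<open>Free variables of axioms are read universally (rule \<open>AllI\<close> below applies to them).
  The ordered semiring axioms are those of a discretely ordered commutative semiring; the
  discreteness axioms also follow from the others by quantifier-free induction.\<close>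

inductive semiring_ax :: "fm \<Rightarrow> bool" where
  "semiring_ax (Eq (plus_tm (plus_tm (Var N 0) (Var N 1)) (Var N 2))
                   (plus_tm (Var N 0) (plus_tm (Var N 1) (Var N 2))))"
| "semiring_ax (Eq (plus_tm (Var N 0) (Var N 1)) (plus_tm (Var N 1) (Var N 0)))"
| "semiring_ax (Eq (plus_tm (Var N 0) zero_tm) (Var N 0))"
| "semiring_ax (Eq (times_tm (times_tm (Var N 0) (Var N 1)) (Var N 2))
                   (times_tm (Var N 0) (times_tm (Var N 1) (Var N 2))))"
| "semiring_ax (Eq (times_tm (Var N 0) (Var N 1)) (times_tm (Var N 1) (Var N 0)))"
| "semiring_ax (Eq (times_tm (Var N 0) one_tm) (Var N 0))"
| "semiring_ax (Eq (times_tm (Var N 0) zero_tm) zero_tm)"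
| "semiring_ax (Eq (times_tm (Var N 0) (plus_tm (Var N 1) (Var N 2)))
                   (plus_tm (times_tm (Var N 0) (Var N 1)) (times_tm (Var N 0) (Var N 2))))"
| "semiring_ax (Neg (Less (Var N 0) (Var N 0)))"
| "semiring_ax (Imp (And (Less (Var N 0) (Var N 1)) (Less (Var N 1) (Var N 2)))
                    (Less (Var N 0) (Var N 2)))"
| "semiring_ax (Or (Less (Var N 0) (Var N 1))
                   (Or (Eq (Var N 0) (Var N 1)) (Less (Var N 1) (Var N 0))))"
| "semiring_ax (Imp (Less (Var N 0) (Var N 1))
                    (Less (plus_tm (Var N 0) (Var N 2)) (plus_tm (Var N 1) (Var N 2))))"
| "semiring_ax (Imp (And (Less zero_tm (Var N 2)) (Less (Var N 0) (Var N 1)))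
                    (Less (times_tm (Var N 0) (Var N 2)) (times_tm (Var N 1) (Var N 2))))"
| "semiring_ax (Less zero_tm one_tm)"
| "semiring_ax (Or (Eq (Var N 0) zero_tm) (Less zero_tm (Var N 0)))"
| "semiring_ax (Imp (Less zero_tm (Var N 0)) (Or (Eq (Var N 0) one_tm) (Less one_tm (Var N 0))))"

text \<open>The indices 0, 1, 2 in the combinator axioms keep the three variables distinct also when
  some of their types coincide. In \<open>qf_ac\<close>, the formula \<open>\<phi>\<close> has \<open>Var one 0\<close> and \<open>Var N 0\<close> for
  the two quantified variables; lifting \<open>\<phi>\<close> makes room for the choice functional \<open>Var two 0\<close>.\<close>

inductive RCA_ax :: "fm \<Rightarrow> bool" where
  semiring_ax: "semiring_ax \<phi> \<Longrightarrow> RCA_ax \<phi>"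
| pi_ax: "RCA_ax (eqf \<rho> (Cst (Pi \<rho> \<sigma>) \<cdot> Var \<rho> 0 \<cdot> Var \<sigma> 1) (Var \<rho> 0))"
| sigma_ax: "RCA_ax (eqf \<tau>
      (Cst (Sigma \<rho> \<sigma> \<tau>) \<cdot> Var (\<rho> \<leadsto> \<sigma> \<leadsto> \<tau>) 0 \<cdot> Var (\<rho> \<leadsto> \<sigma>) 1 \<cdot> Var \<rho> 2)
      (Var (\<rho> \<leadsto> \<sigma> \<leadsto> \<tau>) 0 \<cdot> Var \<rho> 2 \<cdot> (Var (\<rho> \<leadsto> \<sigma>) 1 \<cdot> Var \<rho> 2)))"
| rec_zero: "RCA_ax (Eq (Cst (Rec N) \<cdot> Var (N \<leadsto> N \<leadsto> N) 0 \<cdot> Var N 0 \<cdot> zero_tm) (Var N 0))"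
| rec_suc: "RCA_ax (Eq (Cst (Rec N) \<cdot> Var (N \<leadsto> N \<leadsto> N) 0 \<cdot> Var N 0 \<cdot> suc_tm (Var N 1))
      (Var (N \<leadsto> N \<leadsto> N) 0 \<cdot> Var N 1 \<cdot>
        (Cst (Rec N) \<cdot> Var (N \<leadsto> N \<leadsto> N) 0 \<cdot> Var N 0 \<cdot> Var N 1)))"
| extensionality: "RCA_ax (Imp (eqf \<rho> (Var \<rho> 0) (Var \<rho> 1))
      (eqf \<tau> (Var (\<rho> \<leadsto> \<tau>) 0 \<cdot> Var \<rho> 0) (Var (\<rho> \<leadsto> \<tau>) 0 \<cdot> Var \<rho> 1)))"
| qf_ind: "qf \<phi> \<Longrightarrow> wff \<phi> \<Longrightarrow>
    RCA_ax (Imp (And (substf N 0 zero_tm \<phi>)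
                     (All N (Imp \<phi> (substf N 0 (suc_tm (Var N 0)) (liftf N 1 \<phi>)))))
                (All N \<phi>))"
| qf_ac: "qf \<phi> \<Longrightarrow> wff \<phi> \<Longrightarrow>
    RCA_ax (Imp (All one (Ex N \<phi>))
                (Ex two (All one (substf N 0 (Var two 0 \<cdot> Var one 0) (liftf two 0 \<phi>)))))"

text \<open>Natural deduction for classical many-sorted predicate logic with equality of numbers.
  The side conditions on well-formedness keep ill-typed formulas out of derivations.\<close>

inductive RCA :: "fm set \<Rightarrow> fm \<Rightarrow> bool" (infix "\<turnstile>" 50) where
  Ax: "RCA_ax \<phi> \<Longrightarrow> \<Gamma> \<turnstile> \<phi>"
| Assm: "\<phi> \<in> \<Gamma> \<Longrightarrow> wff \<phi> \<Longrightarrow> \<Gamma> \<turnstile> \<phi>"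
| Contr: "insert (Neg \<phi>) \<Gamma> \<turnstile> Fls \<Longrightarrow> wff \<phi> \<Longrightarrow> \<Gamma> \<turnstile> \<phi>"
| AndI: "\<Gamma> \<turnstile> \<phi> \<Longrightarrow> \<Gamma> \<turnstile> \<psi> \<Longrightarrow> \<Gamma> \<turnstile> And \<phi> \<psi>"
| AndE1: "\<Gamma> \<turnstile> And \<phi> \<psi> \<Longrightarrow> \<Gamma> \<turnstile> \<phi>"
| AndE2: "\<Gamma> \<turnstile> And \<phi> \<psi> \<Longrightarrow> \<Gamma> \<turnstile> \<psi>"
| OrI1: "\<Gamma> \<turnstile> \<phi> \<Longrightarrow> wff \<psi> \<Longrightarrow> \<Gamma> \<turnstile> Or \<phi> \<psi>"
| OrI2: "\<Gamma> \<turnstile> \<psi> \<Longrightarrow> wff \<phi> \<Longrightarrow> \<Gamma> \<turnstile> Or \<phi> \<psi>"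
| OrE: "\<Gamma> \<turnstile> Or \<phi> \<psi> \<Longrightarrow> insert \<phi> \<Gamma> \<turnstile> \<chi> \<Longrightarrow> insert \<psi> \<Gamma> \<turnstile> \<chi> \<Longrightarrow> \<Gamma> \<turnstile> \<chi>"
| ImpI: "insert \<phi> \<Gamma> \<turnstile> \<psi> \<Longrightarrow> wff \<phi> \<Longrightarrow> \<Gamma> \<turnstile> Imp \<phi> \<psi>"
| ImpE: "\<Gamma> \<turnstile> Imp \<phi> \<psi> \<Longrightarrow> \<Gamma> \<turnstile> \<phi> \<Longrightarrow> \<Gamma> \<turnstile> \<psi>"
| AllI: "liftf \<rho> 0 ` \<Gamma> \<turnstile> \<phi> \<Longrightarrow> \<Gamma> \<turnstile> All \<rho> \<phi>"
| AllE: "\<Gamma> \<turnstile> All \<rho> \<phi> \<Longrightarrow> has_ty t \<rho> \<Longrightarrow> \<Gamma> \<turnstile> substf \<rho> 0 t \<phi>"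
| ExI: "\<Gamma> \<turnstile> substf \<rho> 0 t \<phi> \<Longrightarrow> has_ty t \<rho> \<Longrightarrow> wff \<phi> \<Longrightarrow> \<Gamma> \<turnstile> Ex \<rho> \<phi>"
| ExE: "\<Gamma> \<turnstile> Ex \<rho> \<phi> \<Longrightarrow> insert \<phi> (liftf \<rho> 0 ` \<Gamma>) \<turnstile> liftf \<rho> 0 \<psi> \<Longrightarrow> wff \<psi> \<Longrightarrow> \<Gamma> \<turnstile> \<psi>"
| EqRefl: "has_ty t N \<Longrightarrow> \<Gamma> \<turnstile> Eq t t"
| EqSubst: "\<Gamma> \<turnstile> Eq s t \<Longrightarrow> \<Gamma> \<turnstile> substf N 0 s \<phi> \<Longrightarrow> wff \<phi> \<Longrightarrow> \<Gamma> \<turnstile> substf N 0 t \<phi>"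

section \<open>The formulas \<open>NCC(\<zeta>)\<close> and \<open>(\<exists>\<^sup>3)\<close>\<close>

text \<open>The sequence with first entry \<open>m\<close> and tail \<open>f\<close>. A triple \<open>(f, m, n)\<close> of a function and two
  numbers is coded by the function with values \<open>m, n, f(0), f(1), \<dots>\<close>.\<close>

definition cons_tm :: "trm \<Rightarrow> trm \<Rightarrow> trm" where
  "cons_tm m f = Cst (Rec N) \<cdot> lam N (lam N (lift N 0 (lift N 0 f) \<cdot> Var N 1)) \<cdot> m"

definition code_tm :: "trm \<Rightarrow> trm \<Rightarrow> trm \<Rightarrow> trm" where
  "code_tm f m n = cons_tm m (cons_tm n f)"

definition A_fm :: "trm \<Rightarrow> trm \<Rightarrow> trm \<Rightarrow> fm" where
  "A_fm Y n m = Ex one (And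
     (All N (Or (Eq (Var one 0 \<cdot> Var N 0) zero_tm) (Eq (Var one 0 \<cdot> Var N 0) one_tm)))
     (Eq (lift one 0 Y \<cdot> code_tm (Var one 0) (lift one 0 m) (lift one 0 n)) zero_tm))"

text \<open>The functional \<open>\<zeta>\<close> is the free variable \<open>Var (two \<leadsto> one) 0\<close>.\<close>

definition NCC_fm :: fm where
  "NCC_fm = All two (Imp
     (All N (Ex N (A_fm (Var two 0) (Var N 1) (Var N 0))))
     (All N (A_fm (Var two 0) (Var N 0) (Var (two \<leadsto> one) 0 \<cdot> Var two 0 \<cdot> Var N 0))))"

definition exists3_fm :: fm where
  "exists3_fm = Ex three (And
     (All two (Or (Less (Var three 0 \<cdot> Var two 0) one_tm) (Eq (Var three 0 \<cdot> Var two 0) one_tm)))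
     (All two (Iff (Ex one (Eq (Var two 0 \<cdot> Var one 0) zero_tm))
                   (Eq (Var three 0 \<cdot> Var two 0) zero_tm))))"

section \<open>\<open>\<zeta>\<close>-functionals and \<open>\<exists>\<^sup>3\<close> in the full type structure\<close>

type_synonym fun1 = "nat \<Rightarrow> nat"
type_synonym fun2 = "fun1 \<Rightarrow> nat"
type_synonym fun3 = "fun2 \<Rightarrow> nat"

definition code :: "fun1 \<Rightarrow> nat \<Rightarrow> nat \<Rightarrow> fun1" where
  "code f m n = case_nat m (case_nat n f)"

definition A_rel :: "fun2 \<Rightarrow> nat \<Rightarrow> nat \<Rightarrow> bool" where
  "A_rel Y n m \<longleftrightarrow> (\<exists>f. range f \<subseteq> {0, 1} \<and> Y (code f m n) = 0)"

definition NCC :: "(fun2 \<Rightarrow> fun1) \<Rightarrow> bool" where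
  "NCC \<zeta> \<longleftrightarrow> (\<forall>Y. (\<forall>n. \<exists>m. A_rel Y n m) \<longrightarrow> (\<forall>n. A_rel Y n (\<zeta> Y n)))"

definition is_exists3 :: "fun3 \<Rightarrow> bool" where
  "is_exists3 E \<longleftrightarrow> (\<forall>Y. E Y \<le> 1) \<and> (\<forall>Y. (\<exists>f. Y f = 0) \<longleftrightarrow> E Y = 0)"

section \<open>Values of terms of \<open>T\<close>\<close>

text \<open>The full type structure over all finite types has no home in a single HOL type. Values of
  terms of \<open>T\<close> at functionals of low type are therefore given by an evaluation relation on closed
  terms over \<open>T\<close> extended by a name for every element of the types 0, 1, 2, 3 and
  \<open>2 \<rightarrow> 1\<close>. The rules for the names of functionals correspond to Kleene's schemes S7 and S8: their
  arguments are evaluated at all inputs.\<close>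

datatype otm = OC cst | Num nat | F1 fun1 | F2 fun2 | F3 fun3 | F21 "fun2 \<Rightarrow> fun1"
  | Ap otm otm (infixl "\<odot>" 100)

text \<open>The clause for variables is never used: \<open>emb\<close> is applied to closed terms.\<close>

fun emb :: "trm \<Rightarrow> otm" where
  "emb (Var \<rho> i) = OC Zero"
| "emb (Cst c) = OC c"
| "emb (s \<cdot> t) = emb s \<odot> emb t"

text \<open>\<open>ev a bs v\<close>: the term \<open>a\<close>, applied to the terms in the list \<open>bs\<close>, is of type 0 and has
  value \<open>v\<close>.\<close>

inductive ev :: "otm \<Rightarrow> otm list \<Rightarrow> nat \<Rightarrow> bool" where
  ev_Ap: "ev a (b # cs) v \<Longrightarrow> ev (a \<odot> b) cs v"
| ev_Num: "ev (Num n) [] n"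
| ev_Zero: "ev (OC Zero) [] 0"
| ev_One: "ev (OC One) [] 1"
| ev_Plus: "ev a [] m \<Longrightarrow> ev b [] n \<Longrightarrow> ev (OC Plus) [a, b] (m + n)"
| ev_Times: "ev a [] m \<Longrightarrow> ev b [] n \<Longrightarrow> ev (OC Times) [a, b] (m * n)"
| ev_Pi: "ev a cs v \<Longrightarrow> ev (OC (Pi \<rho> \<sigma>)) (a # b # cs) v"
| ev_Sigma: "ev a (c # (b \<odot> c) # cs) v \<Longrightarrow> ev (OC (Sigma \<rho> \<sigma> \<tau>)) (a # b # c # cs) v"
| ev_Rec_0: "ev n [] 0 \<Longrightarrow> ev a cs v \<Longrightarrow> ev (OC (Rec \<rho>)) (f # a # n # cs) v"
| ev_Rec_Suc: "ev n [] (Suc k) \<Longrightarrow> ev f (Num k # (OC (Rec \<rho>) \<odot> f \<odot> a \<odot> Num k) # cs) v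
    \<Longrightarrow> ev (OC (Rec \<rho>)) (f # a # n # cs) v"
| ev_F1: "ev a [] n \<Longrightarrow> v = f n \<Longrightarrow> ev (F1 f) [a] v"
| ev_F2: "\<forall>n. ev a [Num n] (g n) \<Longrightarrow> v = Y g \<Longrightarrow> ev (F2 Y) [a] v"
| ev_F3: "\<forall>f. ev a [F1 f] (Y f) \<Longrightarrow> v = E Y \<Longrightarrow> ev (F3 E) [a] v"
| ev_F21: "\<forall>f. ev a [F1 f] (Y f) \<Longrightarrow> ev b [] n \<Longrightarrow> v = \<zeta> Y n \<Longrightarrow> ev (F21 \<zeta>) [a, b] v"

text \<open>The unbounded search for the least zero of the function given by \<open>a\<close> ends with \<open>m\<close>.\<close>

definition mu_ev :: "otm \<Rightarrow> nat \<Rightarrow> bool" where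
  "mu_ev a m \<longleftrightarrow> ev a [Num m] 0 \<and> (\<forall>i<m. \<exists>k. ev a [Num i] (Suc k))"

section \<open>Unbounded search is needed to compute a \<open>\<zeta>\<close>-functional from \<open>\<exists>\<^sup>3\<close>\<close>

text \<open>Terms of \<open>T\<close> are hereditarily majorizable, and \<open>\<exists>\<^sup>3\<close> has values 0 and 1 only. Hence the value at
  \<open>(Y, n)\<close> of a term of \<open>T\<close> in \<open>\<exists>\<^sup>3\<close> is bounded uniformly in the 0-1-valued \<open>Y\<close>, which is not the case
  for any \<open>\<zeta>\<close>-functional: theorem \<open>no_T_term_without_search\<close> below. So a computation of a
  \<open>\<zeta>\<close>-functional from \<open>\<exists>\<^sup>3\<close> by a term of \<open>T\<close> is a term of \<open>T\<close> whose least zero is searched for.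
  Majorizability is proved for sets of terms: \<open>bd\<close> is the logical relation that is boundedness of the
  set of values at type 0.\<close>

inductive_cases ev_ApE: "ev (a \<odot> b) cs v"
inductive_cases ev_NumE: "ev (Num n) cs v"
inductive_cases ev_ZeroE: "ev (OC Zero) cs v"
inductive_cases ev_OneE: "ev (OC One) cs v"
inductive_cases ev_PlusE: "ev (OC Plus) cs v"
inductive_cases ev_TimesE: "ev (OC Times) cs v"
inductive_cases ev_PiE: "ev (OC (Pi \<rho> \<sigma>)) cs v"
inductive_cases ev_SigmaE: "ev (OC (Sigma \<rho> \<sigma> \<tau>)) cs v"
inductive_cases ev_RecE: "ev (OC (Rec \<rho>)) cs v"
inductive_cases ev_F1E: "ev (F1 f) cs v"
inductive_cases ev_F2E: "ev (F2 f) cs v"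
inductive_cases ev_F3E: "ev (F3 f) cs v"
inductive_cases ev_F21E: "ev (F21 f) cs v"

lemma fun_det:
  assumes "\<forall>x. P x (g x) \<and> (\<forall>y. P x y \<longrightarrow> g x = y)" "\<forall>x. P x (h x)"
  shows "h = g"
proof (rule HOL.ext)
  fix x
  from assms(1) have "P x (g x) \<and> (\<forall>y. P x y \<longrightarrow> g x = y)" by (rule spec)
  then have "P x (h x) \<longrightarrow> g x = h x" by (elim conjE) (erule spec)
  from this spec[OF assms(2)] have "g x = h x" by (rule mp)
  then show "h x = g x" by (rule sym)
qed

lemma ev_F2D:
  assumes "ev (F2 Y) [a] v"
  obtains g where "v = Y g" "\<forall>n. ev a [Num n] (g n)"
proof (rule ev_F2E[OF assms])
  fix a' g assume *: "[a] = [a']" "v = Y g" "\<forall>n. ev a' [Num n] (g n)"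
  show thesis by (rule that[of g]) (use * in simp_all)
qed

lemma ev_F3D:
  assumes "ev (F3 E) [a] v"
  obtains Y where "v = E Y" "\<forall>f. ev a [F1 f] (Y f)"
proof (rule ev_F3E[OF assms])
  fix a' Y assume *: "[a] = [a']" "v = E Y" "\<forall>f. ev a' [F1 f] (Y f)"
  show thesis by (rule that[of Y]) (use * in simp_all)
qed

lemma ev_F21D:
  assumes "ev (F21 \<zeta>) [a, b] v"
  obtains Y n where "v = \<zeta> Y n" "\<forall>f. ev a [F1 f] (Y f)" "ev b [] n"
proof (rule ev_F21E[OF assms])
  fix a' Y b' n
  assume *: "[a, b] = [a', b']" "v = \<zeta> Y n" "\<forall>f. ev a' [F1 f] (Y f)" "ev b' [] n"
  show thesis by (rule that[of Y n]) (use * in simp_all)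
qed

lemma ev_det: "ev a bs v \<Longrightarrow> ev a bs w \<Longrightarrow> v = w"
proof (induction arbitrary: w rule: ev.induct)
  case (ev_Ap a b cs v)
  from ev_Ap.prems have "ev a (b # cs) w" by (rule ev_ApE) simp_all
  then show ?case by (rule ev_Ap.IH)
next
  case (ev_Pi a cs v \<rho> \<sigma> b)
  from ev_Pi.prems have "ev a cs w" by (rule ev_PiE) simp_all
  then show ?case by (rule ev_Pi.IH)
next
  case (ev_Sigma a c b cs v \<rho> \<sigma> \<tau>)
  from ev_Sigma.prems have "ev a (c # (b \<odot> c) # cs) w" by (rule ev_SigmaE) simp_all
  then show ?case by (rule ev_Sigma.IH)
next
  case (ev_Num n)
  from ev_Num.prems show ?case by (rule ev_NumE) simp_all
next
  case ev_Zero
  from ev_Zero.prems show ?case by (rule ev_ZeroE) simp_all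
next
  case ev_One
  from ev_One.prems show ?case by (rule ev_OneE) simp_all
next
  case (ev_Plus a m b n)
  from ev_Plus.prems obtain m' n' where "w = m' + n'" "ev a [] m'" "ev b [] n'"
    by (rule ev_PlusE) simp
  with ev_Plus.IH(1)[of m'] ev_Plus.IH(2)[of n'] show ?case by simp
next
  case (ev_Times a m b n)
  from ev_Times.prems obtain m' n' where "w = m' * n'" "ev a [] m'" "ev b [] n'"
    by (rule ev_TimesE) simp
  with ev_Times.IH(1)[of m'] ev_Times.IH(2)[of n'] show ?case by simp
next
  case (ev_F1 a n v f)
  from ev_F1.prems obtain n' where "w = f n'" "ev a [] n'"
    by (rule ev_F1E) simp
  with ev_F1.IH[of n'] ev_F1.hyps show ?case by simp
next
  case (ev_Rec_0 n a cs v \<rho> f)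
  from ev_Rec_0.prems consider "ev a cs w" | k where "ev n [] (Suc k)"
    by (rule ev_RecE) (simp_all, blast?)
  then show ?case
  proof cases
    case 1 then show ?thesis by (rule ev_Rec_0.IH(2))
  next
    case 2 then show ?thesis using ev_Rec_0.IH(1)[of "Suc k"] by simp
  qed
next
  case (ev_Rec_Suc n k f \<rho> a cs v)
  from ev_Rec_Suc.prems consider "ev n [] 0"
    | k' where "ev n [] (Suc k')" "ev f (Num k' # (OC (Rec \<rho>) \<odot> f \<odot> a \<odot> Num k') # cs) w"
    by (rule ev_RecE) (simp_all, blast?)
  then show ?case
  proof cases
    case 1 then show ?thesis using ev_Rec_Suc.IH(1)[of 0] by simp
  next
    case 2
    with ev_Rec_Suc.IH(1)[of "Suc k'"] have "k' = k" by simp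
    with 2(2) have "ev f (Num k # (OC (Rec \<rho>) \<odot> f \<odot> a \<odot> Num k) # cs) w" by simp
    then show ?thesis by (rule ev_Rec_Suc.IH(2))
  qed
next
  case (ev_F2 a g v Y)
  obtain g' where g': "w = Y g'" "\<forall>n. ev a [Num n] (g' n)"
    by (rule ev_F2D[OF ev_F2.prems])
  have "g' = g"
    by (rule fun_det[where P = "\<lambda>n. ev a [Num n]", OF ev_F2.IH g'(2)])
  with g'(1) ev_F2.hyps show ?case by simp
next
  case (ev_F3 a Y v E)
  obtain Y' where Y': "w = E Y'" "\<forall>f. ev a [F1 f] (Y' f)"
    by (rule ev_F3D[OF ev_F3.prems])
  have "Y' = Y"
    by (rule fun_det[where P = "\<lambda>f. ev a [F1 f]", OF ev_F3.IH Y'(2)])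
  with Y'(1) ev_F3.hyps show ?case by simp
next
  case (ev_F21 a Y b n v \<zeta>)
  obtain Y' n' where Y': "w = \<zeta> Y' n'" "\<forall>f. ev a [F1 f] (Y' f)" "ev b [] n'"
    by (rule ev_F21D[OF ev_F21.prems])
  have "Y' = Y"
    by (rule fun_det[where P = "\<lambda>f. ev a [F1 f]", OF ev_F21.IH(1) Y'(2)])
  moreover have "n = n'" by (rule ev_F21.IH(2)[OF Y'(3)])
  ultimately show ?case using Y'(1) ev_F21.hyps by simp
qed

lemma ev_Ap_iff: "ev (a \<odot> b) cs v \<longleftrightarrow> ev a (b # cs) v"
proof
  assume "ev (a \<odot> b) cs v"
  then show "ev a (b # cs) v" by (rule ev_ApE) simp
qed (rule ev_Ap)

primrec bd :: "ty \<Rightarrow> otm set \<Rightarrow> bool" where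
  "bd N S = (\<exists>M. \<forall>a\<in>S. \<exists>v\<le>M. ev a [] v)"
| "bd (\<sigma> \<leadsto> \<tau>) S = (\<forall>B. bd \<sigma> B \<longrightarrow> bd \<tau> {a \<odot> b | a b. a \<in> S \<and> b \<in> B})"

definition le_ev :: "otm \<Rightarrow> otm \<Rightarrow> bool" where
  "le_ev a b \<longleftrightarrow> (\<forall>cs v. ev a cs v \<longrightarrow> ev b cs v)"

lemma le_evD: "le_ev a b \<Longrightarrow> ev a cs v \<Longrightarrow> ev b cs v"
  unfolding le_ev_def by simp

lemma le_ev_refl: "le_ev a a"
  unfolding le_ev_def by simp

lemma le_ev_Ap: "le_ev a a' \<Longrightarrow> le_ev (a \<odot> b) (a' \<odot> b)"
  unfolding le_ev_def ev_Ap_iff by (intro allI) (elim allE)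

lemma bd_expand:
  "bd \<rho> S \<Longrightarrow> (\<And>a'. a' \<in> S' \<Longrightarrow> \<exists>a\<in>S. le_ev a a') \<Longrightarrow> bd \<rho> S'"
proof (induction \<rho> arbitrary: S S')
  case N
  obtain M where M: "\<forall>a\<in>S. \<exists>v\<le>M. ev a [] v"
    using N.prems(1) unfolding bd.simps by (rule exE)
  have "\<exists>v\<le>M. ev a' [] v" if a': "a' \<in> S'" for a'
  proof -
    obtain a where a: "a \<in> S" "le_ev a a'" using N.prems(2)[OF a'] by (rule bexE)
    obtain v where "v \<le> M" "ev a [] v" using M a(1) by blast
    with le_evD[OF a(2)] show ?thesis by iprover
  qed
  then have "\<forall>a'\<in>S'. \<exists>v\<le>M. ev a' [] v" by (rule ballI)
  then show ?case unfolding bd.simps by (rule exI)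
next
  case (Fn \<sigma> \<tau>)
  show ?case unfolding bd.simps
  proof (intro allI impI)
    fix B assume "bd \<sigma> B"
    then have 1: "bd \<tau> {a \<odot> b | a b. a \<in> S \<and> b \<in> B}" using Fn.prems(1) by simp
    show "bd \<tau> {a \<odot> b | a b. a \<in> S' \<and> b \<in> B}"
    proof (rule Fn.IH(2)[OF 1])
      fix x assume "x \<in> {a \<odot> b | a b. a \<in> S' \<and> b \<in> B}"
      then obtain a' b where x: "x = a' \<odot> b" "a' \<in> S'" "b \<in> B" by blast
      obtain a where a: "a \<in> S" "le_ev a a'" using Fn.prems(2)[OF x(2)] by (rule bexE)
      have "le_ev (a \<odot> b) x" unfolding x(1) by (rule le_ev_Ap[OF a(2)])
      then show "\<exists>y\<in>{a \<odot> b | a b. a \<in> S \<and> b \<in> B}. le_ev y x"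
        using a(1) x(3) by blast
    qed
  qed
qed

lemma bd_mono: "bd \<rho> S \<Longrightarrow> S' \<subseteq> S \<Longrightarrow> bd \<rho> S'"
  by (erule bd_expand) (use le_ev_refl in blast)

lemma bd_Un: "bd \<rho> S \<Longrightarrow> bd \<rho> S' \<Longrightarrow> bd \<rho> (S \<union> S')"
proof (induction \<rho> arbitrary: S S')
  case N
  then obtain M M' where "\<forall>a\<in>S. \<exists>v\<le>M. ev a [] v" "\<forall>a\<in>S'. \<exists>v\<le>M'. ev a [] v" by auto
  then have "\<forall>a\<in>S \<union> S'. \<exists>v\<le>max M M'. ev a [] v" by (meson Un_iff max.coboundedI1 max.coboundedI2)
  then show ?case by auto
next
  case (Fn \<sigma> \<tau>)
  show ?case unfolding bd.simps
  proof (intro allI impI)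
    fix B assume "bd \<sigma> B"
    then have "bd \<tau> ({a \<odot> b | a b. a \<in> S \<and> b \<in> B} \<union> {a \<odot> b | a b. a \<in> S' \<and> b \<in> B})"
      using Fn.prems by (intro Fn.IH(2)) auto
    then show "bd \<tau> {a \<odot> b | a b. a \<in> S \<union> S' \<and> b \<in> B}" by (rule bd_mono) blast
  qed
qed

lemma bd_app: "bd (\<sigma> \<leadsto> \<tau>) S \<Longrightarrow> bd \<sigma> B \<Longrightarrow> bd \<tau> {a \<odot> b | a b. a \<in> S \<and> b \<in> B}"
  by simp

lemma bd_app1: "bd (\<sigma> \<leadsto> \<tau>) {a} \<Longrightarrow> bd \<sigma> {b} \<Longrightarrow> bd \<tau> {a \<odot> b}"
  by (rule bd_mono[OF bd_app]) auto

lemma bd_Num: "bd N {Num n}"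
  by (auto intro: ev_Num)

lemma bd_F1: "bd one {F1 f}"
  unfolding bd.simps
proof (intro allI impI)
  fix B assume "\<exists>M. \<forall>a\<in>B. \<exists>v\<le>M. ev a [] v"
  then obtain M where M: "\<forall>a\<in>B. \<exists>v\<le>M. ev a [] v" by blast
  have "\<forall>x\<in>{a \<odot> b | a b. a \<in> {F1 f} \<and> b \<in> B}. \<exists>v\<le>Max (f ` {..M}). ev x [] v"
  proof
    fix x assume "x \<in> {a \<odot> b | a b. a \<in> {F1 f} \<and> b \<in> B}"
    then obtain b where x: "x = F1 f \<odot> b" "b \<in> B" by blast
    then obtain v where v: "v \<le> M" "ev b [] v" using M by blast
    then have "ev x [] (f v)" "f v \<le> Max (f ` {..M})" using x by (simp_all add: ev_Ap_iff ev_F1)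
    then show "\<exists>v\<le>Max (f ` {..M}). ev x [] v" by blast
  qed
  then show "\<exists>M. \<forall>a\<in>{a \<odot> b | a b. a \<in> {F1 f} \<and> b \<in> B}. \<exists>v\<le>M. ev a [] v" by blast
qed

lemma bd_total:
  assumes "bd (\<sigma> \<leadsto> N) B" "b \<in> B" "\<And>x. bd \<sigma> {c x}"
  shows "\<exists>g. \<forall>x. ev b [c x] (g x)"
proof -
  have "\<exists>v. ev b [c x] v" for x
  proof -
    have "bd N {b \<odot> c x}"
      using bd_app[OF assms(1) assms(3)[of x]] by (rule bd_mono) (use assms(2) in blast)
    then show ?thesis by (simp add: ev_Ap_iff) blast
  qed
  then show ?thesis by (intro choice allI)
qed

lemma bd_leI:
  assumes "\<And>B a b. bd \<sigma> B \<Longrightarrow> b \<in> B \<Longrightarrow> a \<in> S \<Longrightarrow> \<exists>v\<le>M. ev a [b] v"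
  shows "bd (\<sigma> \<leadsto> N) S"
  unfolding bd.simps
proof (rule allI, rule impI, rule exI[of _ M], rule ballI)
  fix B x assume B: "bd \<sigma> B" and "x \<in> {a \<odot> b | a b. a \<in> S \<and> b \<in> B}"
  then obtain a b where x: "x = a \<odot> b" "a \<in> S" "b \<in> B" by blast
  show "\<exists>v\<le>M. ev x [] v" unfolding x(1) ev_Ap_iff by (rule assms[OF B x(3,2)])
qed

lemma bd_F2:
  assumes Ys: "\<And>Y g. Y \<in> Ys \<Longrightarrow> Y g \<le> 1"
  shows "bd two (F2 ` Ys)"
proof (rule bd_leI[where M = 1])
  fix B a b assume B: "bd one B" "b \<in> B" and "a \<in> F2 ` Ys"
  then obtain Y where Y: "a = F2 Y" "Y \<in> Ys" by blast
  obtain g where g: "\<forall>n. ev b [Num n] (g n)"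
    using bd_total[of N B b Num, OF B bd_Num] by (rule exE)
  have "ev a [b] (Y g)" unfolding Y(1) using g refl by (rule ev_F2)
  with Ys[OF Y(2)] show "\<exists>v\<le>1. ev a [b] v" by (intro exI conjI)
qed

lemma bd_F3:
  assumes E: "\<And>Y. E Y \<le> 1"
  shows "bd three {F3 E}"
proof (rule bd_leI[where M = 1])
  fix B a b assume B: "bd two B" "b \<in> B" and a: "a \<in> {F3 E}"
  obtain Y where Y: "\<forall>f. ev b [F1 f] (Y f)"
    using bd_total[of one B b F1, OF B bd_F1] by (rule exE)
  have "ev (F3 E) [b] (E Y)" using Y refl by (rule ev_F3)
  with E a show "\<exists>v\<le>1. ev a [b] v" by (intro exI conjI) simp_all
qed

lemma bd_cst: "bd (cst_ty c) {OC c}"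
proof (cases c)
  case Zero then show ?thesis by (auto intro: ev_Zero)
next
  case One then show ?thesis by (auto intro: ev_One)
next
  case Plus
  { fix S B assume "bd N S" "bd N B"
    then obtain M M' where M: "\<forall>a\<in>S. \<exists>v\<le>M. ev a [] v" "\<forall>a\<in>B. \<exists>v\<le>M'. ev a [] v" by auto
    have "\<exists>v\<le>M + M'. ev (OC Plus \<odot> a \<odot> b) [] v" if "a \<in> S" "b \<in> B" for a b
      using M that by (meson add_mono ev_Ap ev_Plus)
    then have "bd N {x \<odot> b |x b. x \<in> {y \<odot> a |y a. y \<in> {OC Plus} \<and> a \<in> S} \<and> b \<in> B}"
      unfolding bd.simps by blast }
  then show ?thesis using Plus by (simp del: bd.simps(1))
next
  case Times
  { fix S B assume "bd N S" "bd N B"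
    then obtain M M' where M: "\<forall>a\<in>S. \<exists>v\<le>M. ev a [] v" "\<forall>a\<in>B. \<exists>v\<le>M'. ev a [] v" by auto
    have "\<exists>v\<le>M * M'. ev (OC Times \<odot> a \<odot> b) [] v" if "a \<in> S" "b \<in> B" for a b
      using M that by (meson mult_le_mono ev_Ap ev_Times)
    then have "bd N {x \<odot> b |x b. x \<in> {y \<odot> a |y a. y \<in> {OC Times} \<and> a \<in> S} \<and> b \<in> B}"
      unfolding bd.simps by blast }
  then show ?thesis using Times by (simp del: bd.simps(1))
next
  case (Pi \<rho> \<sigma>)
  { fix S B assume "bd \<rho> S"
    then have "bd \<rho> {x \<odot> b |x b. x \<in> {y \<odot> a |y a. y \<in> {OC (Pi \<rho> \<sigma>)} \<and> a \<in> S} \<and> b \<in> B}"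
      by (rule bd_expand) (force simp: le_ev_def ev_Ap_iff intro: ev_Pi) }
  then show ?thesis using Pi by simp
next
  case (Sigma \<rho> \<sigma> \<tau>)
  { fix S B D assume S: "bd (\<rho> \<leadsto> \<sigma> \<leadsto> \<tau>) S" and B: "bd (\<rho> \<leadsto> \<sigma>) B" and D: "bd \<rho> D"
    have "bd \<tau> {z \<odot> d |z d. z \<in> {x \<odot> b |x b. x \<in> {y \<odot> a |y a. y \<in> {OC (Sigma \<rho> \<sigma> \<tau>)} \<and> a \<in> S} \<and> b \<in> B} \<and> d \<in> D}"
    proof (rule bd_expand[OF bd_app[OF bd_app[OF S D] bd_app[OF B D]]])
      fix u assume "u \<in> {z \<odot> d |z d. z \<in> {x \<odot> b |x b. x \<in> {y \<odot> a |y a. y \<in> {OC (Sigma \<rho> \<sigma> \<tau>)} \<and> a \<in> S} \<and> b \<in> B} \<and> d \<in> D}"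
      then obtain a b d where u: "u = OC (Sigma \<rho> \<sigma> \<tau>) \<odot> a \<odot> b \<odot> d" "a \<in> S" "b \<in> B" "d \<in> D" by blast
      have "le_ev (a \<odot> d \<odot> (b \<odot> d)) u"
        unfolding u(1) le_ev_def ev_Ap_iff by (simp add: ev_Sigma)
      then show "\<exists>t\<in>{x \<odot> y |x y. x \<in> {a \<odot> b |a b. a \<in> S \<and> b \<in> D} \<and> y \<in> {a \<odot> b |a b. a \<in> B \<and> b \<in> D}}.
          le_ev t u"
        using u by blast
    qed }
  then show ?thesis using Sigma by simp
next
  case (Rec \<rho>)
  { fix F S B assume F: "bd (N \<leadsto> \<rho> \<leadsto> \<rho>) F" and S: "bd \<rho> S" and B: "bd N B"
    then obtain M where M: "\<forall>a\<in>B. \<exists>v\<le>M. ev a [] v" by auto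
    define R where "R k = {OC (Rec \<rho>) \<odot> f \<odot> a \<odot> Num k | f a. f \<in> F \<and> a \<in> S}" for k
    have R: "bd \<rho> (R k)" for k
    proof (induction k)
      case 0
      show ?case unfolding R_def
        by (rule bd_expand[OF S]) (force simp: le_ev_def ev_Ap_iff intro: ev_Rec_0 ev_Num)
    next
      case (Suc k)
      show ?case
      proof (rule bd_expand[OF bd_app[OF bd_app[OF F bd_Num] Suc]])
        fix u assume "u \<in> R (Suc k)"
        then obtain f a where u: "u = OC (Rec \<rho>) \<odot> f \<odot> a \<odot> Num (Suc k)" "f \<in> F" "a \<in> S"
          unfolding R_def by blast
        have "le_ev (f \<odot> Num k \<odot> (OC (Rec \<rho>) \<odot> f \<odot> a \<odot> Num k)) u"
          unfolding u(1) le_ev_def using ev_Rec_Suc[OF ev_Num] by (simp add: ev_Ap_iff)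
        moreover have "f \<odot> Num k \<odot> (OC (Rec \<rho>) \<odot> f \<odot> a \<odot> Num k) \<in>
          {x \<odot> y |x y. x \<in> {a \<odot> b |a b. a \<in> F \<and> b \<in> {Num k}} \<and> y \<in> R k}"
          unfolding R_def using u by blast
        ultimately show "\<exists>t\<in>{x \<odot> y |x y. x \<in> {a \<odot> b |a b. a \<in> F \<and> b \<in> {Num k}} \<and> y \<in> R k}.
          le_ev t u" by blast
      qed
    qed
    have "bd \<rho> (\<Union>k\<le>j. R k)" for j
      by (induction j) (simp_all add: R atMost_Suc bd_Un)
    then have "bd \<rho> (\<Union>k\<le>M. R k)" .
    then have "bd \<rho> {z \<odot> n |z n. z \<in> {x \<odot> a |x a. x \<in> {y \<odot> f |y f. y \<in> {OC (Rec \<rho>)} \<and> f \<in> F} \<and> a \<in> S} \<and> n \<in> B}"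
    proof (rule bd_expand)
      fix u assume "u \<in> {z \<odot> n |z n. z \<in> {x \<odot> a |x a. x \<in> {y \<odot> f |y f. y \<in> {OC (Rec \<rho>)} \<and> f \<in> F} \<and> a \<in> S} \<and> n \<in> B}"
      then obtain f a n where u: "u = OC (Rec \<rho>) \<odot> f \<odot> a \<odot> n" "f \<in> F" "a \<in> S" "n \<in> B" by blast
      then obtain k where k: "k \<le> M" "ev n [] k" using M by blast
      have "ev u cs v" if "ev (OC (Rec \<rho>) \<odot> f \<odot> a \<odot> Num k) cs v" for cs v
      proof -
        have "ev (OC (Rec \<rho>)) (f # a # Num k # cs) v" using that by (simp only: ev_Ap_iff)
        then have "ev (OC (Rec \<rho>)) (f # a # n # cs) v"
          by (rule ev_RecE) (use k(2) in \<open>auto elim!: ev_NumE intro: ev_Rec_0 ev_Rec_Suc\<close>)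
        then show ?thesis unfolding u(1) ev_Ap_iff .
      qed
      then have "le_ev (OC (Rec \<rho>) \<odot> f \<odot> a \<odot> Num k) u" unfolding le_ev_def by blast
      then show "\<exists>t\<in>\<Union>k\<le>M. R k. le_ev t u"
        unfolding R_def using u k by blast
    qed }
  then show ?thesis using Rec by (simp del: bd.simps(1))
qed

lemma bd_T: "wt t \<Longrightarrow> closed_trm t \<Longrightarrow> bd (ty_of t) {emb t}"
proof (induction t)
  case (App s t)
  then have "bd (ty_of t \<leadsto> ty_of (s \<cdot> t)) {emb s}" "bd (ty_of t) {emb t}"
    by (metis closed_trm.simps(3) wt.simps(3))+
  then show ?case using bd_app1 by (metis emb.simps(3))
qed (use bd_cst in auto)

theorem no_T_term_without_search:
  assumes t: "T_term (three \<leadsto> two \<leadsto> one) t" and E: "is_exists3 E" and \<zeta>: "NCC \<zeta>"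
  shows "\<not> (\<forall>Y n. ev (emb t \<odot> F3 E \<odot> F2 Y \<odot> Num n) [] (\<zeta> Y n))"
proof
  assume *: "\<forall>Y n. ev (emb t \<odot> F3 E \<odot> F2 Y \<odot> Num n) [] (\<zeta> Y n)"
  define Z :: "nat \<Rightarrow> fun2" where "Z k g = (if g 0 = k then 0 else 1)" for k g
  have "bd (three \<leadsto> two \<leadsto> one) {emb t}" using bd_T[of t] t unfolding T_term_def by simp
  moreover have "bd three {F3 E}" using E unfolding is_exists3_def by (intro bd_F3) blast
  ultimately have "bd (two \<leadsto> one) {emb t \<odot> F3 E}" by (rule bd_app1)
  moreover have "bd two (F2 ` range Z)" by (rule bd_F2) (auto simp: Z_def)
  ultimately have "bd one {a \<odot> b |a b. a \<in> {emb t \<odot> F3 E} \<and> b \<in> F2 ` range Z}" by (rule bd_app)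
  from bd_app[OF this bd_Num[of 0]]
  have "bd N ((\<lambda>k. emb t \<odot> F3 E \<odot> F2 (Z k) \<odot> Num 0) ` UNIV)" by (rule bd_mono) blast
  then obtain M where M: "\<exists>v\<le>M. ev (emb t \<odot> F3 E \<odot> F2 (Z k) \<odot> Num 0) [] v" for k
    unfolding bd.simps by blast
  have rel: "A_rel (Z k) n m \<longleftrightarrow> m = k" for k n m
    by (auto simp: A_rel_def Z_def code_def intro: exI[of _ "\<lambda>_. 0"])
  have "k \<le> M" for k
  proof -
    have "(\<forall>n. \<exists>m. A_rel (Z k) n m) \<longrightarrow> (\<forall>n. A_rel (Z k) n (\<zeta> (Z k) n))"
      using \<zeta> unfolding NCC_def by (rule spec)
    then have "\<zeta> (Z k) 0 = k" unfolding rel by simp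
    moreover have "ev (emb t \<odot> F3 E \<odot> F2 (Z k) \<odot> Num 0) [] (\<zeta> (Z k) 0)" using * by (elim allE)
    ultimately have k: "ev (emb t \<odot> F3 E \<odot> F2 (Z k) \<odot> Num 0) [] k" by simp
    obtain v where v: "v \<le> M" "ev (emb t \<odot> F3 E \<odot> F2 (Z k) \<odot> Num 0) [] v" using M[of k] by (elim exE conjE)
    show "k \<le> M" using v(1) unfolding ev_det[OF v(2) k] .
  qed
  then show False using not_less_eq_eq by blast
qed

end

(*
From a zeta-functional to exists3. A zeta-functional is total, so it has some value also at those Y
for which A(n, m) never holds. Let m0 = zeta(1)(0) for the constant functional 1. Given Z, let Y be 0
at (f, m, n) if m = m0 + 1 and Z(f) = 0, and 1 otherwise. If Z has a zero, then m0 + 1 is the only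
possible value of zeta(Y)(0); if Z has no zero, then Y is the constant functional 1, and zeta(Y)(0) = m0
by extensionality. So zeta(Y)(0) tells whether Z has a zero. This treats zeros in Cantor space. The
elements of Baire space are coded by 0-1-valued functions f as n |-> mu k. f(<n, k>) = 0, where the
search mu h is zeta(Y)(0) for Y(f, m, n) = h(m).

From exists3 to a zeta-functional. As exists3 decides A(n, m), it remains to search for m. In the formal
system the search operator comes from QF-AC applied to "if h has a zero, then h(m) = 0".

The formal equivalence is derived by completeness: if it were not derivable, there would be a Henkin
model of the axioms in which it fails. In an arbitrary such model, which may have nonstandard numbers,
the arguments above go through on the basis of the ordered semiring axioms and quantifier-free
induction.
*)

theory Submission
  imports Defs "HOL-Library.Countable"
begin

text \<open>Terms such as \<open>mu_tm\<close>, \<open>guard_tm\<close> and \<open>test_tm\<close>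
  are read in two ways: \<open>val\<close> interprets them in an arbitrary model,
  \<open>embe\<close> and \<open>ev\<close> compute them over the full type structure. In each
  reading \<open>lam\<close> is shown once to obey the beta rule (\<open>beta\<close>,
  \<open>le_ev_lam\<close>), and combinators are not unfolded again. For the formal equivalence the
  obstacle is that an axiom is a formula with fixed free variables, so theorems can be instantiated
  freely but derivations from hypotheses cannot. Henkin witnesses are therefore obtained by renaming
  in an implication that is proved from no hypotheses. Provable equality is a congruence for
  application because extensionality is an axiom; this yields the quotient structure. In a model,
  induction is available for quantifier-free formulas only, so terms (predecessor, truncated
  subtraction) stand in for the existential quantifiers that an induction formula would otherwise
  contain. \<open>E\<close> quantifies over all functions, whereas the searches concern numbers and
  Cantor space: a number enters as the value \<open>g 0\<close> of a function, a 0-1-valued function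
  as the sign of an arbitrary one.\<close>

section \<open>Simultaneous substitution with indices counted per type\<close>

text \<open>Polymorphic in the values: with terms it is a substitution, with elements of a structure
  an environment, with \<open>otm\<close> an environment for evaluation. At \<open>k = 0\<close> it
  enters the scope of a quantifier of type \<open>\<rho>\<close>.\<close>

definition ins :: "ty \<Rightarrow> nat \<Rightarrow> 'a \<Rightarrow> (ty \<Rightarrow> nat \<Rightarrow> 'a) \<Rightarrow> ty \<Rightarrow> nat \<Rightarrow> 'a" where
  "ins \<rho> k x e = (\<lambda>\<sigma> i. if \<sigma> = \<rho> then (if i < k then e \<sigma> i else if i = k then x else e \<sigma> (i - 1)) else e \<sigma> i)"

fun psubst :: "(ty \<Rightarrow> nat \<Rightarrow> trm) \<Rightarrow> trm \<Rightarrow> trm" where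
  "psubst s (Var \<rho> i) = s \<rho> i"
| "psubst s (Cst c) = Cst c"
| "psubst s (t \<cdot> u) = psubst s t \<cdot> psubst s u"

definition up :: "ty \<Rightarrow> (ty \<Rightarrow> nat \<Rightarrow> trm) \<Rightarrow> ty \<Rightarrow> nat \<Rightarrow> trm" where
  "up \<rho> s = ins \<rho> 0 (Var \<rho> 0) (\<lambda>\<sigma> i. lift \<rho> 0 (s \<sigma> i))"

fun psubstf :: "(ty \<Rightarrow> nat \<Rightarrow> trm) \<Rightarrow> fm \<Rightarrow> fm" where
  "psubstf s Fls = Fls"
| "psubstf s (Eq t u) = Eq (psubst s t) (psubst s u)"
| "psubstf s (Less t u) = Less (psubst s t) (psubst s u)"
| "psubstf s (And \<phi> \<psi>) = And (psubstf s \<phi>) (psubstf s \<psi>)"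
| "psubstf s (Or \<phi> \<psi>) = Or (psubstf s \<phi>) (psubstf s \<psi>)"
| "psubstf s (Imp \<phi> \<psi>) = Imp (psubstf s \<phi>) (psubstf s \<psi>)"
| "psubstf s (All \<rho> \<phi>) = All \<rho> (psubstf (up \<rho> s) \<phi>)"
| "psubstf s (Ex \<rho> \<phi>) = Ex \<rho> (psubstf (up \<rho> s) \<phi>)"

definition shift :: "ty \<Rightarrow> nat \<Rightarrow> ty \<Rightarrow> nat \<Rightarrow> trm" where
  "shift \<rho> k \<sigma> i = Var \<sigma> (if \<sigma> = \<rho> \<and> k \<le> i then Suc i else i)"

text \<open>\<open>lift\<close> and \<open>subst\<close> become instances of \<open>psubst\<close>,
  so that their commutation laws all follow from the one composition law for
  \<open>psubst\<close>.\<close>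

lemma lift_psubst: "lift \<rho> k t = psubst (shift \<rho> k) t"
  by (induction t) (auto simp: shift_def)

lemma subst_psubst: "subst \<rho> k u t = psubst (ins \<rho> k u Var) t"
  by (induction t) (auto simp: ins_def)

lemma up_shift: "up \<sigma> (shift \<rho> k) = shift \<rho> (if \<sigma> = \<rho> then Suc k else k)"
  by (intro ext) (auto simp: up_def ins_def shift_def)

lemma up_ins: "up \<sigma> (ins \<rho> k u Var) = ins \<rho> (if \<sigma> = \<rho> then Suc k else k) (lift \<sigma> 0 u) Var"
  by (intro ext) (auto simp: up_def ins_def)

lemma liftf_psubstf: "liftf \<rho> k \<phi> = psubstf (shift \<rho> k) \<phi>"
  by (induction \<phi> arbitrary: k) (simp_all add: lift_psubst up_shift)

lemma substf_psubstf: "substf \<rho> k u \<phi> = psubstf (ins \<rho> k u Var) \<phi>"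
  by (induction \<phi> arbitrary: k u) (simp_all add: subst_psubst up_ins)

lemma psubst_psubst: "psubst s (psubst r t) = psubst (\<lambda>\<sigma> i. psubst s (r \<sigma> i)) t"
  by (induction t) auto

lemma psubst_up_lift: "psubst (up \<rho> s) (lift \<rho> 0 t) = lift \<rho> 0 (psubst s t)"
  by (induction t) (auto simp: up_def ins_def)

lemma up_comp: "(\<lambda>\<sigma> i. psubst (up \<rho> s) (up \<rho> r \<sigma> i)) = up \<rho> (\<lambda>\<sigma> i. psubst s (r \<sigma> i))"
proof (intro ext)
  fix \<sigma> i
  show "psubst (up \<rho> s) (up \<rho> r \<sigma> i) = up \<rho> (\<lambda>\<sigma> i. psubst s (r \<sigma> i)) \<sigma> i"
    using psubst_up_lift[of \<rho> s] by (auto simp: up_def[of \<rho> r] up_def[of \<rho> "\<lambda>\<sigma> i. psubst s (r \<sigma> i)"] ins_def)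
      (auto simp: up_def ins_def)
qed

lemma psubstf_psubstf: "psubstf s (psubstf r \<phi>) = psubstf (\<lambda>\<sigma> i. psubst s (r \<sigma> i)) \<phi>"
  by (induction \<phi> arbitrary: s r) (simp_all add: psubst_psubst up_comp)

lemma psubst_Var [simp]: "psubst Var t = t"
  by (induction t) auto

lemma up_Var [simp]: "up \<rho> Var = Var"
  by (intro ext) (auto simp: up_def ins_def)

lemma psubstf_Var [simp]: "psubstf Var \<phi> = \<phi>"
  by (induction \<phi>) auto

lemma subst_lift [simp]: "subst \<rho> k u (lift \<rho> k t) = t"
  by (induction t) auto

lemma subst_up: "subst \<rho> 0 t (up \<rho> s \<sigma> i) = ins \<rho> 0 t s \<sigma> i"
  by (auto simp: up_def ins_def)

text \<open>Instantiating a quantifier after substituting under it is again one simultaneous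
  substitution. Both \<open>thm_inst\<close> and the quantifier cases of \<open>truth\<close> rest
  on this.\<close>

lemma substf_up: "substf \<rho> 0 t (psubstf (up \<rho> s) \<phi>) = psubstf (ins \<rho> 0 t s) \<phi>"
  by (simp add: substf_psubstf psubstf_psubstf flip: subst_psubst) (simp add: subst_up)

section \<open>Free variables and typing of substitutions\<close>

fun fv :: "trm \<Rightarrow> (ty \<times> nat) set" where
  "fv (Var \<rho> i) = {(\<rho>, i)}"
| "fv (Cst c) = {}"
| "fv (s \<cdot> t) = fv s \<union> fv t"

text \<open>At a quantifier the map takes an outside index to the index inside the scope; the bound
  variable is not in its range and so drops out of the preimage.\<close>

fun fvf :: "fm \<Rightarrow> (ty \<times> nat) set" where
  "fvf Fls = {}"
| "fvf (Eq s t) = fv s \<union> fv t"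
| "fvf (Less s t) = fv s \<union> fv t"
| "fvf (And \<phi> \<psi>) = fvf \<phi> \<union> fvf \<psi>"
| "fvf (Or \<phi> \<psi>) = fvf \<phi> \<union> fvf \<psi>"
| "fvf (Imp \<phi> \<psi>) = fvf \<phi> \<union> fvf \<psi>"
| "fvf (All \<rho> \<phi>) = (\<lambda>(\<sigma>, i). (\<sigma>, if \<sigma> = \<rho> then Suc i else i)) -` fvf \<phi>"
| "fvf (Ex \<rho> \<phi>) = (\<lambda>(\<sigma>, i). (\<sigma>, if \<sigma> = \<rho> then Suc i else i)) -` fvf \<phi>"

lemma finite_fv: "finite (fv t)"
  by (induction t) auto

lemma finite_fvf: "finite (fvf \<phi>)"
  by (induction \<phi>) (auto simp: finite_fv intro!: finite_vimageI injI split: if_splits)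

lemma idx_bound: "finite A \<Longrightarrow> \<exists>n::nat. \<forall>\<sigma> i. (\<sigma>, i) \<in> A \<longrightarrow> i < n"
  using finite_nat_set_iff_bounded[of "snd ` A"] by (metis finite_imageI image_eqI snd_conv)

lemma psubst_cong: "(\<And>\<sigma> i. (\<sigma>, i) \<in> fv t \<Longrightarrow> s \<sigma> i = r \<sigma> i) \<Longrightarrow> psubst s t = psubst r t"
  by (induction t) auto

lemma up_cong:
  assumes "\<forall>(\<sigma>, i) \<in> fvf (All \<rho> \<phi>). s \<sigma> i = r \<sigma> i"
  shows "\<forall>(\<sigma>, i) \<in> fvf \<phi>. up \<rho> s \<sigma> i = up \<rho> r \<sigma> i"
proof clarify
  fix \<sigma> i assume *: "(\<sigma>, i) \<in> fvf \<phi>"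
  show "up \<rho> s \<sigma> i = up \<rho> r \<sigma> i"
  proof (cases "\<sigma> = \<rho> \<and> i = 0")
    case False
    then have "(\<sigma>, if \<sigma> = \<rho> then i - 1 else i) \<in> fvf (All \<rho> \<phi>)" using * by auto
    from bspec[OF assms this] False show ?thesis by (auto simp: up_def ins_def)
  qed (simp add: up_def ins_def)
qed

lemma psubstf_cong: "\<forall>(\<sigma>, i) \<in> fvf \<phi>. s \<sigma> i = r \<sigma> i \<Longrightarrow> psubstf s \<phi> = psubstf r \<phi>"
proof (induction \<phi> arbitrary: s r)
  case (Eq t u)
  have "psubst s t = psubst r t" "psubst s u = psubst r u"
    by (rule psubst_cong; use Eq in auto)+
  then show ?case by simp
next
  case (Less t u)
  have "psubst s t = psubst r t" "psubst s u = psubst r u"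
    by (rule psubst_cong; use Less in auto)+
  then show ?case by simp
next
  case (All \<rho> \<phi>)
  from All.IH[OF up_cong[OF All.prems]] show ?case by simp
next
  case (Ex \<rho> \<phi>)
  have "\<forall>(\<sigma>, i) \<in> fvf (All \<rho> \<phi>). s \<sigma> i = r \<sigma> i" using Ex.prems by simp
  from Ex.IH[OF up_cong[OF this]] show ?case by simp
next
  case (And \<phi> \<psi>)
  from And.IH[of s r] And.prems show ?case by simp
next
  case (Or \<phi> \<psi>)
  from Or.IH[of s r] Or.prems show ?case by simp
next
  case (Imp \<phi> \<psi>)
  from Imp.IH[of s r] Imp.prems show ?case by simp
qed simp

definition typed :: "(ty \<Rightarrow> nat \<Rightarrow> trm) \<Rightarrow> bool" where
  "typed s \<longleftrightarrow> (\<forall>\<sigma> i. has_ty (s \<sigma> i) \<sigma>)"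

lemma typed_Var: "typed Var"
  by (simp add: typed_def)

lemma ty_psubst: "typed s \<Longrightarrow> ty_of (psubst s t) = ty_of t"
  by (induction t) (auto simp: typed_def)

lemma has_ty_psubst: "typed s \<Longrightarrow> has_ty t \<rho> \<Longrightarrow> has_ty (psubst s t) \<rho>"
  by (induction t arbitrary: \<rho>) (auto simp: typed_def ty_psubst[unfolded typed_def])

lemma typed_shift: "typed (shift \<rho> k)"
  by (simp add: typed_def shift_def)

lemma has_ty_lift: "has_ty t \<sigma> \<Longrightarrow> has_ty (lift \<rho> k t) \<sigma>"
  unfolding lift_psubst by (rule has_ty_psubst[OF typed_shift])

lemma typed_ins: "typed s \<Longrightarrow> has_ty t \<rho> \<Longrightarrow> typed (ins \<rho> k t s)"
  by (auto simp: typed_def ins_def)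

lemma typed_up: "typed s \<Longrightarrow> typed (up \<rho> s)"
  unfolding up_def by (rule typed_ins) (auto simp: typed_def has_ty_lift)

lemma wff_psubstf: "typed s \<Longrightarrow> wff \<phi> \<Longrightarrow> wff (psubstf s \<phi>)"
  by (induction \<phi> arbitrary: s) (auto simp: has_ty_psubst ty_psubst typed_up)

lemma wff_substf: "has_ty t \<rho> \<Longrightarrow> wff \<phi> \<Longrightarrow> wff (substf \<rho> k t \<phi>)"
  unfolding substf_psubstf by (intro wff_psubstf typed_ins typed_Var)

lemma psubstf_eqf: "psubstf s (eqf \<tau> t u) = eqf \<tau> (psubst s t) (psubst s u)"
  by (induction \<tau> arbitrary: s t u) (simp_all add: psubst_up_lift, simp add: up_def ins_def)

lemma substf_eqf: "substf \<rho> k v (eqf \<tau> t u) = eqf \<tau> (subst \<rho> k v t) (subst \<rho> k v u)"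
  by (simp add: substf_psubstf subst_psubst psubstf_eqf)

lemma wff_eqf: "has_ty s \<rho> \<Longrightarrow> has_ty t \<rho> \<Longrightarrow> wff (eqf \<rho> s t)"
proof (induction \<rho> arbitrary: s t)
  case (Fn \<sigma> \<tau>)
  then have "has_ty (lift \<sigma> 0 s) (\<sigma> \<leadsto> \<tau>)" "has_ty (lift \<sigma> 0 t) (\<sigma> \<leadsto> \<tau>)"
    by (simp_all add: has_ty_lift)
  then show ?case by (auto intro!: Fn.IH)
qed simp

section \<open>Derivations\<close>

lemma weaken: "\<Gamma> \<turnstile> \<phi> \<Longrightarrow> \<Gamma> \<subseteq> \<Delta> \<Longrightarrow> \<Delta> \<turnstile> \<phi>"
proof (induction arbitrary: \<Delta> rule: RCA.induct)
  case (Contr \<phi> \<Gamma>)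
  then show ?case by (meson RCA.Contr insert_mono)
next
  case (OrE \<Gamma> \<phi> \<psi> \<chi>)
  then show ?case by (meson RCA.OrE insert_mono)
next
  case (ImpI \<phi> \<Gamma> \<psi>)
  then show ?case by (meson RCA.ImpI insert_mono)
next
  case (AllI \<rho> \<Gamma> \<phi>)
  then show ?case by (meson RCA.AllI image_mono)
next
  case (ExE \<Gamma> \<rho> \<phi> \<psi>)
  then show ?case by (meson RCA.ExE insert_mono image_mono)
qed (blast intro: RCA.intros)+

lemma cut: "\<Gamma> \<turnstile> \<phi> \<Longrightarrow> insert \<phi> \<Gamma> \<turnstile> \<psi> \<Longrightarrow> wff \<phi> \<Longrightarrow> \<Gamma> \<turnstile> \<psi>"
  by (blast intro: ImpI ImpE)

lemma cut1: "{\<gamma>} \<turnstile> \<phi> \<Longrightarrow> {\<phi>} \<turnstile> \<psi> \<Longrightarrow> wff \<phi> \<Longrightarrow> {\<gamma>} \<turnstile> \<psi>"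
  by (rule cut[where \<phi> = \<phi>]) (auto elim: weaken)

fun inst :: "(ty \<times> trm) list \<Rightarrow> ty \<Rightarrow> nat \<Rightarrow> trm" where
  "inst [] = Var"
| "inst ((\<rho>, t) # L) = ins \<rho> 0 t (inst L)"

text \<open>With an empty context \<open>AllI\<close> is unrestricted. The induction hypothesis is
  applied to the generalized formula, where the remaining substitution acts under the binder as
  \<open>up\<close>.\<close>

lemma thm_inst:
  "{} \<turnstile> \<phi> \<Longrightarrow> (\<And>\<rho> t. (\<rho>, t) \<in> set L \<Longrightarrow> has_ty t \<rho>) \<Longrightarrow> {} \<turnstile> psubstf (inst L) \<phi>"
proof (induction L arbitrary: \<phi>)
  case (Cons p L)
  obtain \<rho> t where p: "p = (\<rho>, t)" by force
  have "{} \<turnstile> All \<rho> \<phi>" using Cons.prems(1) by (intro AllI) simp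
  then have "{} \<turnstile> psubstf (inst L) (All \<rho> \<phi>)" by (rule Cons.IH) (use Cons.prems(2) in auto)
  then have "{} \<turnstile> substf \<rho> 0 t (psubstf (up \<rho> (inst L)) \<phi>)"
    unfolding psubstf.simps by (rule AllE[OF _ Cons.prems(2)[of \<rho> t]]) (simp_all add: p)
  then show ?case by (simp add: p substf_up)
qed simp

text \<open>A block of entries of one type replaces as many initial indices and lets the later ones
  sink accordingly. Hence \<open>ex_inst\<close> can prescribe a substitution below a bound only,
  which is enough for the finitely many variables of a formula.\<close>

lemma inst_block:
  "inst (map (\<lambda>i. (\<rho>, s i)) [k..<n] @ L) \<sigma> i =
    (if \<sigma> = \<rho> then (if i < n - k then s (k + i) else inst L \<sigma> (i - (n - k))) else inst L \<sigma> i)"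
proof (induction "n - k" arbitrary: k i)
  case (Suc d)
  then have "[k..<n] = k # [Suc k..<n]" by (simp add: upt_conv_Cons)
  then show ?case using Suc(1)[of "Suc k"] Suc(2) by (auto simp: ins_def)
qed simp

lemma ex_inst: "\<exists>L. (\<forall>(\<sigma>, t) \<in> set L. \<exists>i. t = s \<sigma> i) \<and> (\<forall>\<sigma> \<in> set R. \<forall>i<n. inst L \<sigma> i = s \<sigma> i)"
proof (induction R)
  case (Cons \<rho> R)
  then obtain L where L: "\<forall>(\<sigma>, t) \<in> set L. \<exists>i. t = s \<sigma> i" "\<forall>\<sigma> \<in> set R. \<forall>i<n. inst L \<sigma> i = s \<sigma> i"
    by blast
  show ?case
    by (rule exI[of _ "map (\<lambda>i. (\<rho>, s \<rho> i)) [0..<n] @ L"]) (use L in \<open>auto simp: inst_block\<close>)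
qed (auto intro: exI[of _ "[]"])

text \<open>The axioms have fixed free variables, so derivations from hypotheses are not closed under
  substitution by a plain induction; theorems are, by generalizing and instantiating.\<close>

lemma thm_psubstf:
  assumes "{} \<turnstile> \<phi>" and s: "typed s"
  shows "{} \<turnstile> psubstf s \<phi>"
proof -
  obtain R where R: "set R = fst ` fvf \<phi>" using finite_list[OF finite_imageI[OF finite_fvf]] by metis
  obtain n where n: "\<And>\<sigma> i. (\<sigma>, i) \<in> fvf \<phi> \<Longrightarrow> i < n"
    using idx_bound[OF finite_fvf[of \<phi>]] by blast
  obtain L where L: "\<forall>(\<sigma>, t) \<in> set L. \<exists>i. t = s \<sigma> i" "\<forall>\<sigma> \<in> set R. \<forall>i<n. inst L \<sigma> i = s \<sigma> i"
    using ex_inst[of s R n] by blast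
  have "{} \<turnstile> psubstf (inst L) \<phi>"
  proof (rule thm_inst[OF assms(1)])
    fix \<rho> t assume "(\<rho>, t) \<in> set L"
    then obtain i where "t = s \<rho> i" using L(1) by blast
    then show "has_ty t \<rho>" using s by (simp add: typed_def)
  qed
  also have "psubstf (inst L) \<phi> = psubstf s \<phi>"
  proof (rule psubstf_cong, clarify)
    fix \<sigma> i assume *: "(\<sigma>, i) \<in> fvf \<phi>"
    then have "\<sigma> \<in> set R" unfolding R by force
    with L(2) n[OF *] show "inst L \<sigma> i = s \<sigma> i" by blast
  qed
  finally show ?thesis .
qed

text \<open>A renaming turns the instance at the fresh variable into the hypothesis that
  \<open>ExE\<close> adds: \<open>\<gamma>\<close> becomes its lifting, and the instance becomes
  \<open>\<phi>\<close> itself. Inside the scope of the quantifier the fresh variable has index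
  \<open>Suc i\<close>, hence the second freshness condition.\<close>

lemma fresh_witness:
  assumes d: "{And \<gamma> (substf \<rho> 0 (Var \<rho> i) \<phi>)} \<turnstile> Fls" and wf: "wff \<gamma>" "wff \<phi>"
    and i: "(\<rho>, i) \<notin> fvf \<gamma>" "(\<rho>, Suc i) \<notin> fvf \<phi>"
  shows "{And \<gamma> (Ex \<rho> \<phi>)} \<turnstile> Fls"
proof -
  \<comment> \<open>The fresh variable goes to index 0 and every other variable of type
    \<open>\<rho>\<close> moves up by one; where \<open>i\<close> does not occur, this is
    lifting.\<close>
  define r where "r = (\<lambda>\<sigma> j. Var \<sigma> (if \<sigma> = \<rho> then (if j = i then 0 else Suc j) else j))"
  have wff': "wff (And \<gamma> (substf \<rho> 0 (Var \<rho> i) \<phi>))" using wf by (simp add: wff_substf)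
  have "{} \<turnstile> Imp (And \<gamma> (substf \<rho> 0 (Var \<rho> i) \<phi>)) Fls" by (rule ImpI[OF d wff'])
  then have "{} \<turnstile> psubstf r (Imp (And \<gamma> (substf \<rho> 0 (Var \<rho> i) \<phi>)) Fls)"
    by (rule thm_psubstf) (simp add: typed_def r_def)
  moreover have "psubstf r \<gamma> = liftf \<rho> 0 \<gamma>"
    unfolding liftf_psubstf
  proof (rule psubstf_cong, clarify)
    fix \<sigma> j assume "(\<sigma>, j) \<in> fvf \<gamma>"
    then have "\<not> (\<sigma> = \<rho> \<and> j = i)" using i(1) by blast
    then show "r \<sigma> j = shift \<rho> 0 \<sigma> j" by (simp add: r_def shift_def)
  qed
  moreover have "psubstf r (substf \<rho> 0 (Var \<rho> i) \<phi>) = psubstf Var \<phi>"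
    unfolding substf_psubstf psubstf_psubstf
  proof (rule psubstf_cong, clarify)
    fix \<sigma> j assume "(\<sigma>, j) \<in> fvf \<phi>"
    then have "\<not> (\<sigma> = \<rho> \<and> j = Suc i)" using i(2) by blast
    then show "psubst r (ins \<rho> 0 (Var \<rho> i) Var \<sigma> j) = Var \<sigma> j"
      by (cases j) (simp_all add: r_def ins_def)
  qed
  ultimately have *: "{} \<turnstile> Imp (And (liftf \<rho> 0 \<gamma>) \<phi>) Fls" by simp
  let ?\<Gamma> = "{And \<gamma> (Ex \<rho> \<phi>)}"
  have A: "?\<Gamma> \<turnstile> And \<gamma> (Ex \<rho> \<phi>)" using wf by (intro Assm) simp_all
  have wl: "wff (liftf \<rho> 0 \<gamma>)" "wff (liftf \<rho> (Suc 0) \<phi>)"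
    unfolding liftf_psubstf by (rule wff_psubstf[OF typed_shift wf(1)], rule wff_psubstf[OF typed_shift wf(2)])
  let ?\<Delta> = "insert \<phi> (liftf \<rho> 0 ` ?\<Gamma>)"
  have "?\<Delta> \<turnstile> And (liftf \<rho> 0 \<gamma>) (liftf \<rho> 0 (Ex \<rho> \<phi>))" using wl by (intro Assm) simp_all
  then have "?\<Delta> \<turnstile> liftf \<rho> 0 \<gamma>" by (rule AndE1)
  moreover have "?\<Delta> \<turnstile> \<phi>" by (rule Assm) (simp_all add: wf)
  ultimately have "?\<Delta> \<turnstile> And (liftf \<rho> 0 \<gamma>) \<phi>" by (rule AndI)
  with weaken[OF * empty_subsetI] have "?\<Delta> \<turnstile> Fls" by (rule ImpE)
  then have "?\<Delta> \<turnstile> liftf \<rho> 0 Fls" by simp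
  from ExE[OF AndE2[OF A] this] show ?thesis by simp
qed

section \<open>Henkin theories\<close>

instance ty :: countable by countable_datatype
instance cst :: countable by countable_datatype
instance trm :: countable by countable_datatype
instance fm :: countable by countable_datatype

lemma AndD: "wff \<phi> \<Longrightarrow> wff \<psi> \<Longrightarrow> {And \<phi> \<psi>} \<turnstile> \<phi>" "wff \<phi> \<Longrightarrow> wff \<psi> \<Longrightarrow> {And \<phi> \<psi>} \<turnstile> \<psi>"
  by (rule AndE1 AndE2, rule Assm; simp)+

lemma And_Fls:
  assumes "{And \<gamma> \<psi>} \<turnstile> Fls" "wff \<gamma>" "wff \<psi>"
  shows "{\<gamma>} \<turnstile> Neg \<psi>"
proof (rule ImpI)
  have "insert (And \<gamma> \<psi>) {\<psi>, \<gamma>} \<turnstile> Fls" using assms(1) by (rule weaken) auto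
  moreover have "{\<psi>, \<gamma>} \<turnstile> And \<gamma> \<psi>" using assms(2,3) by (intro AndI Assm) simp_all
  ultimately show "{\<psi>, \<gamma>} \<turnstile> Fls" using assms(2,3) cut[of "{\<psi>, \<gamma>}" "And \<gamma> \<psi>"] by simp
qed (rule assms)

lemma henkin_step:
  assumes con: "\<not> {\<gamma>} \<turnstile> Fls" and wf: "wff \<gamma>" "wff \<psi>"
  shows "\<exists>\<gamma>'. wff \<gamma>' \<and> \<not> {\<gamma>'} \<turnstile> Fls \<and> {\<gamma>'} \<turnstile> \<gamma> \<and> ({\<gamma>'} \<turnstile> \<psi> \<or> {\<gamma>'} \<turnstile> Neg \<psi>) \<and>
    (\<forall>\<rho> \<phi>. \<psi> = Ex \<rho> \<phi> \<and> {\<gamma>'} \<turnstile> \<psi> \<longrightarrow> (\<exists>t. has_ty t \<rho> \<and> {\<gamma>'} \<turnstile> substf \<rho> 0 t \<phi>))"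
proof (cases "{And \<gamma> \<psi>} \<turnstile> Fls")
  case True
  then have n: "{\<gamma>} \<turnstile> Neg \<psi>" using And_Fls wf by blast
  \<comment> \<open>By consistency \<open>\<psi>\<close> is not derivable, so the demand for a
    witness is void.\<close>
  have "\<not> {\<gamma>} \<turnstile> \<psi>" using con n ImpE by blast
  moreover have "{\<gamma>} \<turnstile> \<gamma>" using wf by (intro Assm) auto
  ultimately show ?thesis using n con wf by blast
next
  case False
  show ?thesis
  proof (cases "\<exists>\<rho> \<phi>. \<psi> = Ex \<rho> \<phi>")
    case True
    then obtain \<rho> \<phi> where \<psi>: "\<psi> = Ex \<rho> \<phi>" by blast
    \<comment> \<open>One bound on the indices of all types keeps \<open>i\<close> and
      \<open>Suc i\<close> outside both sets of free variables.\<close>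
    obtain i where i: "\<And>\<sigma> j. (\<sigma>, j) \<in> fvf (And \<gamma> \<psi>) \<union> fvf \<phi> \<Longrightarrow> j < i"
      using idx_bound[of "fvf (And \<gamma> \<psi>) \<union> fvf \<phi>"] finite_fvf finite_UnI by blast
    define \<chi> where "\<chi> = substf \<rho> 0 (Var \<rho> i) \<phi>"
    let ?g = "And (And \<gamma> \<psi>) \<chi>"
    have w\<chi>: "wff \<chi>" unfolding \<chi>_def using wf \<psi> by (intro wff_substf) auto
    have "\<not> {?g} \<turnstile> Fls"
    proof
      assume *: "{?g} \<turnstile> Fls"
      have "{And (And \<gamma> \<psi>) (Ex \<rho> \<phi>)} \<turnstile> Fls"
      proof (rule fresh_witness)
        show "{And (And \<gamma> \<psi>) (substf \<rho> 0 (Var \<rho> i) \<phi>)} \<turnstile> Fls" using * unfolding \<chi>_def .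
        show "(\<rho>, i) \<notin> fvf (And \<gamma> \<psi>)" using i by blast
        show "(\<rho>, Suc i) \<notin> fvf \<phi>" using i[of \<rho> "Suc i"] by auto
      qed (use wf \<psi> in auto)
      moreover have "{And \<gamma> \<psi>} \<turnstile> And (And \<gamma> \<psi>) (Ex \<rho> \<phi>)"
        using AndD(2)[of \<gamma> \<psi>] wf \<psi> by (intro AndI[OF Assm]) simp_all
      ultimately have "{And \<gamma> \<psi>} \<turnstile> Fls" using cut1 wf \<psi> by auto
      with False show False ..
    qed
    moreover have "{?g} \<turnstile> And \<gamma> \<psi>" "{?g} \<turnstile> \<chi>" using AndD w\<chi> wf by auto
    ultimately show ?thesis
      using w\<chi> wf \<psi> AndE1[OF \<open>{?g} \<turnstile> And \<gamma> \<psi>\<close>] AndE2[OF \<open>{?g} \<turnstile> And \<gamma> \<psi>\<close>]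
      by (intro exI[of _ ?g]) (auto simp: \<chi>_def intro!: exI[of _ "Var \<rho> i"])
  next
    case nex: False
    then show ?thesis using False wf AndD[of \<gamma> \<psi>] by (intro exI[of _ "And \<gamma> \<psi>"]) auto
  qed
qed

lemma multi_cut:
  "finite \<Gamma> \<Longrightarrow> insert \<gamma> \<Gamma> \<turnstile> \<phi> \<Longrightarrow> \<forall>\<psi>\<in>\<Gamma>. {\<gamma>} \<turnstile> \<psi> \<and> wff \<psi> \<Longrightarrow> {\<gamma>} \<turnstile> \<phi>"
proof (induction \<Gamma> arbitrary: \<phi> rule: finite_induct)
  case (insert \<psi> \<Gamma>)
  have \<psi>: "{\<gamma>} \<turnstile> \<psi>" "wff \<psi>" using insert.prems(2) by auto
  have "insert \<gamma> \<Gamma> \<turnstile> Imp \<psi> \<phi>"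
    using insert.prems(1) \<psi>(2) by (intro ImpI) (simp_all add: insert_commute)
  then have "{\<gamma>} \<turnstile> Imp \<psi> \<phi>" by (rule insert.IH) (use insert.prems(2) in simp)
  then show ?case using \<psi>(1) by (rule ImpE)
qed simp

text \<open>Closure is demanded for finite contexts: all members of such a context are derivable at
  a single stage of the chain constructed below.\<close>

locale henkin =
  fixes H :: "fm set"
  assumes ded: "\<lbrakk>\<Gamma> \<turnstile> \<phi>; \<Gamma> \<subseteq> H; finite \<Gamma>; wff \<phi>\<rbrakk> \<Longrightarrow> \<phi> \<in> H"
    and Fls_H: "Fls \<notin> H"
    and complete: "wff \<phi> \<Longrightarrow> \<phi> \<in> H \<or> Neg \<phi> \<in> H"
    and witness: "Ex \<rho> \<phi> \<in> H \<Longrightarrow> \<exists>t. has_ty t \<rho> \<and> substf \<rho> 0 t \<phi> \<in> H"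
    and wff_H: "\<phi> \<in> H \<Longrightarrow> wff \<phi>"

lemma henkin_extension:
  assumes con: "\<not> {\<gamma>} \<turnstile> Fls" and wf: "wff \<gamma>"
  shows "\<exists>H. henkin H \<and> \<gamma> \<in> H"
proof -
  \<comment> \<open>The clause for \<open>n = 0\<close> fixes the first formula of the chain, which
    dependent choice would leave open.\<close>
  define P where "P n g \<longleftrightarrow> wff g \<and> \<not> {g} \<turnstile> Fls \<and> (n = 0 \<longrightarrow> g = \<gamma>)" for n :: nat and g
  \<comment> \<open>The formula with number \<open>n\<close> is decided at step \<open>n\<close>;
    for the number of an ill-formed formula, only the old stage has to remain derivable.\<close>
  define Q where "Q n g g' \<longleftrightarrow> {g'} \<turnstile> g \<and> (wff (from_nat n) \<longrightarrow> ({g'} \<turnstile> from_nat n \<or> {g'} \<turnstile> Neg (from_nat n)) \<and>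
     (\<forall>\<rho> \<phi>. from_nat n = Ex \<rho> \<phi> \<and> {g'} \<turnstile> from_nat n \<longrightarrow> (\<exists>t. has_ty t \<rho> \<and> {g'} \<turnstile> substf \<rho> 0 t \<phi>)))"
    for n :: nat and g g'
  have "\<exists>G. \<forall>n. P n (G n) \<and> Q n (G n) (G (Suc n))"
  proof (rule dependent_nat_choice)
    show "\<exists>g. P 0 g" using con wf by (auto simp: P_def)
    fix g n assume "P n g"
    then have g: "\<not> {g} \<turnstile> Fls" "wff g" by (auto simp: P_def)
    show "\<exists>g'. P (Suc n) g' \<and> Q n g g'"
    proof (cases "wff (from_nat n)")
      case True
      from henkin_step[OF g True] show ?thesis unfolding P_def Q_def by auto
    next
      case False
      then show ?thesis using g Assm[of g "{g}"] unfolding P_def Q_def by auto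
    qed
  qed
  then obtain G where P: "\<And>n. P n (G n)" and Q: "\<And>n. Q n (G n) (G (Suc n))" by blast
  have G: "wff (G n)" "\<not> {G n} \<turnstile> Fls" "G 0 = \<gamma>" for n using P[of n] P[of 0] by (auto simp: P_def)
  have mono: "{G (n + k)} \<turnstile> G n" for n k
  proof (induction k)
    case 0
    then show ?case using G by (auto intro: Assm)
  next
    case (Suc k)
    have "{G (Suc (n + k))} \<turnstile> G (n + k)" using Q[of "n + k"] by (auto simp: Q_def)
    from cut1[OF this Suc] G show ?case by simp
  qed
  then have mono: "m \<ge> n \<Longrightarrow> {G m} \<turnstile> G n" for m n by (metis le_add_diff_inverse)
  then have mono: "\<lbrakk>{G n} \<turnstile> \<phi>; n \<le> m\<rbrakk> \<Longrightarrow> {G m} \<turnstile> \<phi>" for m n \<phi> using cut1 G by blast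
  define H where "H = {\<phi>. wff \<phi> \<and> (\<exists>n. {G n} \<turnstile> \<phi>)}"
  have fin: "\<exists>n. \<forall>\<phi>\<in>\<Gamma>. {G n} \<turnstile> \<phi>" if "finite \<Gamma>" "\<Gamma> \<subseteq> H" for \<Gamma>
    using that
  proof (induction \<Gamma>)
    case (insert \<phi> \<Gamma>)
    then obtain n m where "\<forall>\<phi>\<in>\<Gamma>. {G n} \<turnstile> \<phi>" "{G m} \<turnstile> \<phi>" by (auto simp: H_def)
    then have "\<forall>\<psi>\<in>insert \<phi> \<Gamma>. {G (max n m)} \<turnstile> \<psi>" using mono by (metis insert_iff max.cobounded1 max.cobounded2)
    then show ?case ..
  qed simp
  have ded: "\<phi> \<in> H" if d: "\<Gamma> \<turnstile> \<phi>" "\<Gamma> \<subseteq> H" "finite \<Gamma>" "wff \<phi>" for \<Gamma> \<phi>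
  proof -
    obtain n where n: "\<forall>\<phi>\<in>\<Gamma>. {G n} \<turnstile> \<phi>" using fin[OF d(3,2)] by blast
    have "insert (G n) \<Gamma> \<turnstile> \<phi>" using d(1) by (rule weaken) blast
    with d(3) have "{G n} \<turnstile> \<phi>" by (rule multi_cut) (use d(2) n in \<open>auto simp: H_def\<close>)
    then show ?thesis using d(4) unfolding H_def by blast
  qed
  have Q': "({G (Suc (to_nat \<phi>))} \<turnstile> \<phi> \<or> {G (Suc (to_nat \<phi>))} \<turnstile> Neg \<phi>) \<and>
     (\<forall>\<rho> \<psi>. \<phi> = Ex \<rho> \<psi> \<and> {G (Suc (to_nat \<phi>))} \<turnstile> \<phi> \<longrightarrow> (\<exists>t. has_ty t \<rho> \<and> {G (Suc (to_nat \<phi>))} \<turnstile> substf \<rho> 0 t \<psi>))"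
    if "wff \<phi>" for \<phi>
    using Q[of "to_nat \<phi>"] that unfolding Q_def from_nat_to_nat by blast
  have "henkin H"
  proof
    show "Fls \<notin> H" using G by (auto simp: H_def)
    show "\<phi> \<in> H \<or> Neg \<phi> \<in> H" if "wff \<phi>" for \<phi>
      using Q'[OF that] that unfolding H_def by auto
    show "\<exists>t. has_ty t \<rho> \<and> substf \<rho> 0 t \<phi> \<in> H" if "Ex \<rho> \<phi> \<in> H" for \<rho> \<phi>
    proof -
      obtain n where w: "wff (Ex \<rho> \<phi>)" and n: "{G n} \<turnstile> Ex \<rho> \<phi>" using \<open>Ex \<rho> \<phi> \<in> H\<close> by (auto simp: H_def)
      let ?k = "Suc (to_nat (Ex \<rho> \<phi>))"
      \<comment> \<open>The formula is derivable at stage \<open>n\<close>. Had step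
        \<open>?k\<close> chosen the negation, the later of the two stages would derive both and be
        inconsistent.\<close>
      have "\<not> {G ?k} \<turnstile> Neg (Ex \<rho> \<phi>)"
      proof
        assume "{G ?k} \<turnstile> Neg (Ex \<rho> \<phi>)"
        then have "{G (max n ?k)} \<turnstile> Neg (Ex \<rho> \<phi>)" "{G (max n ?k)} \<turnstile> Ex \<rho> \<phi>" using mono n by auto
        from ImpE[OF this] G(2) show False by blast
      qed
      then have "{G ?k} \<turnstile> Ex \<rho> \<phi>" using Q'[OF w] by blast
      then obtain t where "has_ty t \<rho>" "{G ?k} \<turnstile> substf \<rho> 0 t \<phi>" using Q'[OF w] by blast
      then show ?thesis using w wff_substf[of t \<rho> \<phi>] unfolding H_def wff.simps by blast
    qed
    show "\<phi> \<in> H" if "\<Gamma> \<turnstile> \<phi>" "\<Gamma> \<subseteq> H" "finite \<Gamma>" "wff \<phi>" for \<Gamma> \<phi>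
      using that by (rule ded)
  qed (simp add: H_def)
  moreover have "{G 0} \<turnstile> \<gamma>" unfolding G(3) by (rule Assm) (simp_all add: wf)
  then have "\<gamma> \<in> H" unfolding H_def using wf by blast
  ultimately show ?thesis by blast
qed

section \<open>Applicative structures\<close>

text \<open>All finite types live in one carrier and are carved out by \<open>D\<close>. By
  \<open>fun_eqI\<close>, the pointwise defined equality of higher type is identity of elements, see
  \<open>sat_eqf\<close>.\<close>

locale struct =
  fixes D :: "ty \<Rightarrow> 'a set" and ap :: "'a \<Rightarrow> 'a \<Rightarrow> 'a" (infixl "\<bullet>" 100)
    and cs :: "cst \<Rightarrow> 'a" and lt :: "'a \<Rightarrow> 'a \<Rightarrow> bool" (infix "\<prec>" 50)
  assumes ap_D: "\<lbrakk>f \<in> D (\<rho> \<leadsto> \<tau>); x \<in> D \<rho>\<rbrakk> \<Longrightarrow> f \<bullet> x \<in> D \<tau>"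
    and cs_D: "cs c \<in> D (cst_ty c)"
    and fun_eqI: "\<lbrakk>f \<in> D (\<rho> \<leadsto> \<tau>); g \<in> D (\<rho> \<leadsto> \<tau>); \<And>x. x \<in> D \<rho> \<Longrightarrow> f \<bullet> x = g \<bullet> x\<rbrakk> \<Longrightarrow> f = g"
begin

fun val :: "(ty \<Rightarrow> nat \<Rightarrow> 'a) \<Rightarrow> trm \<Rightarrow> 'a" where
  "val e (Var \<rho> i) = e \<rho> i"
| "val e (Cst c) = cs c"
| "val e (s \<cdot> t) = val e s \<bullet> val e t"

fun sat :: "(ty \<Rightarrow> nat \<Rightarrow> 'a) \<Rightarrow> fm \<Rightarrow> bool" where
  "sat e Fls \<longleftrightarrow> False"
| "sat e (Eq s t) \<longleftrightarrow> val e s = val e t"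
| "sat e (Less s t) \<longleftrightarrow> val e s \<prec> val e t"
| "sat e (And \<phi> \<psi>) \<longleftrightarrow> sat e \<phi> \<and> sat e \<psi>"
| "sat e (Or \<phi> \<psi>) \<longleftrightarrow> sat e \<phi> \<or> sat e \<psi>"
| "sat e (Imp \<phi> \<psi>) \<longleftrightarrow> (sat e \<phi> \<longrightarrow> sat e \<psi>)"
| "sat e (All \<rho> \<phi>) \<longleftrightarrow> (\<forall>x\<in>D \<rho>. sat (ins \<rho> 0 x e) \<phi>)"
| "sat e (Ex \<rho> \<phi>) \<longleftrightarrow> (\<exists>x\<in>D \<rho>. sat (ins \<rho> 0 x e) \<phi>)"

definition env :: "(ty \<Rightarrow> nat \<Rightarrow> 'a) \<Rightarrow> bool" where
  "env e \<longleftrightarrow> (\<forall>\<rho> i. e \<rho> i \<in> D \<rho>)"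

end

locale rca_model = struct +
  assumes sat_ax: "RCA_ax \<phi> \<Longrightarrow> env e \<Longrightarrow> sat e \<phi>"

section \<open>Completeness\<close>

lemma wff_liftf: "wff \<phi> \<Longrightarrow> wff (liftf \<rho> k \<phi>)"
  unfolding liftf_psubstf by (rule wff_psubstf[OF typed_shift])

lemma wff_RCA_ax: "RCA_ax \<phi> \<Longrightarrow> wff \<phi>"
proof (induction rule: RCA_ax.induct)
  case (semiring_ax \<phi>)
  then show ?case by (induction rule: semiring_ax.induct) simp_all
qed (auto intro!: wff_eqf wff_substf wff_liftf)

lemma substf_liftf_Suc: "substf \<rho> 0 (Var \<rho> 0) (liftf \<rho> (Suc 0) \<phi>) = \<phi>"
proof -
  have "(\<lambda>\<sigma> i. psubst (ins \<rho> 0 (Var \<rho> 0) Var) (shift \<rho> (Suc 0) \<sigma> i)) = Var"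
    by (intro ext) (simp add: shift_def ins_def)
  then show ?thesis unfolding substf_psubstf liftf_psubstf psubstf_psubstf by simp
qed

lemma ty_neq_Fn: "\<rho> \<noteq> \<rho> \<leadsto> \<tau>" "\<rho> \<leadsto> \<tau> \<noteq> \<rho>"
proof -
  have "size \<rho> < size (\<rho> \<leadsto> \<tau>)" by simp
  then show "\<rho> \<noteq> \<rho> \<leadsto> \<tau>" by fastforce
  then show "\<rho> \<leadsto> \<tau> \<noteq> \<rho>" by simp
qed

text \<open>The Henkin property supplies witnesses for existential formulas; this turns the failure
  of a universal formula into a counterexample term.\<close>

lemma not_All:
  assumes "wff \<phi>"
  shows "{Neg (All \<rho> \<phi>)} \<turnstile> Ex \<rho> (Neg \<phi>)"
proof (rule Contr)
  let ?\<Gamma> = "insert (Neg (Ex \<rho> (Neg \<phi>))) {Neg (All \<rho> \<phi>)}"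
  let ?\<Delta> = "insert (Neg \<phi>) (liftf \<rho> 0 ` ?\<Gamma>)"
  have "?\<Delta> \<turnstile> liftf \<rho> 0 (Neg (Ex \<rho> (Neg \<phi>)))"
    by (rule Assm) (use assms in \<open>simp_all add: wff_liftf\<close>)
  then have 1: "?\<Delta> \<turnstile> Neg (Ex \<rho> (Neg (liftf \<rho> (Suc 0) \<phi>)))" by simp
  have "?\<Delta> \<turnstile> substf \<rho> 0 (Var \<rho> 0) (Neg (liftf \<rho> (Suc 0) \<phi>))"
    by (rule Assm) (use assms in \<open>simp_all add: substf_liftf_Suc\<close>)
  then have 2: "?\<Delta> \<turnstile> Ex \<rho> (Neg (liftf \<rho> (Suc 0) \<phi>))"
    by (rule ExI) (use assms in \<open>simp_all add: wff_liftf\<close>)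
  have "liftf \<rho> 0 ` ?\<Gamma> \<turnstile> \<phi>" by (rule Contr[OF ImpE[OF 1 2] assms])
  then have 3: "?\<Gamma> \<turnstile> All \<rho> \<phi>" by (rule AllI)
  have "?\<Gamma> \<turnstile> Neg (All \<rho> \<phi>)" by (rule Assm) (use assms in simp_all)
  from ImpE[OF this 3] show "?\<Gamma> \<turnstile> Fls" .
qed (use assms in simp)

section \<open>Membership in a Henkin set and the connectives\<close>

context henkin
begin

lemma thm_H: "{} \<turnstile> \<phi> \<Longrightarrow> wff \<phi> \<Longrightarrow> \<phi> \<in> H"
  by (rule ded[of "{}"]) simp_all

lemma ded1: "\<phi> \<in> H \<Longrightarrow> {\<phi>} \<turnstile> \<psi> \<Longrightarrow> wff \<psi> \<Longrightarrow> \<psi> \<in> H"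
  by (rule ded[of "{\<phi>}"]) simp_all

lemma ded2: "\<phi> \<in> H \<Longrightarrow> \<psi> \<in> H \<Longrightarrow> {\<phi>, \<psi>} \<turnstile> \<chi> \<Longrightarrow> wff \<chi> \<Longrightarrow> \<chi> \<in> H"
  by (rule ded[of "{\<phi>, \<psi>}"]) simp_all

lemma H_assm: "\<phi> \<in> H \<Longrightarrow> \<phi> \<in> \<Gamma> \<Longrightarrow> \<Gamma> \<turnstile> \<phi>"
  by (rule Assm[OF _ wff_H])

lemma H_mp:
  assumes "Imp \<phi> \<psi> \<in> H" "\<phi> \<in> H"
  shows "\<psi> \<in> H"
proof (rule ded2[OF assms])
  show "{Imp \<phi> \<psi>, \<phi>} \<turnstile> \<psi>"
    by (rule ImpE[OF H_assm[OF assms(1)] H_assm[OF assms(2)]]) simp_all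
qed (use wff_H[OF assms(1)] in simp)

lemma Neg_iff: "wff \<phi> \<Longrightarrow> Neg \<phi> \<in> H \<longleftrightarrow> \<phi> \<notin> H"
  using complete[of \<phi>] H_mp[of \<phi> Fls] Fls_H by blast

lemma And_iff: "And \<phi> \<psi> \<in> H \<longleftrightarrow> \<phi> \<in> H \<and> \<psi> \<in> H"
proof (intro iffI conjI)
  assume *: "And \<phi> \<psi> \<in> H"
  from wff_H[OF *] have w: "wff \<phi>" "wff \<psi>" by simp_all
  from * show "\<phi> \<in> H" by (rule ded1[OF _ AndD(1)[OF w] w(1)])
  from * show "\<psi> \<in> H" by (rule ded1[OF _ AndD(2)[OF w] w(2)])
next
  assume *: "\<phi> \<in> H \<and> \<psi> \<in> H"
  then have "{\<phi>, \<psi>} \<turnstile> And \<phi> \<psi>" by (intro AndI H_assm) simp_all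
  from ded2[OF _ _ this] * wff_H[of \<phi>] wff_H[of \<psi>] show "And \<phi> \<psi> \<in> H" by simp
qed

lemma Imp_iff:
  assumes "wff \<phi>" "wff \<psi>"
  shows "Imp \<phi> \<psi> \<in> H \<longleftrightarrow> (\<phi> \<in> H \<longrightarrow> \<psi> \<in> H)"
proof
  assume "\<phi> \<in> H \<longrightarrow> \<psi> \<in> H"
  then consider "\<psi> \<in> H" | "Neg \<phi> \<in> H" using complete[OF assms(1)] by blast
  then show "Imp \<phi> \<psi> \<in> H"
  proof cases
    case 1
    have "{\<psi>} \<turnstile> Imp \<phi> \<psi>" by (rule ImpI[OF H_assm[OF 1] assms(1)]) simp
    with 1 show ?thesis by (rule ded1) (simp add: assms)
  next
    case 2
    have "insert (Neg \<psi>) {\<phi>, Neg \<phi>} \<turnstile> Fls"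
      by (rule ImpE[of _ \<phi>]; rule Assm) (simp_all add: assms)
    then have "{\<phi>, Neg \<phi>} \<turnstile> \<psi>" by (rule Contr[OF _ assms(2)])
    then have "{Neg \<phi>} \<turnstile> Imp \<phi> \<psi>" by (rule ImpI[OF _ assms(1)])
    with 2 show ?thesis by (rule ded1) (simp add: assms)
  qed
qed (use H_mp in blast)

lemma Or_iff:
  assumes "wff \<phi>" "wff \<psi>"
  shows "Or \<phi> \<psi> \<in> H \<longleftrightarrow> \<phi> \<in> H \<or> \<psi> \<in> H"
proof
  assume *: "Or \<phi> \<psi> \<in> H"
  show "\<phi> \<in> H \<or> \<psi> \<in> H"
  proof (rule ccontr)
    assume "\<not> (\<phi> \<in> H \<or> \<psi> \<in> H)"
    then have n: "Neg \<phi> \<in> H" "Neg \<psi> \<in> H" using Neg_iff assms by auto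
    let ?\<Gamma> = "{Or \<phi> \<psi>, Neg \<phi>, Neg \<psi>}"
    have "?\<Gamma> \<turnstile> Fls"
    proof (rule OrE)
      show "?\<Gamma> \<turnstile> Or \<phi> \<psi>" by (rule H_assm[OF *]) simp
      show "insert \<phi> ?\<Gamma> \<turnstile> Fls" by (rule ImpE[of _ \<phi>]; rule Assm) (simp_all add: assms)
      show "insert \<psi> ?\<Gamma> \<turnstile> Fls" by (rule ImpE[of _ \<psi>]; rule Assm) (simp_all add: assms)
    qed
    then have "Fls \<in> H" by (rule ded) (use * n in simp_all)
    with Fls_H show False ..
  qed
next
  assume "\<phi> \<in> H \<or> \<psi> \<in> H"
  then show "Or \<phi> \<psi> \<in> H"
  proof
    assume *: "\<phi> \<in> H"
    have "{\<phi>} \<turnstile> Or \<phi> \<psi>" by (rule OrI1[OF H_assm[OF *] assms(2)]) simp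
    with * show ?thesis by (rule ded1) (simp add: assms)
  next
    assume *: "\<psi> \<in> H"
    have "{\<psi>} \<turnstile> Or \<phi> \<psi>" by (rule OrI2[OF H_assm[OF *] assms(1)]) simp
    with * show ?thesis by (rule ded1) (simp add: assms)
  qed
qed

lemma Ex_iff:
  assumes "wff \<phi>"
  shows "Ex \<rho> \<phi> \<in> H \<longleftrightarrow> (\<exists>t. has_ty t \<rho> \<and> substf \<rho> 0 t \<phi> \<in> H)"
proof
  assume "\<exists>t. has_ty t \<rho> \<and> substf \<rho> 0 t \<phi> \<in> H"
  then obtain t where t: "has_ty t \<rho>" "substf \<rho> 0 t \<phi> \<in> H" by blast
  have "{substf \<rho> 0 t \<phi>} \<turnstile> Ex \<rho> \<phi>" by (rule ExI[OF H_assm[OF t(2)] t(1) assms]) simp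
  with t(2) show "Ex \<rho> \<phi> \<in> H" by (rule ded1) (simp add: assms)
qed (rule witness)

lemma All_iff:
  assumes "wff \<phi>"
  shows "All \<rho> \<phi> \<in> H \<longleftrightarrow> (\<forall>t. has_ty t \<rho> \<longrightarrow> substf \<rho> 0 t \<phi> \<in> H)"
proof (intro iffI allI impI)
  fix t assume *: "All \<rho> \<phi> \<in> H" "has_ty t \<rho>"
  have "{All \<rho> \<phi>} \<turnstile> substf \<rho> 0 t \<phi>" by (rule AllE[OF H_assm[OF *(1)] *(2)]) simp
  with *(1) show "substf \<rho> 0 t \<phi> \<in> H" by (rule ded1) (simp add: wff_substf * assms)
next
  assume *: "\<forall>t. has_ty t \<rho> \<longrightarrow> substf \<rho> 0 t \<phi> \<in> H"
  show "All \<rho> \<phi> \<in> H"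
  proof (rule ccontr)
    assume "All \<rho> \<phi> \<notin> H"
    then have "Neg (All \<rho> \<phi>) \<in> H" using Neg_iff assms by simp
    then have "Ex \<rho> (Neg \<phi>) \<in> H" by (rule ded1[OF _ not_All]) (simp_all add: assms)
    then obtain t where "has_ty t \<rho>" "Neg (substf \<rho> 0 t \<phi>) \<in> H" using witness by fastforce
    with * H_mp[of "substf \<rho> 0 t \<phi>" Fls] show False using Fls_H by blast
  qed
qed

section \<open>Provable equality as a congruence\<close>

lemma eqf_Fn:
  assumes "has_ty s (\<rho> \<leadsto> \<tau>)" "has_ty t (\<rho> \<leadsto> \<tau>)"
  shows "eqf (\<rho> \<leadsto> \<tau>) s t \<in> H \<longleftrightarrow> (\<forall>u. has_ty u \<rho> \<longrightarrow> eqf \<tau> (s \<cdot> u) (t \<cdot> u) \<in> H)"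
proof -
  have "has_ty (lift \<rho> 0 s) (\<rho> \<leadsto> \<tau>)" "has_ty (lift \<rho> 0 t) (\<rho> \<leadsto> \<tau>)"
    using assms by (simp_all add: has_ty_lift)
  then have w: "wff (eqf \<tau> (lift \<rho> 0 s \<cdot> Var \<rho> 0) (lift \<rho> 0 t \<cdot> Var \<rho> 0))"
    by (intro wff_eqf) simp_all
  show ?thesis unfolding eqf.simps All_iff[OF w] by (simp add: substf_eqf)
qed

lemma Eq_subst:
  assumes "Eq s t \<in> H" "substf N 0 s \<phi> \<in> H" "wff \<phi>"
  shows "substf N 0 t \<phi> \<in> H"
proof (rule ded2[OF assms(1,2)])
  show "{Eq s t, substf N 0 s \<phi>} \<turnstile> substf N 0 t \<phi>"
    by (rule EqSubst[of _ s]; (rule H_assm)?) (use assms in simp_all)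
  show "wff (substf N 0 t \<phi>)" using wff_H[OF assms(1)] assms(3) by (intro wff_substf) simp_all
qed

lemma Eq_sym: "Eq s t \<in> H \<Longrightarrow> Eq t s \<in> H"
proof -
  assume *: "Eq s t \<in> H"
  then have ty: "has_ty s N" "has_ty t N" using wff_H[OF *] by simp_all
  have "Eq s s \<in> H" using ty by (intro thm_H EqRefl) simp_all
  with Eq_subst[OF *, of "Eq (Var N 0) (lift N 0 s)"] show "Eq t s \<in> H"
    using has_ty_lift[OF ty(1)] by simp
qed

lemma Eq_trans: "Eq s t \<in> H \<Longrightarrow> Eq t u \<in> H \<Longrightarrow> Eq s u \<in> H"
proof -
  assume *: "Eq s t \<in> H" "Eq t u \<in> H"
  have "has_ty s N" using wff_H[OF *(1)] by simp
  from has_ty_lift[OF this] Eq_subst[OF *(2), of "Eq (lift N 0 s) (Var N 0)"] *(1)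
  show "Eq s u \<in> H" by simp
qed

lemma Less_cong:
  assumes "Eq s s' \<in> H" "Eq t t' \<in> H" "Less s t \<in> H"
  shows "Less s' t' \<in> H"
proof -
  have "has_ty s' N" "has_ty t N" using wff_H[OF assms(1)] wff_H[OF assms(3)] by simp_all
  then have "has_ty (lift N 0 s') N" "has_ty (lift N 0 t) N" by (simp_all add: has_ty_lift)
  then show ?thesis
    using Eq_subst[OF assms(1), of "Less (Var N 0) (lift N 0 t)"]
      Eq_subst[OF assms(2), of "Less (lift N 0 s') (Var N 0)"] assms(3) by simp
qed

definition eqv :: "trm \<Rightarrow> trm \<Rightarrow> bool" where
  "eqv s t \<longleftrightarrow> wt s \<and> wt t \<and> ty_of s = ty_of t \<and> eqf (ty_of s) s t \<in> H"

lemma eqf_refl: "has_ty t \<rho> \<Longrightarrow> eqf \<rho> t t \<in> H"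
proof (induction \<rho> arbitrary: t)
  case N
  then show ?case by (auto intro: thm_H EqRefl)
next
  case (Fn \<rho> \<tau>)
  show ?case unfolding eqf_Fn[OF Fn.prems Fn.prems]
    by (intro allI impI Fn.IH) (use Fn.prems in simp)
qed

lemma eqf_sym: "has_ty s \<rho> \<Longrightarrow> has_ty t \<rho> \<Longrightarrow> eqf \<rho> s t \<in> H \<Longrightarrow> eqf \<rho> t s \<in> H"
proof (induction \<rho> arbitrary: s t)
  case N
  from N.prems(3) show ?case unfolding eqf.simps by (rule Eq_sym)
next
  case (Fn \<rho> \<tau>)
  have "eqf \<tau> (t \<cdot> u) (s \<cdot> u) \<in> H" if u: "has_ty u \<rho>" for u
  proof (rule Fn.IH(2))
    show "has_ty (s \<cdot> u) \<tau>" "has_ty (t \<cdot> u) \<tau>" using u Fn.prems(1,2) by simp_all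
    show "eqf \<tau> (s \<cdot> u) (t \<cdot> u) \<in> H" using u Fn.prems(3) unfolding eqf_Fn[OF Fn.prems(1,2)] by blast
  qed
  then show ?case unfolding eqf_Fn[OF Fn.prems(2,1)] by blast
qed

lemma eqf_trans:
  "has_ty s \<rho> \<Longrightarrow> has_ty t \<rho> \<Longrightarrow> has_ty u \<rho> \<Longrightarrow> eqf \<rho> s t \<in> H \<Longrightarrow> eqf \<rho> t u \<in> H \<Longrightarrow> eqf \<rho> s u \<in> H"
proof (induction \<rho> arbitrary: s t u)
  case N
  from N.prems(4,5) show ?case unfolding eqf.simps by (rule Eq_trans)
next
  case (Fn \<rho> \<tau>)
  have "eqf \<tau> (s \<cdot> v) (u \<cdot> v) \<in> H" if v: "has_ty v \<rho>" for v
  proof (rule Fn.IH(2))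
    show "has_ty (s \<cdot> v) \<tau>" "has_ty (t \<cdot> v) \<tau>" "has_ty (u \<cdot> v) \<tau>" using v Fn.prems(1-3) by simp_all
    show "eqf \<tau> (s \<cdot> v) (t \<cdot> v) \<in> H" using v Fn.prems(4) unfolding eqf_Fn[OF Fn.prems(1,2)] by blast
    show "eqf \<tau> (t \<cdot> v) (u \<cdot> v) \<in> H" using v Fn.prems(5) unfolding eqf_Fn[OF Fn.prems(2,3)] by blast
  qed
  then show ?case unfolding eqf_Fn[OF Fn.prems(1,3)] by blast
qed

lemma eqv_ty: "eqv s t \<longleftrightarrow> (\<exists>\<rho>. has_ty s \<rho> \<and> has_ty t \<rho> \<and> eqf \<rho> s t \<in> H)"
  unfolding eqv_def by auto

lemma eqv_refl: "wt t \<Longrightarrow> eqv t t"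
  by (simp add: eqv_def eqf_refl)

lemma eqv_sym: "eqv s t \<Longrightarrow> eqv t s"
  unfolding eqv_ty using eqf_sym by blast

lemma eqv_trans:
  assumes "eqv s t" "eqv t u"
  shows "eqv s u"
proof -
  obtain \<rho> where s: "has_ty s \<rho>" "has_ty t \<rho>" "eqf \<rho> s t \<in> H" using assms(1) unfolding eqv_ty by blast
  with assms(2) have t: "has_ty u \<rho>" "eqf \<rho> t u \<in> H" unfolding eqv_ty by auto
  from eqf_trans[OF s(1,2) t(1) s(3) t(2)] s(1) t(1) show ?thesis unfolding eqv_ty by blast
qed

text \<open>An instance of the extensionality axiom for the given terms, available because theorems
  are closed under substitution. It is what lets application pass to the quotient.\<close>

lemma eqv_app_arg:
  assumes f: "has_ty f (\<rho> \<leadsto> \<tau>)" and st: "eqv s t" "ty_of s = \<rho>"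
  shows "eqv (f \<cdot> s) (f \<cdot> t)"
proof -
  have ty: "has_ty s \<rho>" "has_ty t \<rho>" using st by (auto simp: eqv_def)
  let ?s = "ins \<rho> 0 s (ins \<rho> 0 t (ins (\<rho> \<leadsto> \<tau>) 0 f Var))"
  have *: "typed ?s" by (intro typed_ins typed_Var ty f)
  have "?s \<rho> 0 = s" "?s \<rho> (Suc 0) = t" "?s (\<rho> \<leadsto> \<tau>) 0 = f"
    by (simp_all add: ins_def ty_neq_Fn)
  with thm_psubstf[OF Ax[OF extensionality[of \<rho> \<tau>]] *]
  have "{} \<turnstile> Imp (eqf \<rho> s t) (eqf \<tau> (f \<cdot> s) (f \<cdot> t))"
    by (simp add: psubstf_eqf)
  then have "Imp (eqf \<rho> s t) (eqf \<tau> (f \<cdot> s) (f \<cdot> t)) \<in> H"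
    by (rule thm_H) (use ty f in \<open>simp add: wff_eqf\<close>)
  from H_mp[OF this] show ?thesis using st f ty by (simp add: eqv_def)
qed

lemma eqv_app:
  assumes fg: "eqv f g" and f: "ty_of f = \<rho> \<leadsto> \<tau>" and st: "eqv s t" "ty_of s = \<rho>"
  shows "eqv (f \<cdot> s) (g \<cdot> t)"
proof (rule eqv_trans)
  show "eqv (f \<cdot> s) (f \<cdot> t)" by (rule eqv_app_arg[of f \<rho> \<tau>, OF _ st]) (use fg f in \<open>simp add: eqv_def\<close>)
  have ty: "has_ty f (\<rho> \<leadsto> \<tau>)" "has_ty g (\<rho> \<leadsto> \<tau>)" "has_ty t \<rho>" and "eqf (\<rho> \<leadsto> \<tau>) f g \<in> H"
    using fg st f unfolding eqv_def by (metis+)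
  then have "eqf \<tau> (f \<cdot> t) (g \<cdot> t) \<in> H" using eqf_Fn[OF ty(1,2)] by blast
  then show "eqv (f \<cdot> t) (g \<cdot> t)" using ty by (simp add: eqv_def)
qed

text \<open>The elements of the term model are representatives of the classes of \<open>eqv\<close>.\<close>

definition rep :: "trm \<Rightarrow> trm" where
  "rep t = (SOME u. eqv t u)"

lemma eqv_rep: "wt t \<Longrightarrow> eqv t (rep t)"
  unfolding rep_def by (rule someI[where P = "eqv t"]) (rule eqv_refl)

lemma rep_eqI:
  assumes "eqv s t"
  shows "rep s = rep t"
proof -
  have "eqv s u \<longleftrightarrow> eqv t u" for u
    using eqv_trans[OF assms, of u] eqv_trans[OF eqv_sym[OF assms], of u] by blast
  then have "eqv s = eqv t" by (rule ext)
  then show ?thesis unfolding rep_def by (rule arg_cong)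
qed

lemma rep_eq_iff: "wt s \<Longrightarrow> wt t \<Longrightarrow> rep s = rep t \<longleftrightarrow> eqv s t"
  using eqv_trans[OF eqv_rep[of s]] eqv_sym[OF eqv_rep[of t]] rep_eqI[of s t] by auto

lemma has_ty_rep: "has_ty t \<rho> \<Longrightarrow> has_ty (rep t) \<rho>"
  using eqv_rep[of t] by (simp add: eqv_def)

lemma rep_rep: "wt t \<Longrightarrow> rep (rep t) = rep t"
  by (rule rep_eqI[OF eqv_sym[OF eqv_rep]])

definition Dm :: "ty \<Rightarrow> trm set" where
  "Dm \<rho> = rep ` {t. has_ty t \<rho>}"

lemma rep_Dm: "has_ty t \<rho> \<Longrightarrow> rep t \<in> Dm \<rho>"
  unfolding Dm_def by blast

lemma Dm_rep: "x \<in> Dm \<rho> \<Longrightarrow> has_ty x \<rho> \<and> rep x = x"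
  unfolding Dm_def using has_ty_rep rep_rep by blast

lemma rep_app:
  assumes "has_ty s (\<rho> \<leadsto> \<tau>)" "has_ty t \<rho>"
  shows "rep (rep s \<cdot> rep t) = rep (s \<cdot> t)"
proof (rule rep_eqI[OF eqv_sym[OF eqv_app]])
  show "eqv s (rep s)" "eqv t (rep t)" using assms by (simp_all add: eqv_rep)
  show "ty_of s = \<rho> \<leadsto> \<tau>" "ty_of t = \<rho>" using assms by simp_all
qed

text \<open>\<open>fun_eqI\<close> holds because equality of higher type is pointwise by definition:
  agreement on representatives extends to all terms by \<open>rep_app\<close>, and this puts the
  equation into \<open>H\<close> by \<open>eqf_Fn\<close>.\<close>

lemma struct_H: "struct Dm (\<lambda>x y. rep (x \<cdot> y)) (\<lambda>c. rep (Cst c))"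
proof
  show "rep (Cst c) \<in> Dm (cst_ty c)" for c by (rule rep_Dm) simp
  show "rep (f \<cdot> x) \<in> Dm \<tau>" if "f \<in> Dm (\<rho> \<leadsto> \<tau>)" "x \<in> Dm \<rho>" for f x \<rho> \<tau>
    using that[THEN Dm_rep] by (intro rep_Dm) simp
  show "f = g" if fg: "f \<in> Dm (\<rho> \<leadsto> \<tau>)" "g \<in> Dm (\<rho> \<leadsto> \<tau>)"
      and eq: "\<And>x. x \<in> Dm \<rho> \<Longrightarrow> rep (f \<cdot> x) = rep (g \<cdot> x)"
    for f g \<rho> \<tau>
  proof -
    have f: "has_ty f (\<rho> \<leadsto> \<tau>)" "rep f = f" "has_ty g (\<rho> \<leadsto> \<tau>)" "rep g = g"
      using fg[THEN Dm_rep] by simp_all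
    have "eqf \<tau> (f \<cdot> u) (g \<cdot> u) \<in> H" if u: "has_ty u \<rho>" for u
    proof -
      have wt: "wt (f \<cdot> u)" "wt (g \<cdot> u)" using f(1,3) u by simp_all
      have "rep (f \<cdot> u) = rep (f \<cdot> rep u)" using rep_app[OF f(1) u] unfolding f(2) by (rule sym)
      also have "\<dots> = rep (g \<cdot> rep u)" by (rule eq[OF rep_Dm[OF u]])
      also have "\<dots> = rep (g \<cdot> u)" using rep_app[OF f(3) u] unfolding f(4) .
      finally have "eqv (f \<cdot> u) (g \<cdot> u)" unfolding rep_eq_iff[OF wt] .
      then show ?thesis using f by (simp add: eqv_def)
    qed
    then have "eqf (\<rho> \<leadsto> \<tau>) f g \<in> H" using eqf_Fn[OF f(1,3)] by blast
    then have "eqv f g" using f by (simp add: eqv_def)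
    from rep_eqI[OF this] show ?thesis unfolding f(2,4) .
  qed
qed

section \<open>The truth lemma and the term model\<close>

interpretation M: struct Dm "\<lambda>x y. rep (x \<cdot> y)" "\<lambda>c. rep (Cst c)" "\<lambda>x y. Less x y \<in> H"
  by (rule struct_H)

lemma val_rep:
  assumes "typed s"
  shows "wt t \<Longrightarrow> M.val (\<lambda>\<rho> i. rep (s \<rho> i)) t = rep (psubst s t)"
proof (induction t)
  case (App t u)
  then have *: "has_ty t (ty_of u \<leadsto> ty_of (t \<cdot> u))" "has_ty u (ty_of u)" by simp_all
  then have "M.val (\<lambda>\<rho> i. rep (s \<rho> i)) t = rep (psubst s t)"
    "M.val (\<lambda>\<rho> i. rep (s \<rho> i)) u = rep (psubst s u)" using App.IH by blast+
  with rep_app[OF has_ty_psubst[OF assms *(1)] has_ty_psubst[OF assms *(2)]] show ?case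
    by (simp only: M.val.simps psubst.simps)
qed simp_all

lemma Dm_Q:
  "(\<forall>x\<in>Dm \<rho>. P x) \<longleftrightarrow> (\<forall>t. has_ty t \<rho> \<longrightarrow> P (rep t))"
  "(\<exists>x\<in>Dm \<rho>. P x) \<longleftrightarrow> (\<exists>t. has_ty t \<rho> \<and> P (rep t))"
  unfolding Dm_def by blast+

lemma ins_rep: "ins \<rho> 0 (rep t) (\<lambda>\<rho> i. rep (s \<rho> i)) = (\<lambda>\<sigma> i. rep (ins \<rho> 0 t s \<sigma> i))"
  by (intro ext) (simp add: ins_def)

lemma Less_rep:
  assumes "has_ty s N" "has_ty t N"
  shows "Less (rep s) (rep t) \<in> H \<longleftrightarrow> Less s t \<in> H"
proof -
  have s: "Eq s (rep s) \<in> H" and t: "Eq t (rep t) \<in> H"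
    using assms eqv_rep[of s] eqv_rep[of t] by (simp_all add: eqv_def)
  show ?thesis using Less_cong[OF s t] Less_cong[OF Eq_sym[OF s] Eq_sym[OF t]] by blast
qed

lemma Eq_rep: "has_ty s N \<Longrightarrow> has_ty t N \<Longrightarrow> rep s = rep t \<longleftrightarrow> Eq s t \<in> H"
  by (simp add: rep_eq_iff) (simp add: eqv_def)

text \<open>Stated for every typed substitution, so that entering a quantifier extends environment
  and substitution alike by \<open>ins\<close>, and the induction hypothesis applies to the extended
  ones.\<close>

lemma truth:
  "wff \<phi> \<Longrightarrow> typed s \<Longrightarrow> M.sat (\<lambda>\<rho> i. rep (s \<rho> i)) \<phi> \<longleftrightarrow> psubstf s \<phi> \<in> H"
proof (induction \<phi> arbitrary: s)
  case Fls
  then show ?case using Fls_H by simp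
next
  case (Eq t u)
  then have *: "has_ty t N" "has_ty u N" by simp_all
  from Eq_rep[OF this[THEN has_ty_psubst[OF Eq.prems(2)]]] * show ?case
    by (simp add: val_rep[OF Eq.prems(2)])
next
  case (Less t u)
  then have *: "has_ty t N" "has_ty u N" by simp_all
  from Less_rep[OF this[THEN has_ty_psubst[OF Less.prems(2)]]] * show ?case
    by (simp add: val_rep[OF Less.prems(2)])
next
  case (And \<phi> \<psi>)
  then have "wff \<phi>" "wff \<psi>" by simp_all
  with And.IH And.prems(2) show ?case by (simp add: And_iff)
next
  case (Or \<phi> \<psi>)
  then have w: "wff \<phi>" "wff \<psi>" by simp_all
  with Or.IH Or.prems(2) Or_iff[OF w[THEN wff_psubstf[OF Or.prems(2)]]] show ?case by simp
next
  case (Imp \<phi> \<psi>)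
  then have w: "wff \<phi>" "wff \<psi>" by simp_all
  with Imp.IH Imp.prems(2) Imp_iff[OF w[THEN wff_psubstf[OF Imp.prems(2)]]] show ?case by simp
next
  case (All \<rho> \<phi>)
  then have w: "wff \<phi>" by simp
  have *: "M.sat (ins \<rho> 0 (rep t) (\<lambda>\<rho> i. rep (s \<rho> i))) \<phi> \<longleftrightarrow> substf \<rho> 0 t (psubstf (up \<rho> s) \<phi>) \<in> H"
    if "has_ty t \<rho>" for t
    unfolding ins_rep substf_up by (rule All.IH[OF w typed_ins[OF All.prems(2) that]])
  show ?case
    unfolding M.sat.simps psubstf.simps All_iff[OF wff_psubstf[OF typed_up[OF All.prems(2)] w]] Dm_Q
    using * by blast
next
  case (Ex \<rho> \<phi>)
  then have w: "wff \<phi>" by simp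
  have *: "M.sat (ins \<rho> 0 (rep t) (\<lambda>\<rho> i. rep (s \<rho> i))) \<phi> \<longleftrightarrow> substf \<rho> 0 t (psubstf (up \<rho> s) \<phi>) \<in> H"
    if "has_ty t \<rho>" for t
    unfolding ins_rep substf_up by (rule Ex.IH[OF w typed_ins[OF Ex.prems(2) that]])
  show ?case
    unfolding M.sat.simps psubstf.simps Ex_iff[OF wff_psubstf[OF typed_up[OF Ex.prems(2)] w]] Dm_Q
    using * by blast
qed

text \<open>An environment of the term model is a typed substitution whose terms are their own
  representatives. So the truth of an axiom is membership in \<open>H\<close> of a substitution
  instance of a theorem.\<close>

lemma rca_model_H: "rca_model Dm (\<lambda>x y. rep (x \<cdot> y)) (\<lambda>c. rep (Cst c)) (\<lambda>x y. Less x y \<in> H)"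
proof
  fix \<phi> e assume ax: "RCA_ax \<phi>" and "M.env e"
  then have e: "has_ty (e \<rho> i) \<rho>" "rep (e \<rho> i) = e \<rho> i" for \<rho> i
    using Dm_rep unfolding M.env_def by blast+
  then have "typed e" by (simp add: typed_def)
  moreover note wff_RCA_ax[OF ax]
  ultimately have "psubstf e \<phi> \<in> H" using ax by (intro thm_H thm_psubstf Ax wff_psubstf)
  with truth[OF wff_RCA_ax[OF ax] \<open>typed e\<close>] show "M.sat e \<phi>" unfolding e by simp
qed

end

text \<open>Validity over the carrier \<open>trm\<close> suffices, as the countermodel consists of
  terms. In it the free variables of \<open>\<phi>\<close> are interpreted by their own
  representatives.\<close>

theorem completeness:
  assumes sat: "\<And>D ap cs lt e. rca_model D ap cs lt \<Longrightarrow> struct.env D e \<Longrightarrow>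
      struct.sat D ap cs lt (e :: ty \<Rightarrow> nat \<Rightarrow> trm) \<phi>"
    and wf: "wff \<phi>"
  shows "{} \<turnstile> \<phi>"
proof (rule ccontr)
  assume "\<not> {} \<turnstile> \<phi>"
  then have "\<not> {Neg \<phi>} \<turnstile> Fls" using Contr[of \<phi> "{}"] wf by blast
  then obtain H where H: "henkin H" "Neg \<phi> \<in> H" using henkin_extension[of "Neg \<phi>"] wf by auto
  interpret henkin H by (rule H)
  interpret M: struct Dm "\<lambda>x y. rep (x \<cdot> y)" "\<lambda>c. rep (Cst c)" "\<lambda>x y. Less x y \<in> H"
    by (rule struct_H)
  have "M.sat (\<lambda>\<rho> i. rep (Var \<rho> i)) \<phi>"
    by (rule sat[OF rca_model_H]) (simp add: M.env_def rep_Dm)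
  then have "\<phi> \<in> H" using truth[OF wf typed_Var] by simp
  with H(2) show False using H_mp Fls_H by blast
qed

section \<open>Closed terms of arithmetic\<close>

lemma wt_App [simp]: "wt (s \<cdot> t) \<longleftrightarrow> wt s \<and> wt t \<and> (\<exists>\<tau>. ty_of s = ty_of t \<leadsto> \<tau>)"
  by (cases "ty_of s") auto

text \<open>As a rewrite rule, \<open>wt.simps(3)\<close> makes the simplifier loop: its right-hand side rewrites
  \<open>ty_of s\<close> to a term that contains \<open>ty_of s\<close>.\<close>

declare wt.simps(3) [simp del]

lemma ty_of_lam [simp]: "ty_of (lam \<rho> t) = \<rho> \<leadsto> ty_of t"
  by (induction t) auto

lemma wt_lam [simp]: "wt t \<Longrightarrow> wt (lam \<rho> t)"
  by (induction t) auto

text \<open>A bound, for each type, on the indices of free variables. Abstraction uses up one index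
  (\<open>below_lam\<close>), so closedness of nested abstractions reduces to a bound for the
  innermost body.\<close>

fun below :: "(ty \<Rightarrow> nat) \<Rightarrow> trm \<Rightarrow> bool" where
  "below d (Var \<rho> i) \<longleftrightarrow> i < d \<rho>"
| "below d (Cst c) \<longleftrightarrow> True"
| "below d (s \<cdot> t) \<longleftrightarrow> below d s \<and> below d t"

lemma below_lam: "below (d(\<rho> := Suc (d \<rho>))) t \<Longrightarrow> below d (lam \<rho> t)"
  by (induction t) (auto split: if_splits)

declare lam.simps [simp del]

lemma closed_below: "closed_trm t \<longleftrightarrow> below (\<lambda>_. 0) t"
  by (induction t) auto

lemma below_closed: "closed_trm t \<Longrightarrow> below d t"
  by (induction t) auto

lemma closed_lam: "below ((\<lambda>_. 0)(\<rho> := Suc 0)) t \<Longrightarrow> closed_trm (lam \<rho> t)"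
  unfolding closed_below by (rule below_lam) simp

lemma closed_lift [simp]: "closed_trm t \<Longrightarrow> lift \<rho> k t = t"
  by (induction t) auto

text \<open>The step function of a recursor takes the counter first and the earlier value second;
  under the two abstractions these are \<open>Var N 1\<close> and \<open>Var N 0\<close>.\<close>

definition pred_tm :: trm where
  "pred_tm = Cst (Rec N) \<cdot> lam N (lam N (Var N 1)) \<cdot> zero_tm"

definition sg_tm :: trm where
  "sg_tm = Cst (Rec N) \<cdot> lam N (lam N one_tm) \<cdot> zero_tm"

definition nsg_tm :: trm where
  "nsg_tm = Cst (Rec N) \<cdot> lam N (lam N zero_tm) \<cdot> one_tm"

definition pred_step_tm :: trm where
  "pred_step_tm = lam N (lam N (pred_tm \<cdot> Var N 0))"

definition sub_tm :: trm where
  "sub_tm = lam N (lam N (Cst (Rec N) \<cdot> pred_step_tm \<cdot> Var N 1 \<cdot> Var N 0))"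

text \<open>The value of \<open>eqt_tm\<close> is 0 for equal arguments and 1 otherwise.\<close>

definition eqt_tm :: trm where
  "eqt_tm = lam N (lam N (sg_tm \<cdot>
     plus_tm (sub_tm \<cdot> Var N 1 \<cdot> Var N 0) (sub_tm \<cdot> Var N 0 \<cdot> Var N 1)))"

text \<open>The pairing \<open>(n + k) * (n + k) + k\<close>. With \<open>s = n + k\<close>, the
  summand \<open>k\<close> is at most \<open>s\<close>, while the squares of \<open>s\<close> and
  \<open>s + 1\<close> differ by \<open>2 * s + 1\<close>; hence it is injective.\<close>

definition pair_tm :: trm where
  "pair_tm = lam N (lam N (plus_tm
     (times_tm (plus_tm (Var N 1) (Var N 0)) (plus_tm (Var N 1) (Var N 0))) (Var N 0)))"

lemma closed_tms [simp]:
  "closed_trm pred_tm" "closed_trm sg_tm" "closed_trm nsg_tm" "closed_trm pred_step_tm"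
  "closed_trm sub_tm" "closed_trm eqt_tm" "closed_trm pair_tm"
proof -
  show 1: "closed_trm pred_tm" unfolding pred_tm_def by (auto intro!: closed_lam below_lam)
  show 2: "closed_trm sg_tm" unfolding sg_tm_def by (auto intro!: closed_lam below_lam)
  show "closed_trm nsg_tm" unfolding nsg_tm_def by (auto intro!: closed_lam below_lam)
  show 3: "closed_trm pred_step_tm" unfolding pred_step_tm_def
    by (auto intro!: closed_lam below_lam below_closed[OF 1])
  show 4: "closed_trm sub_tm" unfolding sub_tm_def
    by (auto intro!: closed_lam below_lam below_closed[OF 3])
  show "closed_trm eqt_tm" unfolding eqt_tm_def
    by (auto intro!: closed_lam below_lam below_closed[OF 4] below_closed[OF 2])
  show "closed_trm pair_tm" unfolding pair_tm_def by (auto intro!: closed_lam below_lam)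
qed

lemma ty_tms [simp]:
  "ty_of pred_tm = N \<leadsto> N" "ty_of sg_tm = N \<leadsto> N" "ty_of nsg_tm = N \<leadsto> N"
  "ty_of pred_step_tm = N \<leadsto> N \<leadsto> N" "ty_of sub_tm = N \<leadsto> N \<leadsto> N"
  "ty_of eqt_tm = N \<leadsto> N \<leadsto> N" "ty_of pair_tm = N \<leadsto> N \<leadsto> N"
  by (simp_all add: pred_tm_def sg_tm_def nsg_tm_def pred_step_tm_def sub_tm_def eqt_tm_def pair_tm_def)

lemma wt_tms [simp]:
  "wt pred_tm" "wt sg_tm" "wt nsg_tm" "wt pred_step_tm" "wt sub_tm" "wt eqt_tm" "wt pair_tm"
proof -
  show 1: "wt pred_tm" "wt sg_tm" "wt nsg_tm"
    by (simp_all add: pred_tm_def sg_tm_def nsg_tm_def)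
  show 2: "wt pred_step_tm" using 1 by (simp add: pred_step_tm_def)
  show 3: "wt sub_tm" using 2 by (simp add: sub_tm_def)
  show "wt eqt_tm" using 1 3 by (simp add: eqt_tm_def)
  show "wt pair_tm" by (simp add: pair_tm_def)
qed

section \<open>Models of the axioms\<close>

lemma ins_ins_same: "ins \<rho> 0 y (ins \<rho> k x e) = ins \<rho> (Suc k) x (ins \<rho> 0 y e)"
  by (intro ext) (auto simp: ins_def)

lemma ins_ins_diff: "\<rho> \<noteq> \<sigma> \<Longrightarrow> ins \<sigma> j y (ins \<rho> k x e) = ins \<rho> k x (ins \<sigma> j y e)"
  by (intro ext) (auto simp: ins_def)

lemma ins_simps [simp]:
  "ins \<rho> 0 x e \<rho> 0 = x" "ins \<rho> 0 x e \<rho> (Suc i) = e \<rho> i" "\<sigma> \<noteq> \<rho> \<Longrightarrow> ins \<rho> 0 x e \<sigma> i = e \<sigma> i"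
  "ins \<rho> 0 x e \<rho> (numeral k) = e \<rho> (pred_numeral k)"
  by (simp_all add: ins_def numeral_eq_Suc)

context struct
begin

lemma env_ins [simp]: "env e \<Longrightarrow> x \<in> D \<rho> \<Longrightarrow> env (ins \<rho> k x e)"
  by (auto simp: env_def ins_def)

lemma val_D [simp]: "env e \<Longrightarrow> wt t \<Longrightarrow> ty_of t = \<rho> \<Longrightarrow> val e t \<in> D \<rho>"
proof (induction t arbitrary: \<rho>)
  case (App s t)
  then obtain \<tau> where "wt s" "wt t" "ty_of s = ty_of t \<leadsto> \<tau>" "\<tau> = \<rho>" by auto
  with App.IH App.prems(1) have "val e s \<in> D (ty_of t \<leadsto> \<rho>)" "val e t \<in> D (ty_of t)" by blast+
  then show ?case by (simp add: ap_D)
qed (auto simp: env_def cs_D)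

lemma val_lift [simp]: "val (ins \<rho> k x e) (lift \<rho> k t) = val e t"
  by (induction t) (auto simp: ins_def)

lemma val_subst: "val e (subst \<rho> k u t) = val (ins \<rho> k (val e u) e) t"
  by (induction t) (auto simp: ins_def)

lemma sat_liftf: "sat (ins \<rho> k x e) (liftf \<rho> k \<phi>) \<longleftrightarrow> sat e \<phi>"
proof (induction \<phi> arbitrary: k e)
  case (All \<sigma> \<phi>)
  then show ?case by (cases "\<sigma> = \<rho>") (simp_all add: ins_ins_same ins_ins_diff[of \<rho> \<sigma>])
next
  case (Ex \<sigma> \<phi>)
  then show ?case by (cases "\<sigma> = \<rho>") (simp_all add: ins_ins_same ins_ins_diff[of \<rho> \<sigma>])
qed simp_all

lemma sat_substf: "sat e (substf \<rho> k u \<phi>) \<longleftrightarrow> sat (ins \<rho> k (val e u) e) \<phi>"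
proof (induction \<phi> arbitrary: k e u)
  case (All \<sigma> \<phi>)
  then show ?case by (cases "\<sigma> = \<rho>") (simp_all add: ins_ins_same ins_ins_diff[of \<rho> \<sigma>])
next
  case (Ex \<sigma> \<phi>)
  then show ?case by (cases "\<sigma> = \<rho>") (simp_all add: ins_ins_same ins_ins_diff[of \<rho> \<sigma>])
qed (simp_all add: val_subst)

lemma sat_eqf: "env e \<Longrightarrow> has_ty s \<rho> \<Longrightarrow> has_ty t \<rho> \<Longrightarrow> sat e (eqf \<rho> s t) \<longleftrightarrow> val e s = val e t"
proof (induction \<rho> arbitrary: s t e)
  case (Fn \<rho> \<tau>)
  have "sat e (eqf (\<rho> \<leadsto> \<tau>) s t) \<longleftrightarrow> (\<forall>x\<in>D \<rho>. val e s \<bullet> x = val e t \<bullet> x)"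
  proof -
    have "sat (ins \<rho> 0 x e) (eqf \<tau> (lift \<rho> 0 s \<cdot> Var \<rho> 0) (lift \<rho> 0 t \<cdot> Var \<rho> 0)) \<longleftrightarrow>
        val e s \<bullet> x = val e t \<bullet> x" if "x \<in> D \<rho>" for x
      using Fn.prems that has_ty_lift[OF Fn.prems(2)] has_ty_lift[OF Fn.prems(3)]
      by (subst Fn.IH(2)) simp_all
    then show ?thesis by simp
  qed
  then show ?case using fun_eqI[of "val e s" \<rho> \<tau> "val e t"] Fn.prems by auto
qed simp

lemma val_closed: "closed_trm t \<Longrightarrow> val e t = val e' t"
  by (induction t) auto

end

context rca_model
begin

text \<open>The constant 0 inhabits type 0, and the combinator \<open>Pi\<close> supplies constant
  functions in every function type.\<close>

lemma D_nonempty: "\<exists>x. x \<in> D \<rho>"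
proof (induction \<rho>)
  case N
  show ?case using cs_D[of Zero] by auto
next
  case (Fn \<rho> \<tau>)
  then obtain y where "y \<in> D \<tau>" by blast
  moreover have "cs (Pi \<tau> \<rho>) \<in> D (\<tau> \<leadsto> \<rho> \<leadsto> \<tau>)" using cs_D[of "Pi \<tau> \<rho>"] by simp
  ultimately show ?case using ap_D by blast
qed

definition e0 :: "ty \<Rightarrow> nat \<Rightarrow> 'a" where
  "e0 \<rho> i = (SOME x. x \<in> D \<rho>)"

lemma env_e0 [simp]: "env e0"
  unfolding env_def e0_def using someI_ex[OF D_nonempty] by blast

lemma Pi_eq:
  assumes "x \<in> D \<rho>" "y \<in> D \<sigma>"
  shows "cs (Pi \<rho> \<sigma>) \<bullet> x \<bullet> y = x"
proof -
  define e where "e = (\<lambda>\<tau> i. if \<tau> = \<rho> \<and> i = 0 then x else if \<tau> = \<sigma> \<and> i = 1 then y else e0 \<tau> i)"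
  have "env e" using assms env_e0 unfolding env_def e_def by simp
  from sat_ax[OF pi_ax[of \<rho> \<sigma>] this]
  have "val e (Cst (Pi \<rho> \<sigma>) \<cdot> Var \<rho> 0 \<cdot> Var \<sigma> 1) = val e (Var \<rho> 0)"
    by (subst (asm) sat_eqf[OF \<open>env e\<close>]) simp_all
  then show ?thesis by (simp add: e_def)
qed

lemma Sigma_eq:
  assumes "f \<in> D (\<rho> \<leadsto> \<sigma> \<leadsto> \<tau>)" "g \<in> D (\<rho> \<leadsto> \<sigma>)" "x \<in> D \<rho>"
  shows "cs (Sigma \<rho> \<sigma> \<tau>) \<bullet> f \<bullet> g \<bullet> x = f \<bullet> x \<bullet> (g \<bullet> x)"
proof -
  define e where "e = (\<lambda>\<tau>' i. if \<tau>' = \<rho> \<leadsto> \<sigma> \<leadsto> \<tau> \<and> i = 0 then f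
    else if \<tau>' = \<rho> \<leadsto> \<sigma> \<and> i = 1 then g else if \<tau>' = \<rho> \<and> i = 2 then x else e0 \<tau>' i)"
  have "env e" using assms env_e0 unfolding env_def e_def by simp
  from sat_ax[OF sigma_ax[of \<tau> \<rho> \<sigma>] this]
  have "val e (Cst (Sigma \<rho> \<sigma> \<tau>) \<cdot> Var (\<rho> \<leadsto> \<sigma> \<leadsto> \<tau>) 0 \<cdot> Var (\<rho> \<leadsto> \<sigma>) 1 \<cdot> Var \<rho> 2) =
      val e (Var (\<rho> \<leadsto> \<sigma> \<leadsto> \<tau>) 0 \<cdot> Var \<rho> 2 \<cdot> (Var (\<rho> \<leadsto> \<sigma>) 1 \<cdot> Var \<rho> 2))"
    by (subst (asm) sat_eqf[OF \<open>env e\<close>]) simp_all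
  then show ?thesis by (simp add: e_def ty_neq_Fn)
qed

lemma beta [simp]:
  assumes "env e" "x \<in> D \<rho>"
  shows "wt t \<Longrightarrow> val e (lam \<rho> t) \<bullet> x = val (ins \<rho> 0 x e) t"
proof (induction t)
  case (Var \<sigma> i)
  show ?case
  proof (cases "\<sigma> = \<rho> \<and> i = 0")
    case True
    have "cs (Sigma \<rho> (\<rho> \<leadsto> \<rho>) \<rho>) \<bullet> cs (Pi \<rho> (\<rho> \<leadsto> \<rho>)) \<bullet> cs (Pi \<rho> \<rho>) \<bullet> x =
        cs (Pi \<rho> (\<rho> \<leadsto> \<rho>)) \<bullet> x \<bullet> (cs (Pi \<rho> \<rho>) \<bullet> x)"
      using cs_D[of "Pi \<rho> (\<rho> \<leadsto> \<rho>)"] cs_D[of "Pi \<rho> \<rho>"] assms by (intro Sigma_eq) simp_all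
    also have "\<dots> = x" using cs_D[of "Pi \<rho> \<rho>"] assms by (intro Pi_eq[where \<sigma> = "\<rho> \<leadsto> \<rho>"] ap_D[where \<rho> = \<rho>]) simp_all
    finally show ?thesis using True by (simp add: lam.simps)
  next
    case False
    with assms Pi_eq[of _ \<sigma> x \<rho>] show ?thesis by (auto simp: env_def ins_def lam.simps)
  qed
next
  case (Cst c)
  show ?case using Pi_eq[OF cs_D assms(2)] by (simp add: lam.simps)
next
  case (App s t)
  then obtain \<tau> where "wt s" "wt t" "ty_of s = ty_of t \<leadsto> \<tau>" by auto
  then have "val e (lam \<rho> s) \<in> D (\<rho> \<leadsto> ty_of t \<leadsto> ty_of (s \<cdot> t))" "val e (lam \<rho> t) \<in> D (\<rho> \<leadsto> ty_of t)"
    using assms by simp_all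
  from Sigma_eq[OF this assms(2)] App show ?case by (simp add: lam.simps)
qed

lemma qf_induct [consumes 4, case_names zero suc]:
  assumes "qf \<phi>" "wff \<phi>" and e: "env e" and n: "n \<in> D N"
    and 0: "sat (ins N 0 (cs Zero) e) \<phi>"
    and S: "\<And>n. n \<in> D N \<Longrightarrow> sat (ins N 0 n e) \<phi> \<Longrightarrow> sat (ins N 0 (cs Plus \<bullet> n \<bullet> cs One) e) \<phi>"
  shows "sat (ins N 0 n e) \<phi>"
proof -
  have "sat (ins N 0 y (ins N 0 x e)) (liftf N (Suc 0) \<phi>) \<longleftrightarrow> sat (ins N 0 y e) \<phi>" for x y
    by (simp add: ins_ins_same sat_liftf)
  then have "sat e (All N \<phi>)"
    using sat_ax[OF qf_ind[OF assms(1,2)] e] 0 S by (auto simp: sat_substf)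
  with n show ?thesis by simp
qed

lemma qf_choice:
  assumes "qf \<phi>" "wff \<phi>" and e: "env e"
    and ex: "\<And>f. f \<in> D one \<Longrightarrow> \<exists>m\<in>D N. sat (ins N 0 m (ins one 0 f e)) \<phi>"
  shows "\<exists>M\<in>D two. \<forall>f\<in>D one. sat (ins N 0 (M \<bullet> f) (ins one 0 f e)) \<phi>"
proof -
  have "sat (ins N 0 m (ins one 0 f (ins two 0 M e))) (liftf two 0 \<phi>) \<longleftrightarrow>
      sat (ins N 0 m (ins one 0 f e)) \<phi>" for m f M
    by (simp add: ins_ins_diff[of two] sat_liftf)
  with sat_ax[OF qf_ac[OF assms(1,2)] e] ex show ?thesis by (simp add: sat_substf)
qed

subsection \<open>Arithmetic in models\<close>

abbreviation zer :: 'a where "zer \<equiv> cs Zero"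
abbreviation uno :: 'a where "uno \<equiv> cs One"
abbreviation pl :: "'a \<Rightarrow> 'a \<Rightarrow> 'a" (infixl "\<oplus>" 65) where "a \<oplus> b \<equiv> cs Plus \<bullet> a \<bullet> b"
abbreviation tm :: "'a \<Rightarrow> 'a \<Rightarrow> 'a" (infixl "\<otimes>" 70) where "a \<otimes> b \<equiv> cs Times \<bullet> a \<bullet> b"

lemma cst_D [simp]:
  "zer \<in> D N" "uno \<in> D N" "cs Plus \<in> D (N \<leadsto> N \<leadsto> N)" "cs Times \<in> D (N \<leadsto> N \<leadsto> N)"
  "cs (Rec \<rho>) \<in> D ((N \<leadsto> \<rho> \<leadsto> \<rho>) \<leadsto> \<rho> \<leadsto> N \<leadsto> \<rho>)"
  using cs_D[of Zero] cs_D[of One] cs_D[of Plus] cs_D[of Times] cs_D[of "Rec \<rho>"] by simp_all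

lemmas ap_D_simps [simp] =
  ap_D[where \<rho> = N and \<tau> = N] ap_D[where \<rho> = N and \<tau> = "N \<leadsto> N"]
  ap_D[where \<rho> = one and \<tau> = N] ap_D[where \<rho> = two and \<tau> = N] ap_D[where \<rho> = two and \<tau> = one]
  ap_D[where \<rho> = "N \<leadsto> N \<leadsto> N" and \<tau> = "N \<leadsto> N \<leadsto> N"]

definition e3 :: "'a \<Rightarrow> 'a \<Rightarrow> 'a \<Rightarrow> ty \<Rightarrow> nat \<Rightarrow> 'a" where
  "e3 a b c = ins N 0 a (ins N 0 b (ins N 0 c e0))"

lemma e3_simps [simp]: "e3 a b c N 0 = a" "e3 a b c N (Suc 0) = b" "e3 a b c N 2 = c"
  by (simp_all add: e3_def)

lemma semiring_sat:
  "semiring_ax \<phi> \<Longrightarrow> a \<in> D N \<Longrightarrow> b \<in> D N \<Longrightarrow> c \<in> D N \<Longrightarrow> sat (e3 a b c) \<phi>"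
  by (rule sat_ax[OF RCA_ax.semiring_ax]) (simp_all add: e3_def)

lemma
  assumes [simp]: "a \<in> D N"
  shows pl_zero: "a \<oplus> zer = a"
    and tm_one: "a \<otimes> uno = a"
    and less_irrefl: "\<not> a \<prec> a"
    and zero_or_pos: "a = zer \<or> zer \<prec> a"
  using semiring_sat[OF semiring_ax.intros(3), of a a a] semiring_sat[OF semiring_ax.intros(6), of a a a]
    semiring_sat[OF semiring_ax.intros(9), of a a a] semiring_sat[OF semiring_ax.intros(15), of a a a]
  by simp_all

lemma
  assumes [simp]: "a \<in> D N" "b \<in> D N"
  shows pl_comm: "a \<oplus> b = b \<oplus> a"
    and tm_comm: "a \<otimes> b = b \<otimes> a"
    and less_linear: "a \<prec> b \<or> a = b \<or> b \<prec> a"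
  using semiring_sat[OF semiring_ax.intros(2), of a b a] semiring_sat[OF semiring_ax.intros(5), of a b a]
    semiring_sat[OF semiring_ax.intros(11), of a b a]
  by simp_all

lemma
  assumes [simp]: "a \<in> D N" "b \<in> D N" "c \<in> D N"
  shows pl_assoc: "(a \<oplus> b) \<oplus> c = a \<oplus> (b \<oplus> c)"
    and distrib: "a \<otimes> (b \<oplus> c) = a \<otimes> b \<oplus> a \<otimes> c"
    and less_trans: "a \<prec> b \<Longrightarrow> b \<prec> c \<Longrightarrow> a \<prec> c"
    and pl_mono: "a \<prec> b \<Longrightarrow> a \<oplus> c \<prec> b \<oplus> c"
  using semiring_sat[OF semiring_ax.intros(1), of a b c] semiring_sat[OF semiring_ax.intros(8), of a b c]
    semiring_sat[OF semiring_ax.intros(10), of a b c] semiring_sat[OF semiring_ax.intros(12), of a b c]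
  by simp_all

lemma zero_less_one: "zer \<prec> uno"
  using semiring_sat[OF semiring_ax.intros(14), of zer zer zer] by simp

lemma one_times: "a \<in> D N \<Longrightarrow> uno \<otimes> a = a"
  using tm_comm[of uno a] tm_one[of a] by simp

lemma zero_pl: "a \<in> D N \<Longrightarrow> zer \<oplus> a = a"
  using pl_comm[of zer a] pl_zero[of a] by simp

lemma pl_left_comm: "a \<in> D N \<Longrightarrow> b \<in> D N \<Longrightarrow> c \<in> D N \<Longrightarrow> a \<oplus> (b \<oplus> c) = b \<oplus> (a \<oplus> c)"
  by (metis pl_assoc pl_comm)

lemmas pl_ac = pl_assoc pl_comm pl_left_comm

lemma distrib2: "a \<in> D N \<Longrightarrow> b \<in> D N \<Longrightarrow> c \<in> D N \<Longrightarrow> (a \<oplus> b) \<otimes> c = a \<otimes> c \<oplus> b \<otimes> c"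
  using tm_comm[of "a \<oplus> b" c] tm_comm[of c a] tm_comm[of c b] distrib[of c a b] by simp

lemma pl_cancel:
  assumes [simp]: "a \<in> D N" "b \<in> D N" "c \<in> D N" and eq: "c \<oplus> a = c \<oplus> b"
  shows "a = b"
proof (rule ccontr)
  assume "a \<noteq> b"
  then have "a \<prec> b \<or> b \<prec> a" using less_linear[of a b] by simp
  then have "a \<oplus> c \<prec> b \<oplus> c \<or> b \<oplus> c \<prec> a \<oplus> c" using pl_mono[of _ _ c] by auto
  then show False using eq less_irrefl[of "c \<oplus> a"] pl_comm[of a c] pl_comm[of b c] by simp
qed

lemma less_suc: "a \<in> D N \<Longrightarrow> a \<prec> a \<oplus> uno"
  using pl_mono[of zer uno a] zero_less_one pl_comm[of uno a] by (simp add: zero_pl)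

lemma suc_neq_zero: "a \<in> D N \<Longrightarrow> a \<oplus> uno \<noteq> zer"
proof
  assume [simp]: "a \<in> D N" and eq: "a \<oplus> uno = zer"
  have "a \<prec> zer" using less_suc[of a] eq by simp
  then show False using zero_or_pos[of a] less_irrefl[of zer] less_trans[of zer a zer] by auto
qed

lemma one_neq_zero: "uno \<noteq> zer"
  using zero_less_one less_irrefl[of zer] by auto

lemma Rec_zero:
  assumes "f \<in> D (N \<leadsto> N \<leadsto> N)" "a \<in> D N"
  shows "cs (Rec N) \<bullet> f \<bullet> a \<bullet> zer = a"
  using sat_ax[OF rec_zero, of "ins N 0 a (ins (N \<leadsto> N \<leadsto> N) 0 f e0)"] assms by simp

lemma Rec_suc:
  assumes "f \<in> D (N \<leadsto> N \<leadsto> N)" "a \<in> D N" "n \<in> D N"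
  shows "cs (Rec N) \<bullet> f \<bullet> a \<bullet> (n \<oplus> uno) = f \<bullet> n \<bullet> (cs (Rec N) \<bullet> f \<bullet> a \<bullet> n)"
  using sat_ax[OF rec_suc, of "ins N 0 a (ins N 0 n (ins (N \<leadsto> N \<leadsto> N) 0 f e0))"] assms by simp

lemma Rec_D [simp]:
  assumes "f \<in> D (N \<leadsto> N \<leadsto> N)" "a \<in> D N"
  shows "cs (Rec N) \<bullet> f \<bullet> a \<in> D (N \<leadsto> N)"
  using ap_D[OF ap_D[OF _ assms(1)] assms(2), of "cs (Rec N)"] by simp

section \<open>Predecessor, subtraction and pairing in models\<close>

definition "Pred = val e0 pred_tm"
definition "Sg = val e0 sg_tm"
definition "Nsg = val e0 nsg_tm"
definition "PredStep = val e0 pred_step_tm"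
definition "Sub = val e0 sub_tm"
definition "Eqt = val e0 eqt_tm"
definition "Pairn = val e0 pair_tm"

lemma val_tms [simp]:
  "val e pred_tm = Pred" "val e sg_tm = Sg" "val e nsg_tm = Nsg" "val e pred_step_tm = PredStep"
  "val e sub_tm = Sub" "val e eqt_tm = Eqt" "val e pair_tm = Pairn"
  unfolding Pred_def Sg_def Nsg_def PredStep_def Sub_def Eqt_def Pairn_def
  by (rule val_closed; simp)+

lemma tms_D [simp]:
  "Pred \<in> D (N \<leadsto> N)" "Sg \<in> D (N \<leadsto> N)" "Nsg \<in> D (N \<leadsto> N)" "PredStep \<in> D (N \<leadsto> N \<leadsto> N)"
  "Sub \<in> D (N \<leadsto> N \<leadsto> N)" "Eqt \<in> D (N \<leadsto> N \<leadsto> N)" "Pairn \<in> D (N \<leadsto> N \<leadsto> N)"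
  unfolding Pred_def Sg_def Nsg_def PredStep_def Sub_def Eqt_def Pairn_def
  by (rule val_D; simp)+

lemma Pred_eq:
  "Pred \<bullet> zer = zer" "n \<in> D N \<Longrightarrow> Pred \<bullet> (n \<oplus> uno) = n"
  using val_tms(1)[of e0, symmetric] by (simp_all add: pred_tm_def Rec_zero Rec_suc)

lemma Sg_eq:
  "Sg \<bullet> zer = zer" "n \<in> D N \<Longrightarrow> Sg \<bullet> (n \<oplus> uno) = uno"
  using val_tms(2)[of e0, symmetric] by (simp_all add: sg_tm_def Rec_zero Rec_suc)

lemma Nsg_eq:
  "Nsg \<bullet> zer = uno" "n \<in> D N \<Longrightarrow> Nsg \<bullet> (n \<oplus> uno) = zer"
  using val_tms(3)[of e0, symmetric] by (simp_all add: nsg_tm_def Rec_zero Rec_suc)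

lemma Sub_rec: 
  assumes "a \<in> D N" "b \<in> D N"
  shows "Sub \<bullet> a \<bullet> b = cs (Rec N) \<bullet> PredStep \<bullet> a \<bullet> b"
  using val_tms(5)[of e0, symmetric] assms by (simp add: sub_tm_def)

lemma Sub_eq:
  "a \<in> D N \<Longrightarrow> Sub \<bullet> a \<bullet> zer = a"
  "a \<in> D N \<Longrightarrow> n \<in> D N \<Longrightarrow> Sub \<bullet> a \<bullet> (n \<oplus> uno) = Pred \<bullet> (Sub \<bullet> a \<bullet> n)"
proof -
  have "PredStep \<bullet> k \<bullet> r = Pred \<bullet> r" if "k \<in> D N" "r \<in> D N" for k r
    using val_tms(4)[of e0, symmetric] that by (simp add: pred_step_tm_def)
  then show "a \<in> D N \<Longrightarrow> Sub \<bullet> a \<bullet> zer = a"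
    "a \<in> D N \<Longrightarrow> n \<in> D N \<Longrightarrow> Sub \<bullet> a \<bullet> (n \<oplus> uno) = Pred \<bullet> (Sub \<bullet> a \<bullet> n)"
    by (simp_all add: Sub_rec Rec_zero Rec_suc)
qed

text \<open>The existence of a predecessor is not quantifier-free; with the term
  \<open>pred_tm\<close> as the witness it becomes so, and induction reaches nonstandard numbers as
  well.\<close>

lemma zero_or_suc:
  assumes "n \<in> D N"
  obtains "n = zer" | m where "m \<in> D N" "n = m \<oplus> uno"
proof -
  have "sat (ins N 0 n e0) (Or (Eq (Var N 0) zero_tm) (Eq (Var N 0) (suc_tm (pred_tm \<cdot> Var N 0))))"
    by (rule qf_induct) (use assms in \<open>simp_all add: Pred_eq\<close>)
  then have "n = zer \<or> n = Pred \<bullet> n \<oplus> uno" by simp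
  then show thesis using that(1) that(2)[of "Pred \<bullet> n"] assms by auto
qed

lemma pl_eq_zero:
  assumes "a \<in> D N" "b \<in> D N" "a \<oplus> b = zer"
  shows "a = zer \<and> b = zer"
proof -
  have "y = zer" if [simp]: "x \<in> D N" "y \<in> D N" and eq: "x \<oplus> y = zer" for x y
    using \<open>y \<in> D N\<close>
  proof (cases rule: zero_or_suc)
    case (2 m)
    then show ?thesis using eq suc_neq_zero[of "x \<oplus> m"] pl_assoc[of x m uno] by simp
  qed
  from this[of a b] this[of b a] assms pl_comm[of a b] show ?thesis by simp
qed

text \<open>Induction on \<open>x\<close>. The term \<open>sub_tm\<close> replaces the existentially
  quantified difference: truncated subtraction is either cut off at 0, with \<open>y\<close> below
  \<open>x\<close>, or exact.\<close>

lemma Sub_cases: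
  assumes [simp]: "x \<in> D N" "y \<in> D N"
  shows "y \<prec> x \<and> Sub \<bullet> y \<bullet> x = zer \<or> y = x \<oplus> Sub \<bullet> y \<bullet> x"
proof -
  have "sat (ins N 0 x (ins N 0 y e0)) (Or
      (And (Less (Var N 1) (Var N 0)) (Eq (sub_tm \<cdot> Var N 1 \<cdot> Var N 0) zero_tm))
      (Eq (Var N 1) (plus_tm (Var N 0) (sub_tm \<cdot> Var N 1 \<cdot> Var N 0))))"
  proof (rule qf_induct)
    fix n assume [simp]: "n \<in> D N" and
      "sat (ins N 0 n (ins N 0 y e0)) (Or
        (And (Less (Var N 1) (Var N 0)) (Eq (sub_tm \<cdot> Var N 1 \<cdot> Var N 0) zero_tm))
        (Eq (Var N 1) (plus_tm (Var N 0) (sub_tm \<cdot> Var N 1 \<cdot> Var N 0))))"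
    then consider "y \<prec> n" "Sub \<bullet> y \<bullet> n = zer" | "y = n \<oplus> Sub \<bullet> y \<bullet> n" by auto
    then have "y \<prec> n \<oplus> uno \<and> Sub \<bullet> y \<bullet> (n \<oplus> uno) = zer \<or> y = (n \<oplus> uno) \<oplus> Sub \<bullet> y \<bullet> (n \<oplus> uno)"
    proof cases
      case 1
      then show ?thesis using less_suc[of n] less_trans[of y n "n \<oplus> uno"] by (simp add: Sub_eq Pred_eq)
    next
      case 2
      have "Sub \<bullet> y \<bullet> n \<in> D N" by simp
      then show ?thesis
      proof (cases rule: zero_or_suc)
        \<comment> \<open>Here \<open>x\<close> has reached \<open>y\<close>; at its successor the
          first alternative takes over.\<close>
        case 1
        then have "y = n" using 2 by (simp add: pl_zero)
        then show ?thesis using less_suc[of n] 1 by (simp add: Sub_eq Pred_eq)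
      next
        case (2 m)
        then have "y = n \<oplus> (m \<oplus> uno)" using \<open>y = n \<oplus> Sub \<bullet> y \<bullet> n\<close> by simp
        then have "y = (n \<oplus> uno) \<oplus> m" using 2 by (simp add: pl_ac)
        then show ?thesis using 2 by (simp add: Sub_eq Pred_eq)
      qed
    qed
    then show "sat (ins N 0 (n \<oplus> uno) (ins N 0 y e0)) (Or
        (And (Less (Var N 1) (Var N 0)) (Eq (sub_tm \<cdot> Var N 1 \<cdot> Var N 0) zero_tm))
        (Eq (Var N 1) (plus_tm (Var N 0) (sub_tm \<cdot> Var N 1 \<cdot> Var N 0))))" by simp
  qed (simp_all add: Sub_eq zero_pl)
  then show ?thesis by simp
qed

lemma less_imp_suc:
  assumes [simp]: "x \<in> D N" "y \<in> D N" and less: "x \<prec> y"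
  obtains c where "c \<in> D N" "y = x \<oplus> (c \<oplus> uno)"
proof -
  have "\<not> y \<prec> x" using less less_trans[of x y x] less_irrefl[of x] by auto
  then have eq: "y = x \<oplus> Sub \<bullet> y \<bullet> x" using Sub_cases[of x y] by simp
  have "Sub \<bullet> y \<bullet> x \<in> D N" by simp
  then show thesis
  proof (cases rule: zero_or_suc)
    case 1
    then have "y = x" using eq pl_zero[of x] by simp
    then show ?thesis using less less_irrefl[of x] by simp
  next
    case (2 m)
    then show ?thesis using that[of m] eq by simp
  qed
qed

lemma Sub_self: "a \<in> D N \<Longrightarrow> Sub \<bullet> a \<bullet> a = zer"
  using Sub_cases[of a a] less_irrefl[of a] pl_cancel[of "Sub \<bullet> a \<bullet> a" zer a] pl_zero[of a] by auto

lemma Eqt_sub: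
  "a \<in> D N \<Longrightarrow> b \<in> D N \<Longrightarrow> Eqt \<bullet> a \<bullet> b = Sg \<bullet> (Sub \<bullet> a \<bullet> b \<oplus> Sub \<bullet> b \<bullet> a)"
  using val_tms(6)[of e0, symmetric] by (simp add: eqt_tm_def)

lemma Sg_pos:
  assumes "n \<in> D N" "n \<noteq> zer"
  shows "Sg \<bullet> n = uno"
  using assms(1) by (cases rule: zero_or_suc) (use assms in \<open>simp_all add: Sg_eq\<close>)

lemma Sg_01: "n \<in> D N \<Longrightarrow> Sg \<bullet> n = zer \<or> Sg \<bullet> n = uno"
  using Sg_pos Sg_eq by blast

lemma Sg_zero_iff: "n \<in> D N \<Longrightarrow> Sg \<bullet> n = zer \<longleftrightarrow> n = zer"
  using Sg_pos Sg_eq one_neq_zero by metis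

lemma Sg_id: "n = zer \<or> n = uno \<Longrightarrow> Sg \<bullet> n = n"
  using Sg_eq(1) Sg_pos[of uno] one_neq_zero by auto

lemma Nsg_pos:
  assumes "n \<in> D N" "n \<noteq> zer"
  shows "Nsg \<bullet> n = zer"
  using assms(1) by (cases rule: zero_or_suc) (use assms in \<open>simp_all add: Nsg_eq\<close>)

lemma Eqt_zero_iff:
  assumes [simp]: "a \<in> D N" "b \<in> D N"
  shows "Eqt \<bullet> a \<bullet> b = zer \<longleftrightarrow> a = b"
proof
  assume "Eqt \<bullet> a \<bullet> b = zer"
  then have "Sub \<bullet> a \<bullet> b \<oplus> Sub \<bullet> b \<bullet> a = zer" by (simp add: Eqt_sub Sg_zero_iff)
  then have *: "Sub \<bullet> a \<bullet> b = zer" "Sub \<bullet> b \<bullet> a = zer"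
    using pl_eq_zero[of "Sub \<bullet> a \<bullet> b" "Sub \<bullet> b \<bullet> a"] by simp_all
  then have "a \<prec> b \<or> a = b" "b \<prec> a \<or> b = a"
    using Sub_cases[of b a] Sub_cases[of a b] by (auto simp: pl_zero)
  then show "a = b" using less_trans[of a b a] less_irrefl[of a] by auto
next
  assume "a = b"
  then show "Eqt \<bullet> a \<bullet> b = zer" by (simp add: Eqt_sub Sub_self pl_zero Sg_eq)
qed

lemma Pair_eq:
  "n \<in> D N \<Longrightarrow> k \<in> D N \<Longrightarrow> Pairn \<bullet> n \<bullet> k = (n \<oplus> k) \<otimes> (n \<oplus> k) \<oplus> k"
  using val_tms(7)[of e0, symmetric] by (simp add: pair_tm_def)

lemma Pair_less:
  assumes [simp]: "n \<in> D N" "k \<in> D N" "n' \<in> D N" "k' \<in> D N" and less: "n \<oplus> k \<prec> n' \<oplus> k'"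
  shows "Pairn \<bullet> n \<bullet> k \<noteq> Pairn \<bullet> n' \<bullet> k'"
proof
  assume eq: "Pairn \<bullet> n \<bullet> k = Pairn \<bullet> n' \<bullet> k'"
  define s where "s = n \<oplus> k"
  have s [simp]: "s \<in> D N" by (simp add: s_def)
  obtain c where c [simp]: "c \<in> D N" and s': "n' \<oplus> k' = s \<oplus> (c \<oplus> uno)"
    using less_imp_suc[OF _ _ less] unfolding s_def by auto
  \<comment> \<open>With \<open>s + c + 1\<close> for the larger sum, \<open>Y\<close> is what
    remains of its square plus \<open>k'\<close> after splitting off the square of \<open>s\<close>,
    then \<open>s\<close> and 1. Equal codes give \<open>k = s + Y + 1\<close>, which is impossible
    for \<open>s = n + k\<close>.\<close>
  define Y where "Y = s \<otimes> c \<oplus> (c \<oplus> uno) \<otimes> s \<oplus> ((c \<oplus> uno) \<otimes> c \<oplus> c) \<oplus> k'"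
  have Y [simp]: "Y \<in> D N" by (simp add: Y_def)
  have "s \<otimes> s \<oplus> k = (s \<oplus> (c \<oplus> uno)) \<otimes> (s \<oplus> (c \<oplus> uno)) \<oplus> k'"
    using eq by (simp add: Pair_eq s' flip: s_def)
  also have "\<dots> = s \<otimes> s \<oplus> (s \<oplus> (Y \<oplus> uno))"
    unfolding Y_def by (simp add: distrib distrib2 tm_one one_times pl_ac)
  finally have "k = s \<oplus> (Y \<oplus> uno)" using pl_cancel[of k "s \<oplus> (Y \<oplus> uno)" "s \<otimes> s"] by simp
  also have "\<dots> = k \<oplus> ((n \<oplus> Y) \<oplus> uno)" unfolding s_def by (simp add: pl_ac)
  finally have "k \<oplus> zer = k \<oplus> ((n \<oplus> Y) \<oplus> uno)" by (simp add: pl_zero)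
  then have "zer = (n \<oplus> Y) \<oplus> uno" by (rule pl_cancel[rotated 3]) simp_all
  then show False using suc_neq_zero[of "n \<oplus> Y"] by simp
qed

lemma Pair_inj:
  assumes [simp]: "n \<in> D N" "k \<in> D N" "n' \<in> D N" "k' \<in> D N" and eq: "Pairn \<bullet> n \<bullet> k = Pairn \<bullet> n' \<bullet> k'"
  shows "n = n' \<and> k = k'"
proof -
  have s: "n \<oplus> k = n' \<oplus> k'"
    using Pair_less[of n k n' k'] Pair_less[of n' k' n k] less_linear[of "n \<oplus> k" "n' \<oplus> k'"] eq by auto
  then have "k = k'" using eq pl_cancel[of k k' "(n \<oplus> k) \<otimes> (n \<oplus> k)"] by (simp add: Pair_eq)
  then show ?thesis using s pl_cancel[of n n' k] pl_comm[of n k] pl_comm[of n' k] by simp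
qed

end

section \<open>\<open>\<zeta>\<close>-functionals and \<open>\<exists>\<^sup>3\<close> in models\<close>

lemma has_ty_cons [simp]: "has_ty m N \<Longrightarrow> has_ty f one \<Longrightarrow> wt (cons_tm m f) \<and> ty_of (cons_tm m f) = one"
  using has_ty_lift[of f one N 0] has_ty_lift[of "lift N 0 f" one N 0] by (simp add: cons_tm_def)

lemma has_ty_code [simp]:
  "has_ty m N \<Longrightarrow> has_ty n N \<Longrightarrow> has_ty f one \<Longrightarrow> wt (code_tm f m n) \<and> ty_of (code_tm f m n) = one"
  by (simp add: code_tm_def)

text \<open>In the following terms, \<open>Var (two \<leadsto> one) 0\<close> is a \<open>\<zeta>\<close>-functional.\<close>

definition mu_tm :: trm where
  "mu_tm = lam one (Var (two \<leadsto> one) 0 \<cdot> lam one (Var one 1 \<cdot> (Var one 0 \<cdot> zero_tm)) \<cdot> zero_tm)"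

definition dec_tm :: trm where
  "dec_tm = lam one (lam N (mu_tm \<cdot> lam N (Var one 0 \<cdot> (pair_tm \<cdot> Var N 1 \<cdot> Var N 0))))"

definition enc_fun_tm :: trm where
  "enc_fun_tm = lam N (eqt_tm \<cdot> (pair_tm \<cdot> Var N 0 \<cdot> (Var one 0 \<cdot> Var N 0)) \<cdot> Var N 1)"

text \<open>The search looks for \<open>n\<close> such that the pair of \<open>n\<close> and
  \<open>x(n)\<close> is \<open>p\<close>, and the test is then evaluated at the result: it gives 0
  exactly if such an \<open>n\<close> exists, whatever the search returns otherwise. By this term a
  model contains a 0-1-valued code of each of its functions.\<close>

definition enc_tm :: trm where
  "enc_tm = lam N (enc_fun_tm \<cdot> (mu_tm \<cdot> enc_fun_tm))"

definition one_fun_tm :: trm where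
  "one_fun_tm = lam one one_tm"

definition base_tm :: trm where
  "base_tm = Var (two \<leadsto> one) 0 \<cdot> one_fun_tm \<cdot> zero_tm"

definition tail2_tm :: trm where
  "tail2_tm = lam N (Var one 0 \<cdot> suc_tm (suc_tm (Var N 0)))"

text \<open>A sum vanishes exactly if both summands do, so addition expresses the conjunction. The
  outer \<open>sg_tm\<close> makes the values 0 and 1, so that without a zero the functional agrees
  with \<open>one_fun_tm\<close>, the argument used in \<open>base_tm\<close>.\<close>

definition guard_tm :: trm where
  "guard_tm = lam one (sg_tm \<cdot> plus_tm (eqt_tm \<cdot> (Var one 0 \<cdot> zero_tm) \<cdot> suc_tm base_tm)
     (Var two 0 \<cdot> (dec_tm \<cdot> tail2_tm)))"

definition exists3_tm :: trm where
  "exists3_tm = lam two (nsg_tm \<cdot> (eqt_tm \<cdot> (Var (two \<leadsto> one) 0 \<cdot> guard_tm \<cdot> zero_tm) \<cdot> base_tm))"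

lemma closed_one_fun [simp]: "closed_trm one_fun_tm"
  unfolding one_fun_tm_def by (rule closed_lam) simp

lemma has_ty_search [simp]:
  "wt mu_tm" "ty_of mu_tm = two" "wt dec_tm" "ty_of dec_tm = one \<leadsto> one"
  "wt enc_fun_tm" "ty_of enc_fun_tm = one" "wt enc_tm" "ty_of enc_tm = one"
  "wt one_fun_tm" "ty_of one_fun_tm = two" "wt base_tm" "ty_of base_tm = N"
  "wt tail2_tm" "ty_of tail2_tm = one" "wt guard_tm" "ty_of guard_tm = two"
  "wt exists3_tm" "ty_of exists3_tm = three"
  by (simp_all add: mu_tm_def dec_tm_def enc_fun_tm_def enc_tm_def one_fun_tm_def base_tm_def
      tail2_tm_def guard_tm_def exists3_tm_def)

text \<open>In the following terms, \<open>Var three 0\<close> is \<open>\<exists>\<^sup>3\<close>.\<close>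

definition sg_fun_tm :: trm where
  "sg_fun_tm = lam N (sg_tm \<cdot> (Var one 0 \<cdot> Var N 0))"

text \<open>\<open>E\<close> quantifies over all functions. Composition with the sign restricts it
  to Cantor space, since \<open>sg_fun_tm\<close> always yields a 0-1-valued function and fixes
  those that already are.\<close>

definition test_tm :: "trm \<Rightarrow> trm \<Rightarrow> trm" where
  "test_tm m n = Var three 0 \<cdot> lam one (Var two 0 \<cdot> code_tm sg_fun_tm (lift one 0 m) (lift one 0 n))"

text \<open>\<open>Var two 1\<close> is the search functional obtained from QF-AC, which is
  \<open>Var two 0\<close> outside the abstraction over \<open>Y\<close>. It is applied to the test
  for \<open>A(n, m)\<close> as a function of \<open>m\<close>.\<close>

definition choice_tm :: trm where
  "choice_tm = lam two (lam N (Var two 1 \<cdot> lam N (test_tm (Var N 0) (Var N 1))))"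

lemma has_ty_sg_fun [simp]: "wt sg_fun_tm" "ty_of sg_fun_tm = one"
  by (simp_all add: sg_fun_tm_def)

lemma has_ty_test [simp]: "has_ty m N \<Longrightarrow> has_ty n N \<Longrightarrow> wt (test_tm m n) \<and> ty_of (test_tm m n) = N"
  using has_ty_lift[of m N one 0] has_ty_lift[of n N one 0] by (simp add: test_tm_def)

lemma has_ty_choice [simp]: "wt choice_tm" "ty_of choice_tm = two \<leadsto> one"
  by (simp_all add: choice_tm_def)

context rca_model
begin

section \<open>Coded triples and the relation A in models\<close>

lemma one_D_cases:
  assumes "f \<in> D one" "g \<in> D one" "f \<bullet> zer = g \<bullet> zer"
    "\<And>n. n \<in> D N \<Longrightarrow> f \<bullet> (n \<oplus> uno) = g \<bullet> (n \<oplus> uno)"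
  shows "f = g"
proof (rule fun_eqI[OF assms(1,2)])
  fix n assume "n \<in> D N"
  then show "f \<bullet> n = g \<bullet> n" by (cases rule: zero_or_suc) (use assms in simp_all)
qed

lemma val_cons_tm:
  assumes "env e" "has_ty m N" "has_ty f one"
  shows "val e (cons_tm m f) \<bullet> zer = val e m"
    and "n \<in> D N \<Longrightarrow> val e (cons_tm m f) \<bullet> (n \<oplus> uno) = val e f \<bullet> n"
proof -
  have ty: "has_ty (lift N 0 (lift N 0 f)) one" using assms(3) by (intro has_ty_lift)
  show "val e (cons_tm m f) \<bullet> zer = val e m"
    using assms ty by (simp add: cons_tm_def Rec_zero)
  assume n: "n \<in> D N"
  have "cs (Rec N) \<bullet> val e (lam N (lam N (lift N 0 (lift N 0 f) \<cdot> Var N 1))) \<bullet> val e m \<bullet> n \<in> D N"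
    using n assms ty by simp
  then show "val e (cons_tm m f) \<bullet> (n \<oplus> uno) = val e f \<bullet> n"
    using assms ty n by (simp add: cons_tm_def Rec_suc)
qed

definition Cons :: "'a \<Rightarrow> 'a \<Rightarrow> 'a" where
  "Cons m f = val (ins N 0 m (ins one 0 f e0)) (cons_tm (Var N 0) (Var one 0))"

lemma Cons_D [simp]: "m \<in> D N \<Longrightarrow> f \<in> D one \<Longrightarrow> Cons m f \<in> D one"
  unfolding Cons_def by (rule val_D) simp_all

lemma Cons_eq [simp]:
  assumes "m \<in> D N" "f \<in> D one"
  shows "Cons m f \<bullet> zer = m" and "n \<in> D N \<Longrightarrow> Cons m f \<bullet> (n \<oplus> uno) = f \<bullet> n"
  unfolding Cons_def using assms by (simp_all add: val_cons_tm)

lemma val_cons [simp]: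
  "env e \<Longrightarrow> has_ty m N \<Longrightarrow> has_ty f one \<Longrightarrow> val e (cons_tm m f) = Cons (val e m) (val e f)"
  by (rule one_D_cases) (simp_all add: val_cons_tm)

definition Code :: "'a \<Rightarrow> 'a \<Rightarrow> 'a \<Rightarrow> 'a" where
  "Code f m n = Cons m (Cons n f)"

lemma Code_D [simp]: "m \<in> D N \<Longrightarrow> n \<in> D N \<Longrightarrow> f \<in> D one \<Longrightarrow> Code f m n \<in> D one"
  by (simp add: Code_def)

lemma Code_eq:
  assumes "m \<in> D N" "n \<in> D N" "f \<in> D one"
  shows "Code f m n \<bullet> zer = m" and "i \<in> D N \<Longrightarrow> Code f m n \<bullet> (i \<oplus> uno \<oplus> uno) = f \<bullet> i"
  using assms by (simp_all add: Code_def)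

lemma val_code [simp]:
  "env e \<Longrightarrow> has_ty m N \<Longrightarrow> has_ty n N \<Longrightarrow> has_ty f one \<Longrightarrow>
    val e (code_tm f m n) = Code (val e f) (val e m) (val e n)"
  by (simp add: code_tm_def Code_def)

definition bin :: "'a \<Rightarrow> bool" where
  "bin f \<longleftrightarrow> f \<in> D one \<and> (\<forall>i\<in>D N. f \<bullet> i = zer \<or> f \<bullet> i = uno)"

definition Arel :: "'a \<Rightarrow> 'a \<Rightarrow> 'a \<Rightarrow> bool" where
  "Arel Y n m \<longleftrightarrow> (\<exists>f. bin f \<and> Y \<bullet> Code f m n = zer)"

lemma sat_A_fm [simp]:
  assumes "env e" "has_ty m N" "has_ty n N"
  shows "sat e (A_fm Y n m) \<longleftrightarrow> Arel (val e Y) (val e n) (val e m)"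
proof -
  have "has_ty (lift one 0 m) N" "has_ty (lift one 0 n) N" using assms by (simp_all add: has_ty_lift)
  then show ?thesis using assms by (auto simp: A_fm_def Arel_def bin_def)
qed

definition Ncc :: "'a \<Rightarrow> bool" where
  "Ncc \<zeta> \<longleftrightarrow> (\<forall>Y\<in>D two. (\<forall>n\<in>D N. \<exists>m\<in>D N. Arel Y n m) \<longrightarrow> (\<forall>n\<in>D N. Arel Y n (\<zeta> \<bullet> Y \<bullet> n)))"

lemma sat_NCC_fm: "env e \<Longrightarrow> \<zeta> \<in> D (two \<leadsto> one) \<Longrightarrow> sat (ins (two \<leadsto> one) 0 \<zeta> e) NCC_fm \<longleftrightarrow> Ncc \<zeta>"
  by (simp add: NCC_fm_def Ncc_def)

definition Exists3 :: "'a \<Rightarrow> bool" where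
  "Exists3 E \<longleftrightarrow> (\<forall>Y\<in>D two. E \<bullet> Y \<prec> uno \<or> E \<bullet> Y = uno) \<and>
     (\<forall>Y\<in>D two. (\<exists>f\<in>D one. Y \<bullet> f = zer) \<longleftrightarrow> E \<bullet> Y = zer)"

lemma sat_exists3_fm: "env e \<Longrightarrow> sat e exists3_fm \<longleftrightarrow> (\<exists>E\<in>D three. Exists3 E)"
  by (auto simp: exists3_fm_def Exists3_def)

section \<open>From a zeta-functional to exists3 in models\<close>

lemma mu_spec:
  assumes \<zeta>: "Ncc \<zeta>" "e (two \<leadsto> one) 0 = \<zeta>" and e [simp]: "env e"
    and h [simp]: "h \<in> D one" and k: "k \<in> D N" "h \<bullet> k = zer"
  shows "h \<bullet> (val e mu_tm \<bullet> h) = zer"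
proof -
  have \<zeta>D: "\<zeta> \<in> D (two \<leadsto> one)" using \<zeta>(2) e unfolding env_def by blast
  define Y where "Y = val (ins one 0 h e) (lam one (Var one 1 \<cdot> (Var one 0 \<cdot> zero_tm)))"
  have Y [simp]: "Y \<in> D two" unfolding Y_def by (rule val_D) simp_all
  have Y_eq: "Y \<bullet> g = h \<bullet> (g \<bullet> zer)" if "g \<in> D one" for g
    unfolding Y_def using that by simp
  \<comment> \<open>\<open>Y\<close> reads only the entry \<open>m\<close>, so
    \<open>A(n, m)\<close> amounts to \<open>h(m) = 0\<close> for every \<open>n\<close>. The
    relation asks for an element of Cantor space as well; the zero function serves.\<close>
  have "Arel Y n k" if "n \<in> D N" for n
  proof -
    have "bin (val e (lam N zero_tm))" by (simp add: bin_def)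
    moreover have "Y \<bullet> Code (val e (lam N zero_tm)) k n = zer"
      using that k by (simp add: Y_eq Code_eq)
    ultimately show ?thesis unfolding Arel_def by blast
  qed
  then have "\<forall>n\<in>D N. \<exists>m\<in>D N. Arel Y n m" using k(1) by blast
  then have "Arel Y zer (\<zeta> \<bullet> Y \<bullet> zer)" using \<zeta>(1) unfolding Ncc_def by simp
  then obtain f where "f \<in> D one" "Y \<bullet> Code f (\<zeta> \<bullet> Y \<bullet> zer) zer = zer"
    unfolding Arel_def bin_def by blast
  then have "h \<bullet> (\<zeta> \<bullet> Y \<bullet> zer) = zer" using \<zeta>D by (simp add: Y_eq Code_eq)
  moreover have "val e mu_tm \<bullet> h = \<zeta> \<bullet> Y \<bullet> zer" by (simp add: mu_tm_def Y_def \<zeta>(2))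
  ultimately show ?thesis by simp
qed

text \<open>For fixed \<open>n\<close>, the function of \<open>k\<close> that is searched has a zero
  at \<open>x(n)\<close>, and injectivity of the pairing makes it the only one. So the search
  returns \<open>x(n)\<close>, although it need not look for a least zero.\<close>

lemma dec_spec:
  assumes \<zeta>: "Ncc \<zeta>" "e (two \<leadsto> one) 0 = \<zeta>" and e [simp]: "env e"
    and [simp]: "f \<in> D one" "x \<in> D one"
    and f: "\<And>p. p \<in> D N \<Longrightarrow> f \<bullet> p = zer \<longleftrightarrow> (\<exists>n\<in>D N. Pairn \<bullet> n \<bullet> (x \<bullet> n) = p)"
  shows "val e dec_tm \<bullet> f = x"
proof (rule fun_eqI)
  show "val e dec_tm \<bullet> f \<in> D one" by (rule ap_D[where \<rho> = one]) simp_all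
  show "x \<in> D one" by simp
  fix n assume [simp]: "n \<in> D N"
  define e' where "e' = ins N 0 n (ins one 0 f e)"
  have e' [simp]: "env e'" by (simp add: e'_def)
  define h where "h = val e' (lam N (Var one 0 \<cdot> (pair_tm \<cdot> Var N 1 \<cdot> Var N 0)))"
  have h [simp]: "h \<in> D one" unfolding h_def by (rule val_D) simp_all
  have h_eq: "h \<bullet> k = f \<bullet> (Pairn \<bullet> n \<bullet> k)" if "k \<in> D N" for k
    unfolding h_def e'_def using that by simp
  have "Pairn \<bullet> n \<bullet> (x \<bullet> n) \<in> D N" by simp
  then have "h \<bullet> (x \<bullet> n) = zer" by (subst h_eq, simp, subst f) auto
  then have "h \<bullet> (val e' mu_tm \<bullet> h) = zer"
    by (intro mu_spec[OF \<zeta>(1), of e' h "x \<bullet> n"]) (simp_all add: e'_def \<zeta>(2))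
  moreover have *: "val e' mu_tm \<bullet> h \<in> D N" by simp
  ultimately obtain k where "k \<in> D N" "Pairn \<bullet> k \<bullet> (x \<bullet> k) = Pairn \<bullet> n \<bullet> (val e' mu_tm \<bullet> h)"
    using h_eq[OF *] f[of "Pairn \<bullet> n \<bullet> (val e' mu_tm \<bullet> h)"] by auto
  then have "x \<bullet> n = val e' mu_tm \<bullet> h"
    using Pair_inj[of k "x \<bullet> k" n "val e' mu_tm \<bullet> h"] * by auto
  then show "val e dec_tm \<bullet> f \<bullet> n = x \<bullet> n"
    by (simp add: dec_tm_def e'_def h_def)
qed

lemma enc_spec:
  assumes \<zeta>: "Ncc \<zeta>" "e (two \<leadsto> one) 0 = \<zeta>" and e [simp]: "env e"
    and [simp]: "x \<in> D one"
  shows "\<exists>f. bin f \<and> (\<forall>p\<in>D N. f \<bullet> p = zer \<longleftrightarrow> (\<exists>n\<in>D N. Pairn \<bullet> n \<bullet> (x \<bullet> n) = p))"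
proof (intro exI conjI ballI)
  let ?f = "val (ins one 0 x e) enc_tm"
  have *: "(?f \<bullet> p = zer \<or> ?f \<bullet> p = uno) \<and> (?f \<bullet> p = zer \<longleftrightarrow> (\<exists>n\<in>D N. Pairn \<bullet> n \<bullet> (x \<bullet> n) = p))"
    if [simp]: "p \<in> D N" for p
  proof -
    define e' where "e' = ins N 0 p (ins one 0 x e)"
    have e' [simp]: "env e'" by (simp add: e'_def)
    define h where "h = val e' enc_fun_tm"
    have h [simp]: "h \<in> D one" unfolding h_def by (rule val_D) simp_all
    have h_eq: "h \<bullet> n = Eqt \<bullet> (Pairn \<bullet> n \<bullet> (x \<bullet> n)) \<bullet> p" if "n \<in> D N" for n
      unfolding h_def e'_def enc_fun_tm_def using that by simp
    have f: "?f \<bullet> p = h \<bullet> (val e' mu_tm \<bullet> h)"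
      unfolding enc_tm_def by (simp add: h_def e'_def)
    have m [simp]: "val e' mu_tm \<bullet> h \<in> D N" by simp
    have "?f \<bullet> p = zer \<or> ?f \<bullet> p = uno"
      unfolding f h_eq[OF m] by (subst (1 2) Eqt_sub) (simp_all add: Sg_01)
    moreover have "\<exists>n\<in>D N. Pairn \<bullet> n \<bullet> (x \<bullet> n) = p" if "?f \<bullet> p = zer"
      using that unfolding f h_eq[OF m] by (subst (asm) Eqt_zero_iff) (auto intro: m)
    moreover have "?f \<bullet> p = zer" if n: "n \<in> D N" "Pairn \<bullet> n \<bullet> (x \<bullet> n) = p" for n
    proof -
      have "h \<bullet> n = zer" unfolding h_eq[OF n(1)] using n by (simp add: Eqt_zero_iff)
      then show ?thesis unfolding f
        by (intro mu_spec[OF \<zeta>(1), of e' h n]) (use n in \<open>simp_all add: e'_def \<zeta>(2)\<close>)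
    qed
    ultimately show ?thesis by blast
  qed
  then have "\<forall>p\<in>D N. ?f \<bullet> p = zer \<or> ?f \<bullet> p = uno" by blast
  then show "bin ?f" unfolding bin_def by simp
  show "?f \<bullet> p = zer \<longleftrightarrow> (\<exists>n\<in>D N. Pairn \<bullet> n \<bullet> (x \<bullet> n) = p)" if "p \<in> D N" for p
    using * that by blast
qed

definition "OneFun = val e0 one_fun_tm"

lemma val_one_fun [simp]: "val e one_fun_tm = OneFun"
  unfolding OneFun_def by (rule val_closed) simp

lemma OneFun_D [simp]: "OneFun \<in> D two"
  unfolding OneFun_def by (rule val_D) simp_all

lemma OneFun_eq: "g \<in> D one \<Longrightarrow> OneFun \<bullet> g = uno"
  unfolding OneFun_def one_fun_tm_def by simp

lemma Exists3_of_Ncc: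
  assumes \<zeta>: "Ncc \<zeta>" and \<zeta>D [simp]: "\<zeta> \<in> D (two \<leadsto> one)"
  shows "\<exists>E\<in>D three. Exists3 E"
proof
  let ?e = "ins (two \<leadsto> one) 0 \<zeta> e0"
  show "val ?e exists3_tm \<in> D three" by (rule val_D) simp_all
  define m0 where "m0 = \<zeta> \<bullet> OneFun \<bullet> zer"
  have m0 [simp]: "m0 \<in> D N" by (simp add: m0_def)
  have key: "(val ?e exists3_tm \<bullet> Z = zer \<or> val ?e exists3_tm \<bullet> Z = uno) \<and>
      (val ?e exists3_tm \<bullet> Z = zer \<longleftrightarrow> (\<exists>x\<in>D one. Z \<bullet> x = zer))" if Z [simp]: "Z \<in> D two" for Z
  proof -
    define e where "e = ins two 0 Z ?e"
    have e [simp]: "env e" by (simp add: e_def)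
    have e_simps [simp]: "e (two \<leadsto> one) 0 = \<zeta>" "e two 0 = Z" by (simp_all add: e_def)
    define Y where "Y = val e guard_tm"
    have Y [simp]: "Y \<in> D two" unfolding Y_def by (rule val_D) simp_all
    define tail where "tail g = val (ins one 0 g e) tail2_tm" for g
    define dec where "dec g = val (ins one 0 g e) dec_tm \<bullet> tail g" for g
    have tail_D [simp]: "tail g \<in> D one" if "g \<in> D one" for g
      unfolding tail_def by (rule val_D) (use that in simp_all)
    have dec_D [simp]: "dec g \<in> D one" if "g \<in> D one" for g
      unfolding dec_def by (rule ap_D[where \<rho> = one]) (use that in simp_all)
    have Y_eq: "Y \<bullet> g = Sg \<bullet> (Eqt \<bullet> (g \<bullet> zer) \<bullet> (m0 \<oplus> uno) \<oplus> Z \<bullet> dec g)" if "g \<in> D one" for g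
      using that dec_D[OF that] unfolding Y_def guard_tm_def
      by (simp add: base_tm_def m0_def dec_def tail_def)
    have Y_zero: "Y \<bullet> g = zer \<longleftrightarrow> g \<bullet> zer = m0 \<oplus> uno \<and> Z \<bullet> dec g = zer" if g: "g \<in> D one" for g
    proof -
      have "Y \<bullet> g = zer \<longleftrightarrow> Eqt \<bullet> (g \<bullet> zer) \<bullet> (m0 \<oplus> uno) \<oplus> Z \<bullet> dec g = zer"
        unfolding Y_eq[OF g] using g by (intro Sg_zero_iff) simp
      also have "\<dots> \<longleftrightarrow> Eqt \<bullet> (g \<bullet> zer) \<bullet> (m0 \<oplus> uno) = zer \<and> Z \<bullet> dec g = zer"
        using pl_eq_zero[of "Eqt \<bullet> (g \<bullet> zer) \<bullet> (m0 \<oplus> uno)" "Z \<bullet> dec g"] g by (auto simp: pl_zero)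
      finally show ?thesis using g by (simp add: Eqt_zero_iff)
    qed
    define c where "c = \<zeta> \<bullet> Y \<bullet> zer"
    have c [simp]: "c \<in> D N" by (simp add: c_def)
    have E: "val ?e exists3_tm \<bullet> Z = Nsg \<bullet> (Eqt \<bullet> c \<bullet> m0)"
      unfolding exists3_tm_def by (simp add: base_tm_def m0_def c_def Y_def e_def)
    have E1: "c \<noteq> m0 \<Longrightarrow> val ?e exists3_tm \<bullet> Z = zer"
      unfolding E by (rule Nsg_pos) (simp_all add: Eqt_zero_iff)
    have E2: "c = m0 \<Longrightarrow> val ?e exists3_tm \<bullet> Z = uno"
      unfolding E using Eqt_zero_iff[of m0 m0] by (simp add: Nsg_eq)
    have "c \<noteq> m0" if x: "x \<in> D one" "Z \<bullet> x = zer" for x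
    proof -
      obtain f where f: "bin f" "\<forall>p\<in>D N. f \<bullet> p = zer \<longleftrightarrow> (\<exists>n\<in>D N. Pairn \<bullet> n \<bullet> (x \<bullet> n) = p)"
        using enc_spec[OF \<zeta> _ e x(1)] by auto
      have f_D [simp]: "f \<in> D one" using f(1) by (simp add: bin_def)
      have "Arel Y n (m0 \<oplus> uno)" if n [simp]: "n \<in> D N" for n
      proof -
        let ?g = "Code f (m0 \<oplus> uno) n"
        have "tail ?g = f"
          by (rule fun_eqI[where \<rho> = N and \<tau> = N]) (simp_all add: tail_def tail2_tm_def Code_eq)
        then have "dec ?g = x" unfolding dec_def
          by (simp, intro dec_spec[OF \<zeta>]) (use x f in simp_all)
        then have "Y \<bullet> ?g = zer" using x by (simp add: Y_zero Code_eq)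
        then show ?thesis unfolding Arel_def using f(1) by blast
      qed
      moreover have "m0 \<oplus> uno \<in> D N" by simp
      ultimately have "\<forall>n\<in>D N. \<exists>m\<in>D N. Arel Y n m" by blast
      then have "Arel Y zer c" using \<zeta> unfolding Ncc_def c_def by simp
      then obtain f where "f \<in> D one" "Y \<bullet> Code f c zer = zer" unfolding Arel_def bin_def by blast
      then have "c = m0 \<oplus> uno" by (simp add: Y_zero Code_eq)
      then show ?thesis using less_suc[of m0] less_irrefl[of m0] by auto
    qed
    moreover have "c = m0" if none: "\<not> (\<exists>x\<in>D one. Z \<bullet> x = zer)"
    proof -
      have "Y = OneFun"
      proof (rule fun_eqI[where \<rho> = one and \<tau> = N])
        fix g assume g: "g \<in> D one"
        then have "Y \<bullet> g \<noteq> zer" using none by (simp add: Y_zero)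
        moreover have "Y \<bullet> g = zer \<or> Y \<bullet> g = uno" unfolding Y_eq[OF g] by (rule Sg_01) (use g in simp)
        ultimately show "Y \<bullet> g = OneFun \<bullet> g" by (simp add: OneFun_eq g)
      qed simp_all
      then show ?thesis by (simp add: c_def m0_def)
    qed
    ultimately show ?thesis using E1 E2 one_neq_zero by (cases "c = m0") auto
  qed
  have "val ?e exists3_tm \<bullet> Z \<prec> uno \<or> val ?e exists3_tm \<bullet> Z = uno" if "Z \<in> D two" for Z
    using key[OF that, THEN conjunct1] by (elim disjE) (simp_all add: zero_less_one)
  moreover have "(\<exists>x\<in>D one. Z \<bullet> x = zer) \<longleftrightarrow> val ?e exists3_tm \<bullet> Z = zer" if "Z \<in> D two" for Z
    using key[OF that, THEN conjunct2] by (rule sym)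
  ultimately show "Exists3 (val ?e exists3_tm)" unfolding Exists3_def by blast
qed

section \<open>From exists3 to a zeta-functional in models\<close>

lemma sg_fun:
  assumes "env e" "e one 0 = f" "f \<in> D one"
  shows "bin (val e sg_fun_tm)" "bin f \<Longrightarrow> val e sg_fun_tm = f"
proof -
  have *: "val e sg_fun_tm \<bullet> i = Sg \<bullet> (f \<bullet> i)" if "i \<in> D N" for i
    using that assms unfolding sg_fun_tm_def by simp
  have "val e sg_fun_tm \<in> D one" by (rule val_D) (simp_all add: assms)
  moreover have "Sg \<bullet> (f \<bullet> i) = zer \<or> Sg \<bullet> (f \<bullet> i) = uno" if "i \<in> D N" for i
    by (rule Sg_01) (use that assms(3) in simp)
  ultimately show "bin (val e sg_fun_tm)" unfolding bin_def using * by simp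
  assume "bin f"
  then have "Sg \<bullet> (f \<bullet> i) = f \<bullet> i" if "i \<in> D N" for i
    using that by (intro Sg_id) (simp add: bin_def)
  with * have "val e sg_fun_tm \<bullet> i = f \<bullet> i" if "i \<in> D N" for i using that by simp
  then show "val e sg_fun_tm = f"
    by (rule fun_eqI[OF \<open>val e sg_fun_tm \<in> D one\<close> assms(3)])
qed

lemma test_spec:
  assumes E: "Exists3 (e three 0)" and e [simp]: "env e" and ty: "has_ty m N" "has_ty n N"
  shows "val e (test_tm m n) = zer \<longleftrightarrow> Arel (e two 0) (val e n) (val e m)"
proof -
  let ?t = "lam one (Var two 0 \<cdot> code_tm sg_fun_tm (lift one 0 m) (lift one 0 n))"
  have ty': "has_ty (lift one 0 m) N" "has_ty (lift one 0 n) N" using ty by (simp_all add: has_ty_lift)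
  have G: "val e ?t \<in> D two" by (rule val_D) (use ty' in simp_all)
  have G_eq: "val e ?t \<bullet> f = e two 0 \<bullet> Code (val (ins one 0 f e) sg_fun_tm) (val e m) (val e n)"
    if "f \<in> D one" for f using that ty' by simp
  have "val e (test_tm m n) = zer \<longleftrightarrow> (\<exists>f\<in>D one. val e ?t \<bullet> f = zer)"
    using E G unfolding Exists3_def test_tm_def val.simps by blast
  also have "\<dots> \<longleftrightarrow> Arel (e two 0) (val e n) (val e m)"
  proof
    assume "\<exists>f\<in>D one. val e ?t \<bullet> f = zer"
    then obtain f where f: "f \<in> D one" "val e ?t \<bullet> f = zer" by blast
    have "bin (val (ins one 0 f e) sg_fun_tm)" by (rule sg_fun(1)) (use f(1) in simp_all)
    with f(2) show "Arel (e two 0) (val e n) (val e m)"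
      unfolding Arel_def G_eq[OF f(1)] by blast
  next
    assume "Arel (e two 0) (val e n) (val e m)"
    then obtain f where f: "bin f" "e two 0 \<bullet> Code f (val e m) (val e n) = zer"
      unfolding Arel_def by blast
    then have f_D: "f \<in> D one" by (simp add: bin_def)
    have "val (ins one 0 f e) sg_fun_tm = f" by (rule sg_fun(2)[OF _ _ f_D f(1)]) (use f_D in simp_all)
    with f(2) have "val e ?t \<bullet> f = zer" unfolding G_eq[OF f_D] by simp
    with f_D show "\<exists>f\<in>D one. val e ?t \<bullet> f = zer" by blast
  qed
  finally show ?thesis .
qed

lemma Ncc_of_Exists3:
  assumes E: "Exists3 E" and ED [simp]: "E \<in> D three"
  shows "\<exists>\<zeta>\<in>D (two \<leadsto> one). Ncc \<zeta>"
proof -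
  let ?e = "ins three 0 E e0"
  \<comment> \<open>As \<open>E\<close> quantifies over functions, the premise that \<open>h\<close>
    has a zero is expressed as a zero of the functional taking \<open>g\<close> to
    \<open>h(g(0))\<close>. With \<open>E\<close> as a parameter the formula is quantifier-free, as
    QF-AC demands.\<close>
  define \<phi> where "\<phi> = Imp (Eq (Var three 0 \<cdot> lam one (Var one (Suc 0) \<cdot> (Var one 0 \<cdot> zero_tm))) zero_tm)
    (Eq (Var one 0 \<cdot> Var N 0) zero_tm)"
  define G where "G h = val (ins one 0 h ?e) (lam one (Var one (Suc 0) \<cdot> (Var one 0 \<cdot> zero_tm)))" for h
  have G: "G h \<in> D two" if "h \<in> D one" for h
    unfolding G_def by (rule val_D) (use that in simp_all)
  have G_eq: "G h \<bullet> g = h \<bullet> (g \<bullet> zer)" if "h \<in> D one" "g \<in> D one" for h g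
    unfolding G_def using that by simp
  have G_env: "val (ins N 0 m (ins one 0 h ?e)) (lam one (Var one (Suc 0) \<cdot> (Var one 0 \<cdot> zero_tm))) = G h"
    if "h \<in> D one" "m \<in> D N" for h m
    unfolding G_def by (rule fun_eqI[where \<rho> = one and \<tau> = N]) (use that in simp_all)
  have sat_\<phi>: "sat (ins N 0 m (ins one 0 h ?e)) \<phi> \<longleftrightarrow> (E \<bullet> G h = zer \<longrightarrow> h \<bullet> m = zer)"
    if "h \<in> D one" "m \<in> D N" for h m
    using that by (simp add: \<phi>_def G_env)
  have wf_\<phi>: "qf \<phi>" "wff \<phi>" by (simp_all add: \<phi>_def)
  have E_iff: "(\<exists>f\<in>D one. Y \<bullet> f = zer) \<longleftrightarrow> E \<bullet> Y = zer" if "Y \<in> D two" for Y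
    using E that unfolding Exists3_def by blast
  have "\<exists>m\<in>D N. sat (ins N 0 m (ins one 0 h ?e)) \<phi>" if h: "h \<in> D one" for h
  proof (cases "E \<bullet> G h = zer")
    case True
    then obtain g where g: "g \<in> D one" "G h \<bullet> g = zer" using E_iff[OF G[OF h]] by blast
    then have "h \<bullet> (g \<bullet> zer) = zer" using G_eq[OF h g(1)] by simp
    moreover have D: "g \<bullet> zer \<in> D N" using g(1) by simp
    ultimately show ?thesis using sat_\<phi>[OF h D] by blast
  next
    case False
    \<comment> \<open>The premise of the implication fails, so any number will do; 0 is
      chosen.\<close>
    then show ?thesis using sat_\<phi>[OF h cst_D(1)] cst_D(1) by blast
  qed
  then have "\<exists>M\<in>D two. \<forall>h\<in>D one. sat (ins N 0 (M \<bullet> h) (ins one 0 h ?e)) \<phi>"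
    by (rule qf_choice[rotated 3]) (simp_all add: wf_\<phi>)
  then obtain M where M [simp]: "M \<in> D two"
    and sat_M: "\<And>h. h \<in> D one \<Longrightarrow> sat (ins N 0 (M \<bullet> h) (ins one 0 h ?e)) \<phi>" by blast
  have M_spec: "h \<bullet> (M \<bullet> h) = zer" if "h \<in> D one" "k \<in> D N" "h \<bullet> k = zer" for h k
  proof -
    \<comment> \<open>The constant function with value \<open>k\<close> presents the zero
      \<open>k\<close> of \<open>h\<close> to \<open>E\<close>.\<close>
    let ?g = "val (ins N 0 k e0) (lam N (Var N 1))"
    have g: "?g \<in> D one" by (rule val_D) (use that in simp_all)
    have "?g \<bullet> zer = k" using that by simp
    then have "G h \<bullet> ?g = zer" using G_eq[OF that(1) g] that(3) by simp
    then have "E \<bullet> G h = zer" using E_iff[OF G[OF that(1)]] g by blast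
    moreover have "M \<bullet> h \<in> D N" using that(1) by simp
    ultimately show ?thesis using sat_M[OF that(1)] sat_\<phi>[OF that(1)] by blast
  qed
  let ?e' = "ins two 0 M ?e"
  have "Ncc (val ?e' choice_tm)"
    unfolding Ncc_def
  proof (intro ballI impI)
    fix Y n assume Y [simp]: "Y \<in> D two" and ex: "\<forall>n\<in>D N. \<exists>m\<in>D N. Arel Y n m" and n [simp]: "n \<in> D N"
    define e where "e = ins N 0 n (ins two 0 Y ?e')"
    have e [simp]: "env e" by (simp add: e_def)
    define h where "h = val e (lam N (test_tm (Var N 0) (Var N 1)))"
    have h [simp]: "h \<in> D one" unfolding h_def by (rule val_D) simp_all
    have h_eq: "h \<bullet> m = zer \<longleftrightarrow> Arel Y n m" if "m \<in> D N" for m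
    proof -
      let ?e = "ins N 0 m e"
      have h: "h \<bullet> m = val ?e (test_tm (Var N 0) (Var N 1))"
        unfolding h_def using that by simp
      have e3: "?e three 0 = E" and e2: "?e two 0 = Y" and eN: "?e N 0 = m" "?e N 1 = n"
        by (simp_all add: e_def)
      have "val ?e (test_tm (Var N 0) (Var N 1)) = zer \<longleftrightarrow>
          Arel (?e two 0) (val ?e (Var N 1)) (val ?e (Var N 0))"
        by (rule test_spec) (use that E e3 in simp_all)
      then show ?thesis unfolding h e2 val.simps eN .
    qed
    obtain m where "m \<in> D N" "Arel Y n m" using ex n by blast
    then have "h \<bullet> (M \<bullet> h) = zer" by (intro M_spec[of h m]) (simp_all add: h_eq)
    then have "Arel Y n (M \<bullet> h)" by (simp add: h_eq)
    moreover have "val ?e' choice_tm \<bullet> Y \<bullet> n = M \<bullet> h"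
      unfolding choice_tm_def by (simp add: e_def h_def)
    ultimately show "Arel Y n (val ?e' choice_tm \<bullet> Y \<bullet> n)" by simp
  qed
  moreover have "val ?e' choice_tm \<in> D (two \<leadsto> one)" by (rule val_D) simp_all
  ultimately show ?thesis by (rule bexI)
qed

end

section \<open>The formal equivalence\<close>

lemma wff_A_fm:
  assumes "has_ty Y two" "has_ty n N" "has_ty m N"
  shows "wff (A_fm Y n m)"
  using has_ty_lift[OF assms(1), of one 0] has_ty_lift[OF assms(2), of one 0]
    has_ty_lift[OF assms(3), of one 0] by (simp add: A_fm_def)

theorem NCC_iff_exists3: "{} \<turnstile> Iff (Ex (two \<leadsto> one) NCC_fm) exists3_fm"
proof (rule completeness)
  fix D :: "ty \<Rightarrow> trm set" and ap cs lt e
  assume "rca_model D ap cs lt" and e: "struct.env D e"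
  then interpret rca_model D ap cs lt by simp
  have "sat e (Ex (two \<leadsto> one) NCC_fm) \<longleftrightarrow> (\<exists>\<zeta>\<in>D (two \<leadsto> one). Ncc \<zeta>)"
    using e by (simp add: sat_NCC_fm)
  with sat_exists3_fm[OF e] show "sat e (Iff (Ex (two \<leadsto> one) NCC_fm) exists3_fm)"
    unfolding sat.simps(4,6) using Exists3_of_Ncc Ncc_of_Exists3 by blast
qed (simp add: NCC_fm_def exists3_fm_def wff_A_fm)

section \<open>Evaluation of bracket abstractions\<close>

lemma le_ev_trans: "le_ev a b \<Longrightarrow> le_ev b c \<Longrightarrow> le_ev a c"
  unfolding le_ev_def by blast

text \<open>Evaluation is call-by-name, so an argument that is replaced with a larger one in the sense of
  \<open>le_ev\<close> is copied in the course of the evaluation. Hence the induction has to allow for the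
  replacement of several subterms at once.\<close>

inductive cong_le :: "otm \<Rightarrow> otm \<Rightarrow> bool" where
  refl: "cong_le a a"
| app: "cong_le a a' \<Longrightarrow> cong_le b b' \<Longrightarrow> cong_le (a \<odot> b) (a' \<odot> b')"
| step: "cong_le a b \<Longrightarrow> le_ev b c \<Longrightarrow> cong_le a c"

lemma cong_le_le_ev: "le_ev a b \<Longrightarrow> cong_le a b"
  by (rule cong_le.step[OF cong_le.refl])

text \<open>A term that is not an application can change at the root only, so the congruence
  collapses to \<open>le_ev\<close>.\<close>

lemma cong_le_head: "cong_le a x \<Longrightarrow> (\<And>b c. a \<noteq> b \<odot> c) \<Longrightarrow> le_ev a x"
  by (induction rule: cong_le.induct) (auto intro: le_ev_refl le_ev_trans)

text \<open>Replacements inside the two parts can be carried out first, which leaves one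
  \<open>le_ev\<close> at the root for the end.\<close>

lemma cong_le_App:
  "cong_le a x \<Longrightarrow> a = b \<odot> c \<Longrightarrow> \<exists>b' c'. cong_le b b' \<and> cong_le c c' \<and> le_ev (b' \<odot> c') x"
proof (induction rule: cong_le.induct)
  case (refl a)
  then show ?case using cong_le.refl le_ev_refl by blast
next
  case (app a a' b b')
  then show ?case using le_ev_refl by blast
next
  case (step a b c)
  then show ?case using le_ev_trans by blast
qed

text \<open>Each case sets the change at the root aside and applies it last by
  \<open>le_evD\<close>. Arguments copied by \<open>Sigma\<close> or \<open>Rec\<close> cause no
  trouble because the whole argument lists are related.\<close>

lemma ev_cong_le:
  "ev a bs v \<Longrightarrow> cong_le a a' \<Longrightarrow> list_all2 cong_le bs bs' \<Longrightarrow> ev a' bs' v"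
proof (induction arbitrary: a' bs' rule: ev.induct)
  case (ev_Ap a b cs v)
  obtain x y where xy: "cong_le a x" "cong_le b y" "le_ev (x \<odot> y) a'"
    using cong_le_App[OF ev_Ap.prems(1) HOL.refl] by blast
  have "ev x (y # bs') v" by (rule ev_Ap.IH[OF xy(1)]) (use xy(2) ev_Ap.prems(2) in simp)
  then have "ev (x \<odot> y) bs' v" by (rule ev.ev_Ap)
  then show ?case by (rule le_evD[OF xy(3)])
next
  case (ev_Num n)
  then show ?case by (auto intro: le_evD[OF cong_le_head] ev.ev_Num)
next
  case ev_Zero
  then show ?case by (auto intro: le_evD[OF cong_le_head] ev.ev_Zero)
next
  case ev_One
  then show ?case using le_evD[OF cong_le_head ev.ev_One] by auto
next
  case (ev_Plus a m b n)
  obtain x y where bs': "bs' = [x, y]" "cong_le a x" "cong_le b y"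
    using ev_Plus.prems(2) by (auto simp: list_all2_Cons1)
  have "ev (OC Plus) bs' (m + n)" unfolding bs'(1)
    by (rule ev.ev_Plus[OF ev_Plus.IH(1)[OF bs'(2)] ev_Plus.IH(2)[OF bs'(3)]]) simp_all
  then show ?case by (rule le_evD[OF cong_le_head[OF ev_Plus.prems(1)], rotated]) simp
next
  case (ev_Times a m b n)
  obtain x y where bs': "bs' = [x, y]" "cong_le a x" "cong_le b y"
    using ev_Times.prems(2) by (auto simp: list_all2_Cons1)
  have "ev (OC Times) bs' (m * n)" unfolding bs'(1)
    by (rule ev.ev_Times[OF ev_Times.IH(1)[OF bs'(2)] ev_Times.IH(2)[OF bs'(3)]]) simp_all
  then show ?case by (rule le_evD[OF cong_le_head[OF ev_Times.prems(1)], rotated]) simp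
next
  case (ev_Pi a cs v \<rho> \<sigma> b)
  obtain x y zs where bs': "bs' = x # y # zs" "cong_le a x" "list_all2 cong_le cs zs"
    using ev_Pi.prems(2) by (auto simp: list_all2_Cons1)
  have "ev (OC (Pi \<rho> \<sigma>)) bs' v" unfolding bs'(1)
    by (rule ev.ev_Pi[OF ev_Pi.IH[OF bs'(2,3)]])
  then show ?case by (rule le_evD[OF cong_le_head[OF ev_Pi.prems(1)], rotated]) simp
next
  case (ev_Sigma a c b cs v \<rho> \<sigma> \<tau>)
  obtain x y z zs where bs': "bs' = x # y # z # zs" "cong_le a x" "cong_le b y" "cong_le c z"
      "list_all2 cong_le cs zs"
    using ev_Sigma.prems(2) by (auto simp: list_all2_Cons1)
  have "ev x (z # (y \<odot> z) # zs) v"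
    by (rule ev_Sigma.IH[OF bs'(2)]) (use bs' in \<open>simp add: cong_le.app\<close>)
  then have "ev (OC (Sigma \<rho> \<sigma> \<tau>)) bs' v" unfolding bs'(1) by (rule ev.ev_Sigma)
  then show ?case by (rule le_evD[OF cong_le_head[OF ev_Sigma.prems(1)], rotated]) simp
next
  case (ev_Rec_0 n a cs v \<rho> f)
  obtain x y z zs where bs': "bs' = x # y # z # zs" "cong_le f x" "cong_le a y" "cong_le n z"
      "list_all2 cong_le cs zs"
    using ev_Rec_0.prems(2) by (auto simp: list_all2_Cons1)
  have "ev z [] 0" by (rule ev_Rec_0.IH(1)[OF bs'(4)]) simp
  then have "ev (OC (Rec \<rho>)) bs' v" unfolding bs'(1)
    by (rule ev.ev_Rec_0[OF _ ev_Rec_0.IH(2)[OF bs'(3,5)]])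
  then show ?case by (rule le_evD[OF cong_le_head[OF ev_Rec_0.prems(1)], rotated]) simp
next
  case (ev_Rec_Suc n k f \<rho> a cs v)
  obtain x y z zs where bs': "bs' = x # y # z # zs" "cong_le f x" "cong_le a y" "cong_le n z"
      "list_all2 cong_le cs zs"
    using ev_Rec_Suc.prems(2) by (auto simp: list_all2_Cons1)
  have "ev z [] (Suc k)" by (rule ev_Rec_Suc.IH(1)[OF bs'(4)]) simp
  moreover have "ev x (Num k # (OC (Rec \<rho>) \<odot> x \<odot> y \<odot> Num k) # zs) v"
    by (rule ev_Rec_Suc.IH(2)[OF bs'(2)])
      (use bs' in \<open>simp add: cong_le.app cong_le.refl\<close>)
  ultimately have "ev (OC (Rec \<rho>)) bs' v" unfolding bs'(1) by (rule ev.ev_Rec_Suc)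
  then show ?case by (rule le_evD[OF cong_le_head[OF ev_Rec_Suc.prems(1)], rotated]) simp
next
  case (ev_F1 a n v f)
  obtain x where bs': "bs' = [x]" "cong_le a x"
    using ev_F1.prems(2) by (auto simp: list_all2_Cons1)
  have "ev x [] n" by (rule ev_F1.IH[OF bs'(2)]) simp
  then have "ev (F1 f) bs' v" unfolding bs'(1) by (rule ev.ev_F1) (rule ev_F1.hyps)
  then show ?case by (rule le_evD[OF cong_le_head[OF ev_F1.prems(1)], rotated]) simp
next
  case (ev_F2 a g v Y)
  obtain x where bs': "bs' = [x]" "cong_le a x"
    using ev_F2.prems(2) by (auto simp: list_all2_Cons1)
  have "\<forall>n. ev x [Num n] (g n)"
    using ev_F2.IH bs'(2) by (simp add: cong_le.refl)
  then have "ev (F2 Y) bs' v" unfolding bs'(1) by (rule ev.ev_F2) (rule ev_F2.hyps)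
  then show ?case by (rule le_evD[OF cong_le_head[OF ev_F2.prems(1)], rotated]) simp
next
  case (ev_F3 a Y v E)
  obtain x where bs': "bs' = [x]" "cong_le a x"
    using ev_F3.prems(2) by (auto simp: list_all2_Cons1)
  have "\<forall>f. ev x [F1 f] (Y f)"
    using ev_F3.IH bs'(2) by (simp add: cong_le.refl)
  then have "ev (F3 E) bs' v" unfolding bs'(1) by (rule ev.ev_F3) (rule ev_F3.hyps)
  then show ?case by (rule le_evD[OF cong_le_head[OF ev_F3.prems(1)], rotated]) simp
next
  case (ev_F21 a Y b n v \<zeta>)
  obtain x y where bs': "bs' = [x, y]" "cong_le a x" "cong_le b y"
    using ev_F21.prems(2) by (auto simp: list_all2_Cons1)
  have "\<forall>f. ev x [F1 f] (Y f)"
    using ev_F21.IH(1) bs'(2) by (simp add: cong_le.refl)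
  moreover have "ev y [] n" by (rule ev_F21.IH(2)[OF bs'(3)]) simp
  ultimately have "ev (F21 \<zeta>) bs' v" unfolding bs'(1) by (rule ev.ev_F21) (rule ev_F21.hyps)
  then show ?case by (rule le_evD[OF cong_le_head[OF ev_F21.prems(1)], rotated]) simp
qed

lemma ev_arg_le: "ev a (b # cs) v \<Longrightarrow> le_ev b b' \<Longrightarrow> ev a (b' # cs) v"
  by (erule ev_cong_le) (simp_all add: cong_le.refl cong_le_le_ev list_all2_refl)

text \<open>Values of functions are known at numerals, while call-by-name evaluation meets compound
  arguments such as \<open>F1 f \<odot> OC Zero\<close>. A numeral is below every term with its
  value.\<close>

lemma ev_arg:
  assumes "ev a (Num n # cs) v" "ev b [] n"
  shows "ev a (b # cs) v"
proof (rule ev_arg_le[OF assms(1)])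
  show "le_ev (Num n) b" unfolding le_ev_def using assms(2) by (auto elim: ev_NumE)
qed

text \<open>Unlike \<open>emb\<close>, this treats open terms: the environment holds the arguments
  that abstractions have received so far, as \<open>ev_lam\<close> requires.\<close>

fun embe :: "(ty \<Rightarrow> nat \<Rightarrow> otm) \<Rightarrow> trm \<Rightarrow> otm" where
  "embe e (Var \<rho> i) = e \<rho> i"
| "embe e (Cst c) = OC c"
| "embe e (s \<cdot> t) = embe e s \<odot> embe e t"

lemma embe_closed: "closed_trm t \<Longrightarrow> embe e t = emb t"
  by (induction t) auto

lemma embe_lift [simp]: "embe (ins \<rho> k x e) (lift \<rho> k t) = embe e t"
  by (induction t) (auto simp: ins_def)

text \<open>For an application, \<open>Sigma\<close> supplies the abstracted argument applied to
  \<open>b\<close>, where the instantiated body has its instantiated argument. Monotonicity in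
  arguments bridges the two; this is the use of \<open>ev_cong_le\<close>.\<close>

lemma le_ev_lam: "le_ev (embe (ins \<rho> 0 b e) t) (embe e (lam \<rho> t) \<odot> b)"
proof (induction t)
  case (Var \<sigma> i)
  show ?case
    by (cases "\<sigma> = \<rho> \<and> i = 0")
      (auto simp: le_ev_def ev_Ap_iff ins_def lam.simps intro!: ev_Sigma ev_Pi)
next
  case (Cst c)
  show ?case by (simp add: le_ev_def ev_Ap_iff lam.simps ev_Pi)
next
  case (App s t)
  show ?case unfolding le_ev_def
  proof (intro allI impI)
    fix cs v assume "ev (embe (ins \<rho> 0 b e) (s \<cdot> t)) cs v"
    then have "ev (embe (ins \<rho> 0 b e) s) (embe (ins \<rho> 0 b e) t # cs) v" by (simp add: ev_Ap_iff)
    then have "ev (embe e (lam \<rho> s) \<odot> b) (embe (ins \<rho> 0 b e) t # cs) v" by (rule le_evD[OF App.IH(1)])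
    then have "ev (embe e (lam \<rho> s) \<odot> b) ((embe e (lam \<rho> t) \<odot> b) # cs) v"
      by (rule ev_arg_le) (rule App.IH(2))
    then show "ev (embe e (lam \<rho> (s \<cdot> t)) \<odot> b) cs v"
      by (simp add: ev_Ap_iff lam.simps ev_Sigma)
  qed
qed

lemma ev_lam: "ev (embe (ins \<rho> 0 b e) t) cs v \<Longrightarrow> ev (embe e (lam \<rho> t)) (b # cs) v"
  using le_evD[OF le_ev_lam] by (simp add: ev_Ap_iff)

section \<open>Values of the closed terms\<close>

lemma emb_tms [simp]:
  "embe e pred_tm = emb pred_tm" "embe e sg_tm = emb sg_tm" "embe e nsg_tm = emb nsg_tm"
  "embe e pred_step_tm = emb pred_step_tm" "embe e sub_tm = emb sub_tm" "embe e eqt_tm = emb eqt_tm"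
  "embe e pair_tm = emb pair_tm"
  by (simp_all add: embe_closed)

lemma emb_embe: "closed_trm t \<Longrightarrow> emb t = embe (\<lambda>_ _. OC Zero) t"
  by (simp add: embe_closed)

lemma ev_Rec_case:
  assumes "ev n [] k" "k = 0 \<Longrightarrow> ev a cs v"
    "\<And>j. k = Suc j \<Longrightarrow> ev f (Num j # (OC (Rec \<rho>) \<odot> f \<odot> a \<odot> Num j) # cs) v"
  shows "ev (OC (Rec \<rho>)) (f # a # n # cs) v"
  using assms by (cases k) (auto intro: ev_Rec_0 ev_Rec_Suc)

lemma ev_pred: "ev a [] n \<Longrightarrow> ev (emb pred_tm) [a] (n - 1)"
  by (subst emb_embe, simp)
    (auto simp: pred_tm_def ev_Ap_iff intro!: ev_Rec_case[of _ n] ev_lam ev_Zero ev_Num)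

lemma ev_sg: "ev a [] n \<Longrightarrow> ev (emb sg_tm) [a] (if n = 0 then 0 else 1)"
  by (subst emb_embe, simp)
    (auto simp: sg_tm_def ev_Ap_iff intro!: ev_Rec_case[of _ n] ev_lam ev_Zero ev_One[unfolded One_nat_def])

lemma ev_nsg: "ev a [] n \<Longrightarrow> ev (emb nsg_tm) [a] (if n = 0 then 1 else 0)"
  by (subst emb_embe, simp)
    (auto simp: nsg_tm_def ev_Ap_iff intro!: ev_Rec_case[of _ n] ev_lam ev_Zero ev_One[unfolded One_nat_def])

lemma ev_pred_step: "ev a [] n \<Longrightarrow> ev (emb pred_step_tm) [b, a] (n - 1)"
proof -
  assume a: "ev a [] n"
  have "ev (embe e (lam N (lam N (pred_tm \<cdot> Var N 0)))) [b, a] (n - 1)" for e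
    by (intro ev_lam) (use ev_pred[OF a] in \<open>simp add: ev_Ap_iff\<close>)
  then show ?thesis unfolding pred_step_tm_def[symmetric] by simp
qed

text \<open>The recursion replaces \<open>b\<close> by the numeral of its predecessor, so
  \<open>b\<close> has to be arbitrary in the induction.\<close>

lemma ev_sub_Rec:
  "ev a [] m \<Longrightarrow> ev b [] n \<Longrightarrow> ev (OC (Rec N)) [emb pred_step_tm, a, b] (m - n)"
proof (induction n arbitrary: b)
  case 0
  then show ?case by (auto intro: ev_Rec_0)
next
  case (Suc n)
  have "ev (OC (Rec N) \<odot> emb pred_step_tm \<odot> a \<odot> Num n) [] (m - n)"
    using Suc.IH[OF Suc.prems(1) ev_Num[of n]] by (simp add: ev_Ap_iff)
  from ev_pred_step[OF this, of "Num n"] show ?case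
    by (intro ev_Rec_Suc[OF Suc.prems(2)]) simp
qed

lemma ev_sub: "ev a [] m \<Longrightarrow> ev b [] n \<Longrightarrow> ev (emb sub_tm) [a, b] (m - n)"
proof -
  assume a: "ev a [] m" "ev b [] n"
  have "ev (embe e (lam N (lam N (Cst (Rec N) \<cdot> pred_step_tm \<cdot> Var N 1 \<cdot> Var N 0)))) [a, b] (m - n)" for e
    by (intro ev_lam) (use ev_sub_Rec[OF a] in \<open>simp add: ev_Ap_iff\<close>)
  then show ?thesis unfolding sub_tm_def[symmetric] by simp
qed

lemma ev_eqt:
  assumes "ev a [] m" "ev b [] n"
  shows "ev (emb eqt_tm) [a, b] (if m = n then 0 else 1)"
proof -
  have "ev (OC Plus \<odot> (emb sub_tm \<odot> a \<odot> b) \<odot> (emb sub_tm \<odot> b \<odot> a)) [] ((m - n) + (n - m))"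
    unfolding ev_Ap_iff by (intro ev_Plus) (simp_all add: ev_Ap_iff ev_sub assms)
  from ev_sg[OF this] have "ev (embe e (lam N (lam N (sg_tm \<cdot> plus_tm (sub_tm \<cdot> Var N 1 \<cdot> Var N 0)
      (sub_tm \<cdot> Var N 0 \<cdot> Var N 1))))) [a, b] (if (m - n) + (n - m) = 0 then 0 else 1)" for e
    by (intro ev_lam) (simp add: ev_Ap_iff)
  moreover have "(m - n) + (n - m) = 0 \<longleftrightarrow> m = n" by auto
  ultimately show ?thesis unfolding eqt_tm_def[symmetric] by simp
qed

lemma ev_pair:
  assumes "ev a [] m" "ev b [] n"
  shows "ev (emb pair_tm) [a, b] ((m + n) * (m + n) + n)"
proof -
  have "ev (embe e (lam N (lam N (plus_tm (times_tm (plus_tm (Var N 1) (Var N 0))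
      (plus_tm (Var N 1) (Var N 0))) (Var N 0))))) [a, b] ((m + n) * (m + n) + n)" for e
    by (intro ev_lam) (simp add: ev_Ap_iff ev_Plus ev_Times assms)
  then show ?thesis unfolding pair_tm_def[symmetric] by simp
qed

lemma ev_Plus_Ap: "ev a [] m \<Longrightarrow> ev b [] n \<Longrightarrow> ev (OC Plus \<odot> a \<odot> b) [] (m + n)"
  by (simp add: ev_Ap_iff ev_Plus)

lemma ev_suc: "ev a [] m \<Longrightarrow> ev (OC Plus \<odot> a \<odot> OC One) [] (Suc m)"
  using ev_Plus_Ap[OF _ ev_One] by simp

lemma ev_cons:
  assumes "ev (embe e m) [] x" "\<And>n. ev (embe e f) [Num n] (F n)"
  shows "ev (embe e (cons_tm m f)) [Num i] (case i of 0 \<Rightarrow> x | Suc j \<Rightarrow> F j)"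
  by (auto simp: cons_tm_def ev_Ap_iff assms intro!: ev_Rec_case[OF ev_Num] ev_lam)

lemma ev_code:
  assumes "ev (embe e m) [] x" "ev (embe e n) [] y" "\<And>i. ev (embe e f) [Num i] (F i)"
  shows "ev (embe e (code_tm f m n)) [Num i] (code F x y i)"
  unfolding code_tm_def code_def by (intro ev_cons assms)

lemma below_lift: "below d t \<Longrightarrow> below (d(\<rho> := Suc (d \<rho>))) (lift \<rho> k t)"
  by (induction t) auto

lemma below_cons: "below d m \<Longrightarrow> below d f \<Longrightarrow> below d (cons_tm m f)"
  unfolding cons_tm_def below.simps
  by (intro conjI TrueI below_lam) (simp_all add: below_lift[THEN below_lift, of d f N N, simplified])

lemma below_code: "below d f \<Longrightarrow> below d m \<Longrightarrow> below d n \<Longrightarrow> below d (code_tm f m n)"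
  unfolding code_tm_def by (intro below_cons)

lemma below_test:
  "0 < d three \<Longrightarrow> 0 < d two \<Longrightarrow> below d m \<Longrightarrow> below d n \<Longrightarrow> below d (test_tm m n)"
  unfolding test_tm_def sg_fun_tm_def below.simps
  by (intro conjI below_lam) (simp_all add: below_code below_lift below_lam below_closed)

section \<open>Computing a \<open>\<zeta>\<close>-functional\<close>

definition sgn01 :: "fun1 \<Rightarrow> fun1" where
  "sgn01 f i = (if f i = 0 then 0 else 1)"

definition test :: "fun3 \<Rightarrow> fun2 \<Rightarrow> nat \<Rightarrow> nat \<Rightarrow> nat" where
  "test E Y m n = E (\<lambda>f. Y (code (sgn01 f) m n))"

lemma is_exists3D: "is_exists3 E \<Longrightarrow> (\<exists>f. Y f = 0) \<longleftrightarrow> E Y = 0"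
  unfolding is_exists3_def by (elim conjE allE)

lemma test_zero_iff:
  assumes "is_exists3 E"
  shows "test E Y m n = 0 \<longleftrightarrow> A_rel Y n m"
proof -
  have "test E Y m n = 0 \<longleftrightarrow> (\<exists>f. Y (code (sgn01 f) m n) = 0)"
    using is_exists3D[OF assms, symmetric] unfolding test_def .
  also have "\<dots> \<longleftrightarrow> A_rel Y n m"
  proof
    assume "\<exists>f. Y (code (sgn01 f) m n) = 0"
    then obtain f where "Y (code (sgn01 f) m n) = 0" by blast
    moreover have "range (sgn01 f) \<subseteq> {0, 1}" by (auto simp: sgn01_def)
    ultimately show "A_rel Y n m" unfolding A_rel_def by blast
  next
    assume "A_rel Y n m"
    then obtain f where f: "range f \<subseteq> {0, 1}" "Y (code f m n) = 0" unfolding A_rel_def by blast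
    have "sgn01 f i = f i" for i
    proof -
      have "f i \<in> {0, 1}" using f(1) by blast
      then show ?thesis unfolding sgn01_def by auto
    qed
    then have "sgn01 f = f" by (rule ext)
    then have "Y (code (sgn01 f) m n) = 0" using f(2) by simp
    then show "\<exists>f. Y (code (sgn01 f) m n) = 0" by blast
  qed
  finally show ?thesis .
qed

lemma ev_test:
  assumes e: "e three 0 = F3 E" "e two 0 = F2 Y" and mn: "ev (embe e m) [] x" "ev (embe e n) [] y"
  shows "ev (embe e (test_tm m n)) [] (test E Y x y)"
proof -
  have "ev (embe (ins one 0 (F1 f) e) (code_tm sg_fun_tm (lift one 0 m) (lift one 0 n))) [Num i]
      (code (sgn01 f) x y i)" for f i
  proof (rule ev_code)
    fix i
    show "ev (embe (ins one 0 (F1 f) e) sg_fun_tm) [Num i] (sgn01 f i)"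
      unfolding sg_fun_tm_def sgn01_def
      by (rule ev_lam) (use ev_sg[of "F1 f \<odot> Num i" "f i"] in \<open>simp add: ev_Ap_iff ev_F1[OF ev_Num]\<close>)
  qed (simp_all add: mn)
  then have "ev (embe e (lam one (Var two 0 \<cdot> code_tm sg_fun_tm (lift one 0 m) (lift one 0 n))))
      [F1 f] (Y (code (sgn01 f) x y))" for f
    by (intro ev_lam) (auto simp: e ev_Ap_iff intro!: ev_F2)
  then show ?thesis unfolding test_tm_def test_def by (auto simp: e ev_Ap_iff intro!: ev_F3)
qed

text \<open>The second factor vanishes if there is no \<open>m\<close> with \<open>A(n, m)\<close>, so that the search for a zero
  always ends.\<close>

definition search_tm :: trm where
  "search_tm = lam three (lam two (lam N (lam N (times_tm (test_tm (Var N 0) (Var N 1))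
     (nsg_tm \<cdot> (Var three 0 \<cdot> lam one (test_tm (Var one 0 \<cdot> zero_tm) (Var N 1))))))))"

lemma T_term_search: "T_term (three \<leadsto> two \<leadsto> N \<leadsto> N \<leadsto> N) search_tm"
proof -
  have "closed_trm search_tm"
    unfolding search_tm_def closed_below by (intro below_lam) (simp add: below_test below_closed below_lam)
  then show ?thesis unfolding T_term_def by (simp add: search_tm_def)
qed

definition search :: "fun3 \<Rightarrow> fun2 \<Rightarrow> nat \<Rightarrow> nat \<Rightarrow> nat" where
  "search E Y n m = test E Y m n * (if E (\<lambda>g. test E Y (g 0) n) = 0 then 1 else 0)"

lemma ev_search: "ev (emb search_tm \<odot> F3 E \<odot> F2 Y \<odot> Num n) [Num m] (search E Y n m)"
proof -
  define e where "e = ins N 0 (Num m) (ins N 0 (Num n) (ins two 0 (F2 Y) (ins three 0 (F3 E)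
    (\<lambda>_ _. OC Zero))))"
  have e: "e N 0 = Num m" "e N 1 = Num n" "e two 0 = F2 Y" "e three 0 = F3 E"
    by (simp_all add: e_def)
  have 1: "ev (embe e (test_tm (Var N 0) (Var N 1))) [] (test E Y m n)"
    by (rule ev_test) (simp_all add: e ev_Num flip: One_nat_def)
  have "ev (embe e (lam one (test_tm (Var one 0 \<cdot> zero_tm) (Var N 1)))) [F1 g] (test E Y (g 0) n)" for g
    by (intro ev_lam ev_test) (auto simp: e ev_Ap_iff intro!: ev_F1 ev_Zero ev_Num simp flip: One_nat_def)
  then have "ev (embe e (Var three 0 \<cdot> lam one (test_tm (Var one 0 \<cdot> zero_tm) (Var N 1)))) []
      (E (\<lambda>g. test E Y (g 0) n))"
    by (auto simp: e ev_Ap_iff intro!: ev_F3)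
  from ev_Times[OF 1 ev_Ap[OF ev_nsg[OF this]]]
  have "ev (embe e (times_tm (test_tm (Var N 0) (Var N 1))
     (nsg_tm \<cdot> (Var three 0 \<cdot> lam one (test_tm (Var one 0 \<cdot> zero_tm) (Var N 1)))))) [] (search E Y n m)"
    unfolding search_def by (simp only: embe.simps ev_Ap_iff emb_tms)
  then have "ev (embe (\<lambda>_ _. OC Zero) search_tm) [F3 E, F2 Y, Num n, Num m] (search E Y n m)"
    unfolding search_tm_def e_def by (intro ev_lam)
  moreover have "closed_trm search_tm" using T_term_search by (simp add: T_term_def)
  ultimately show ?thesis by (simp add: embe_closed ev_Ap_iff)
qed

text \<open>With \<open>g 0\<close> in place of \<open>m\<close>, \<open>E\<close> decides whether
  some \<open>m\<close> satisfies \<open>A(n, m)\<close>. In that case the second factor of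
  \<open>search\<close> is 1, and the zeros of the product are exactly these
  \<open>m\<close>.\<close>

lemma search_zero:
  assumes E: "is_exists3 E"
  shows "\<exists>m. search E Y n m = 0"
    and "A_rel Y n k \<Longrightarrow> search E Y n m = 0 \<Longrightarrow> A_rel Y n m"
proof -
  have *: "E (\<lambda>g. test E Y (g 0) n) = 0 \<longleftrightarrow> (\<exists>g :: fun1. A_rel Y n (g 0))"
    using is_exists3D[OF E, of "\<lambda>g. test E Y (g 0) n"] test_zero_iff[OF E] by simp
  show "\<exists>m. search E Y n m = 0"
  proof (cases "E (\<lambda>g. test E Y (g 0) n) = 0")
    case True
    then obtain g :: fun1 where "A_rel Y n (g 0)" using * by blast
    then have "search E Y n (g 0) = 0" unfolding search_def using test_zero_iff[OF E] by simp
    then show ?thesis by blast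
  next
    case False
    then have "search E Y n 0 = 0" by (simp add: search_def)
    then show ?thesis by blast
  qed
  assume "A_rel Y n k" and m: "search E Y n m = 0"
  then have "\<exists>g :: fun1. A_rel Y n (g 0)" by (intro exI[of _ "\<lambda>_. k"])
  then show "A_rel Y n m" using m * test_zero_iff[OF E] unfolding search_def by simp
qed

text \<open>The least zero of \<open>search\<close> exists for all \<open>Y\<close> and
  \<open>n\<close>, so the functional is total even where \<open>A(n, m)\<close> never
  holds.\<close>

lemma zeta_of_exists3:
  assumes E: "is_exists3 E"
  shows "\<exists>\<zeta>. NCC \<zeta> \<and> (\<forall>Y n. mu_ev (emb search_tm \<odot> F3 E \<odot> F2 Y \<odot> Num n) (\<zeta> Y n))"
proof (intro exI conjI allI)
  let ?\<zeta> = "\<lambda>Y n. LEAST m. search E Y n m = 0"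
  have 0: "search E Y n (?\<zeta> Y n) = 0" for Y n
    using search_zero(1)[OF E] by (rule LeastI_ex)
  show "NCC ?\<zeta>"
    unfolding NCC_def
  proof (intro allI impI)
    fix Y n assume "\<forall>n. \<exists>m. A_rel Y n m"
    then obtain k where "A_rel Y n k" by blast
    then show "A_rel Y n (?\<zeta> Y n)" using 0 by (rule search_zero(2)[OF E])
  qed
  fix Y n
  show "mu_ev (emb search_tm \<odot> F3 E \<odot> F2 Y \<odot> Num n) (?\<zeta> Y n)"
    unfolding mu_ev_def
  proof (intro conjI allI impI)
    show "ev (emb search_tm \<odot> F3 E \<odot> F2 Y \<odot> Num n) [Num (?\<zeta> Y n)] 0"
      using ev_search[of E Y n "?\<zeta> Y n"] unfolding 0 .
    fix i assume "i < ?\<zeta> Y n"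
    then have "search E Y n i \<noteq> 0" by (rule not_less_Least)
    then obtain k where "search E Y n i = Suc k" using not0_implies_Suc by blast
    then show "\<exists>k. ev (emb search_tm \<odot> F3 E \<odot> F2 Y \<odot> Num n) [Num i] (Suc k)"
      using ev_search[of E Y n i] by metis
  qed
qed

section \<open>Computing \<open>\<exists>\<^sup>3\<close>\<close>

text \<open>\<open>mu_fun\<close>, \<open>dec_fun\<close>, \<open>guard_fun\<close> and
  \<open>exists3_fun\<close> are the functions computed by the terms of like name. Correctness is
  argued about the functions; the evaluation lemmas then only match the terms with them.\<close>

definition mu_fun :: "(fun2 \<Rightarrow> fun1) \<Rightarrow> fun2" where
  "mu_fun \<zeta> h = \<zeta> (\<lambda>g. h (g 0)) 0"

definition dec_fun :: "(fun2 \<Rightarrow> fun1) \<Rightarrow> fun1 \<Rightarrow> fun1" where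
  "dec_fun \<zeta> f n = mu_fun \<zeta> (\<lambda>k. f ((n + k) * (n + k) + k))"

definition guard_fun :: "(fun2 \<Rightarrow> fun1) \<Rightarrow> fun2 \<Rightarrow> fun2" where
  "guard_fun \<zeta> Z g =
    (if g 0 = Suc (\<zeta> (\<lambda>_. 1) 0) \<and> Z (dec_fun \<zeta> (\<lambda>i. g (Suc (Suc i)))) = 0 then 0 else 1)"

definition exists3_fun :: "(fun2 \<Rightarrow> fun1) \<Rightarrow> fun3" where
  "exists3_fun \<zeta> Z = (if \<zeta> (guard_fun \<zeta> Z) 0 = \<zeta> (\<lambda>_. 1) 0 then 1 else 0)"

lemma mu_fun_zero:
  assumes "NCC \<zeta>" "h k = 0"
  shows "h (mu_fun \<zeta> h) = 0"
proof -
  have rel: "A_rel (\<lambda>g. h (g 0)) n m \<longleftrightarrow> h m = 0" for n m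
    unfolding A_rel_def code_def by (auto intro: exI[of _ "\<lambda>_. 0"])
  have "(\<forall>n::nat. \<exists>m. A_rel (\<lambda>g. h (g 0)) n m) \<longrightarrow> (\<forall>n. A_rel (\<lambda>g. h (g 0)) n (\<zeta> (\<lambda>g. h (g 0)) n))"
    using assms(1) unfolding NCC_def by (rule spec)
  then show ?thesis unfolding rel mu_fun_def using assms(2) by blast
qed

lemma pair_inj:
  assumes "(n + k) * (n + k) + k = (n' + k') * (n' + k') + (k' :: nat)"
  shows "n = n' \<and> k = k'"
proof -
  have less: "s * s + k < s' * s' + k'" if "s < s'" "k \<le> s" for s s' k k' :: nat
  proof -
    have "Suc s * Suc s \<le> s' * s'" using that(1) by (intro mult_le_mono) simp_all
    then show ?thesis using that(2) by simp
  qed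
  have "n + k = n' + k'"
    using less[of "n + k" "n' + k'" k k'] less[of "n' + k'" "n + k" k' k] assms
    by (metis le_add2 less_irrefl linorder_neqE_nat)
  then show ?thesis using assms by simp
qed

text \<open>The preimage vanishes exactly at the codes of the graph of \<open>x\<close>, so that
  \<open>x n\<close> is the only zero the search can return.\<close>

lemma dec_fun_surj:
  assumes "NCC \<zeta>"
  shows "\<exists>f. range f \<subseteq> {0, 1} \<and> dec_fun \<zeta> f = x"
proof (intro exI conjI ext)
  let ?f = "\<lambda>p. if \<exists>n. (n + x n) * (n + x n) + x n = p then 0 else 1 :: nat"
  show "range ?f \<subseteq> {0, 1}" by auto
  fix n
  let ?h = "\<lambda>k. ?f ((n + k) * (n + k) + k)"
  have "?h (x n) = 0" by auto
  with assms have "?h (mu_fun \<zeta> ?h) = 0" by (rule mu_fun_zero)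
  then obtain n' where "(n' + x n') * (n' + x n') + x n' =
      (n + mu_fun \<zeta> ?h) * (n + mu_fun \<zeta> ?h) + mu_fun \<zeta> ?h"
    by (auto split: if_splits)
  from pair_inj[OF this] show "dec_fun \<zeta> ?f n = x n" unfolding dec_fun_def by metis
qed

lemma is_exists3_exists3_fun:
  assumes \<zeta>: "NCC \<zeta>"
  shows "is_exists3 (exists3_fun \<zeta>)"
proof -
  have "(\<exists>x. Z x = 0) \<longleftrightarrow> \<zeta> (guard_fun \<zeta> Z) 0 \<noteq> \<zeta> (\<lambda>_. 1) 0" for Z
  proof
    let ?m = "\<zeta> (\<lambda>_. 1) 0"
    assume "\<exists>x. Z x = 0"
    then obtain x where x: "Z x = 0" by blast
    obtain f where f: "range f \<subseteq> {0, 1}" "dec_fun \<zeta> f = x" using dec_fun_surj[OF \<zeta>] by blast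
    have "guard_fun \<zeta> Z (code f (Suc ?m) n) = 0" for n
      by (simp add: guard_fun_def code_def f(2) x)
    then have "A_rel (guard_fun \<zeta> Z) n (Suc ?m)" for n unfolding A_rel_def using f(1) by blast
    moreover have "(\<forall>n. \<exists>m. A_rel (guard_fun \<zeta> Z) n m) \<longrightarrow>
        (\<forall>n. A_rel (guard_fun \<zeta> Z) n (\<zeta> (guard_fun \<zeta> Z) n))"
      using \<zeta> unfolding NCC_def by (rule spec)
    ultimately have "A_rel (guard_fun \<zeta> Z) 0 (\<zeta> (guard_fun \<zeta> Z) 0)" by blast
    then obtain g where "guard_fun \<zeta> Z (code g (\<zeta> (guard_fun \<zeta> Z) 0) 0) = 0"
      unfolding A_rel_def by blast
    then show "\<zeta> (guard_fun \<zeta> Z) 0 \<noteq> ?m"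
      by (auto simp: guard_fun_def code_def split: if_splits)
  next
    assume *: "\<zeta> (guard_fun \<zeta> Z) 0 \<noteq> \<zeta> (\<lambda>_. 1) 0"
    show "\<exists>x. Z x = 0"
    proof (rule ccontr)
      assume "\<not> (\<exists>x. Z x = 0)"
      then have "guard_fun \<zeta> Z = (\<lambda>_. 1)" by (intro HOL.ext) (simp add: guard_fun_def)
      with * show False by simp
    qed
  qed
  then show ?thesis unfolding is_exists3_def exists3_fun_def by simp
qed

lemma ev_mu:
  assumes e: "e (two \<leadsto> one) 0 = F21 \<zeta>" and a: "\<And>n. ev a [Num n] (h n)"
  shows "ev (embe e mu_tm) [a] (mu_fun \<zeta> h)"
proof -
  let ?e = "ins one 0 a e"
  have "ev a [F1 f \<odot> OC Zero] (h (f 0))" for f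
    by (rule ev_arg[OF a]) (simp add: ev_Ap_iff ev_F1[OF ev_Zero])
  then have "ev (embe ?e (lam one (Var one 1 \<cdot> (Var one 0 \<cdot> zero_tm)))) [F1 f] (h (f 0))" for f
    by (intro ev_lam) (simp add: ev_Ap_iff)
  then have "ev (F21 \<zeta>) [embe ?e (lam one (Var one 1 \<cdot> (Var one 0 \<cdot> zero_tm))), OC Zero] (mu_fun \<zeta> h)"
    unfolding mu_fun_def by (intro ev_F21[OF _ ev_Zero]) simp_all
  then show ?thesis unfolding mu_tm_def by (intro ev_lam) (simp add: ev_Ap_iff e)
qed

lemma ev_dec:
  assumes e: "e (two \<leadsto> one) 0 = F21 \<zeta>" and a: "\<And>n. ev a [Num n] (f n)"
  shows "ev (embe e dec_tm) [a, Num n] (dec_fun \<zeta> f n)"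
proof -
  let ?e = "ins N 0 (Num n) (ins one 0 a e)"
  have "ev (embe ?e (lam N (Var one 0 \<cdot> (pair_tm \<cdot> Var N 1 \<cdot> Var N 0)))) [Num k]
      (f ((n + k) * (n + k) + k))" for k
  proof (rule ev_lam)
    have "ev (emb pair_tm \<odot> Num n \<odot> Num k) [] ((n + k) * (n + k) + k)"
      unfolding ev_Ap_iff by (rule ev_pair[OF ev_Num ev_Num])
    from ev_arg[OF a this] show "ev (embe (ins N 0 (Num k) ?e) (Var one 0 \<cdot> (pair_tm \<cdot> Var N 1 \<cdot> Var N 0))) []
        (f ((n + k) * (n + k) + k))"
      by (simp add: ev_Ap_iff)
  qed
  then have "ev (embe ?e mu_tm) [embe ?e (lam N (Var one 0 \<cdot> (pair_tm \<cdot> Var N 1 \<cdot> Var N 0)))]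
      (dec_fun \<zeta> f n)"
    unfolding dec_fun_def by (intro ev_mu) (simp_all add: e)
  then show ?thesis unfolding dec_tm_def by (intro ev_lam) (simp add: ev_Ap_iff)
qed

lemma ev_base:
  assumes "e (two \<leadsto> one) 0 = F21 \<zeta>"
  shows "ev (embe e base_tm) [] (\<zeta> (\<lambda>_. 1) 0)"
proof -
  have "ev (embe e one_fun_tm) [F1 f] 1" for f
    unfolding one_fun_tm_def by (rule ev_lam) (simp add: ev_One[unfolded One_nat_def])
  then have "ev (F21 \<zeta>) [embe e one_fun_tm, OC Zero] (\<zeta> (\<lambda>_. 1) 0)"
    by (intro ev_F21[OF _ ev_Zero]) simp_all
  then show ?thesis by (simp add: base_tm_def ev_Ap_iff assms)
qed

lemma ev_guard:
  assumes e: "e (two \<leadsto> one) 0 = F21 \<zeta>" "e two 0 = F2 Z"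
  shows "ev (embe e guard_tm) [F1 g] (guard_fun \<zeta> Z g)"
proof -
  let ?e = "ins one 0 (F1 g) e"
  let ?d = "dec_fun \<zeta> (\<lambda>i. g (Suc (Suc i)))"
  have "ev (embe ?e tail2_tm) [Num i] (g (Suc (Suc i)))" for i
    unfolding tail2_tm_def
    by (rule ev_lam) (simp add: ev_Ap_iff ev_F1[OF ev_suc[OF ev_suc[OF ev_Num]], unfolded ev_Ap_iff])
  then have "ev (embe ?e dec_tm) [embe ?e tail2_tm, Num n] (?d n)" for n
    by (intro ev_dec) (simp_all add: e)
  \<comment> \<open>The rule for \<open>F2\<close> asks for a value at every numeral. Decoding
    provides one for every \<open>g\<close>, because \<open>\<zeta>\<close> is total, even if the
    tail of \<open>g\<close> codes no function.\<close>
  then have Z: "ev (F2 Z) [embe ?e dec_tm \<odot> embe ?e tail2_tm] (Z ?d)"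
    by (intro ev_F2) (simp_all add: ev_Ap_iff)
  have "ev (embe ?e base_tm) [] (\<zeta> (\<lambda>_. 1) 0)" by (rule ev_base) (simp add: e)
  from ev_eqt[OF ev_Ap[OF ev_F1[OF ev_Zero HOL.refl]] ev_suc[OF this], of g]
  have "ev (OC Plus \<odot> (emb eqt_tm \<odot> (F1 g \<odot> OC Zero) \<odot> (OC Plus \<odot> embe ?e base_tm \<odot> OC One)) \<odot>
      (F2 Z \<odot> (embe ?e dec_tm \<odot> embe ?e tail2_tm))) []
      ((if g 0 = Suc (\<zeta> (\<lambda>_. 1) 0) then 0 else 1) + Z ?d)"
    using Z by (intro ev_Plus_Ap) (simp_all add: ev_Ap_iff)
  from ev_sg[OF this] have "ev (embe ?e (sg_tm \<cdot> plus_tm (eqt_tm \<cdot> (Var one 0 \<cdot> zero_tm) \<cdot> suc_tm base_tm)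
     (Var two 0 \<cdot> (dec_tm \<cdot> tail2_tm)))) [] (guard_fun \<zeta> Z g)"
    by (simp add: ev_Ap_iff guard_fun_def e split: if_splits)
  then show ?thesis unfolding guard_tm_def by (rule ev_lam)
qed

lemma T_term_exists3: "T_term ((two \<leadsto> one) \<leadsto> three) (lam (two \<leadsto> one) exists3_tm)"
proof -
  have mu: "below d mu_tm" if "0 < d (two \<leadsto> one)" for d
    unfolding mu_tm_def by (rule below_lam) (simp add: that below_lam)
  have dec: "below d dec_tm" if "0 < d (two \<leadsto> one)" for d
    unfolding dec_tm_def by (rule below_lam, rule below_lam) (simp add: that mu below_lam below_closed)
  have base: "below d base_tm" if "0 < d (two \<leadsto> one)" for d
    unfolding base_tm_def by (simp add: that below_closed)
  have guard: "below d guard_tm" if "0 < d (two \<leadsto> one)" "0 < d two" for d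
    unfolding guard_tm_def tail2_tm_def
    by (rule below_lam) (simp add: that dec base below_lam below_closed)
  have "closed_trm (lam (two \<leadsto> one) exists3_tm)"
    unfolding exists3_tm_def closed_below
    by (rule below_lam, rule below_lam) (simp add: guard base below_closed)
  then show ?thesis unfolding T_term_def by simp
qed

lemma ev_exists3:
  "ev (emb (lam (two \<leadsto> one) exists3_tm) \<odot> F21 \<zeta> \<odot> F2 Z) [] (exists3_fun \<zeta> Z)"
proof -
  define e where "e = ins two 0 (F2 Z) (ins (two \<leadsto> one) 0 (F21 \<zeta>) (\<lambda>_ _. OC Zero))"
  have e: "e (two \<leadsto> one) 0 = F21 \<zeta>" "e two 0 = F2 Z" by (simp_all add: e_def)
  have "ev (F21 \<zeta>) [embe e guard_tm, OC Zero] (\<zeta> (guard_fun \<zeta> Z) 0)"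
    using ev_guard[of e, OF e] by (intro ev_F21[OF _ ev_Zero]) simp_all
  then have "ev (F21 \<zeta> \<odot> embe e guard_tm \<odot> OC Zero) [] (\<zeta> (guard_fun \<zeta> Z) 0)"
    by (simp add: ev_Ap_iff)
  from ev_nsg[OF ev_Ap[OF ev_Ap[OF ev_eqt[OF this ev_base[of e, OF e(1)]]]]]
  have "ev (embe e (nsg_tm \<cdot> (eqt_tm \<cdot> (Var (two \<leadsto> one) 0 \<cdot> guard_tm \<cdot> zero_tm) \<cdot> base_tm))) []
      (exists3_fun \<zeta> Z)"
    by (simp add: ev_Ap_iff exists3_fun_def e split: if_splits)
  then have "ev (embe (\<lambda>_ _. OC Zero) (lam (two \<leadsto> one) exists3_tm)) [F21 \<zeta>, F2 Z] (exists3_fun \<zeta> Z)"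
    unfolding exists3_tm_def e_def by (intro ev_lam)
  moreover have "closed_trm (lam (two \<leadsto> one) exists3_tm)"
    using T_term_exists3 by (simp add: T_term_def)
  ultimately show ?thesis by (simp add: embe_closed ev_Ap_iff)
qed

theorem theorem4p5:
  shows "(\<exists>t. T_term (three \<leadsto> two \<leadsto> N \<leadsto> N \<leadsto> N) t \<and>
            (\<forall>E. is_exists3 E \<longrightarrow>
               (\<exists>\<zeta>. NCC \<zeta> \<and> (\<forall>Y n. mu_ev (emb t \<odot> F3 E \<odot> F2 Y \<odot> Num n) (\<zeta> Y n)))))
       \<and> (\<exists>s. T_term ((two \<leadsto> one) \<leadsto> three) s \<and>
            (\<forall>\<zeta>. NCC \<zeta> \<longrightarrow>
               (\<exists>E. is_exists3 E \<and> (\<forall>Y. ev (emb s \<odot> F21 \<zeta> \<odot> F2 Y) [] (E Y)))))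
       \<and> {} \<turnstile> Iff (Ex (two \<leadsto> one) NCC_fm) exists3_fm"
proof (intro conjI)
  show "\<exists>t. T_term (three \<leadsto> two \<leadsto> N \<leadsto> N \<leadsto> N) t \<and>
      (\<forall>E. is_exists3 E \<longrightarrow>
         (\<exists>\<zeta>. NCC \<zeta> \<and> (\<forall>Y n. mu_ev (emb t \<odot> F3 E \<odot> F2 Y \<odot> Num n) (\<zeta> Y n))))"
    by (intro exI[of _ search_tm] conjI allI impI T_term_search zeta_of_exists3)
  show "\<exists>s. T_term ((two \<leadsto> one) \<leadsto> three) s \<and>
      (\<forall>\<zeta>. NCC \<zeta> \<longrightarrow> (\<exists>E. is_exists3 E \<and> (\<forall>Y. ev (emb s \<odot> F21 \<zeta> \<odot> F2 Y) [] (E Y))))"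
  proof (intro exI[of _ "lam (two \<leadsto> one) exists3_tm"] conjI allI impI)
    fix \<zeta> assume "NCC \<zeta>"
    then show "\<exists>E. is_exists3 E \<and>
        (\<forall>Y. ev (emb (lam (two \<leadsto> one) exists3_tm) \<odot> F21 \<zeta> \<odot> F2 Y) [] (E Y))"
      by (intro exI[of _ "exists3_fun \<zeta>"] conjI allI is_exists3_exists3_fun ev_exists3)
  qed (rule T_term_exists3)
  show "{} \<turnstile> Iff (Ex (two \<leadsto> one) NCC_fm) exists3_fm" by (rule NCC_iff_exists3)
qed

end
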